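(* Let $(\mathcal M,\tau)$ be a $W^*$-noncommutative probability space and let $x\in\mathcal M$ be a nonzero $R$-diagonal element with non-trivial kernel. Let $p_1$ be the projection onto $\ker x$, $p_2=1-p_1$, and $\mathcal D=\mathrm{Span}\{p_1,p_2\}$. Then the polar decomposition $x=vh$ of $x$ satisfies: - $v$ and $h$ are free with amalgamation over $\mathcal D$; - $v$ has the $\mathcal D$-distribution of $up_2$, where $u$ is a Haar unitary which is $\tau$-free with $p_2$; - the $\mathcal D$-distribution of $h$ is determined by the facts that $h^2=x^*x$ and $p_2hp_2=h$. Moreover, the projection onto the final subspace of $v$ is $\tau$-free with $h$.
   Context: $(\mathcal M,\tau)$ is a von Neumann algebra with faithful normal tracial state. The polar decomposition of $x\in\mathcal M$ is $x=vh$ with $h\ge0$, $\ker h=\ker x$, and $v$ a partial isometry with initial space $(\ker x)^\perp$ and final space the closure of the image of $x$. A Haar unitary is a unitary $u$ with $\tau(u^n)=0$ for all $n\in\mathbb Z\setminus\{0\}$. An element $x$ is $R$-diagonal if it can be written $x=uh$ with $u$ a Haar unitary and $h$ positive, $u$ and $h$ being $\tau$-free (Nica–Speicher characterization). $\tau$-freeness is ordinary freeness with respect to $\tau$ (of the generated $*$-subalgebras). The conditional expectation $E:\mathcal M\to\mathcal D$ is $E(a)=\sum_{i=1}^2\frac{\tau(p_iap_i)}{\tau(p_i)}p_i$. $*$-subalgebras $(\mathcal A_i)_{i\in I}$ containing $\mathcal D$ are free with amalgamation over $\mathcal D$ if $E(x(1)\cdots x(n))=0$ whenever $i_1\ne i_2\ne\cdots\ne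 i_n$ (consecutive indices distinct) and $x(j)\in\mathcal A_{i_j}\cap\ker E$; elements are free with amalgamation over $\mathcal D$ if they belong respectively to such $*$-subalgebras. The $\mathcal D$-distribution of an element $a$ is the map sending each word $X^{\epsilon_0}d_0X^{\epsilon_1}d_1\cdots X^{\epsilon_n}d_n$ ($d_j\in\mathcal D$, $\epsilon_j\in\{1,*\}$) to $E(a^{\epsilon_0}d_0\cdots a^{\epsilon_n}d_n)$. *)

theory Defs
  imports "HOL-Analysis.Analysis" "HOL-Library.FuncSet" "HOL-Library.Nonpos_Ints"
begin

class scaleC =
  fixes scaleC :: "complex \<Rightarrow> 'a \<Rightarrow> 'a" (infixr "*\<^sub>C" 75)

text \<open>The inner product is conjugate linear in its first argument. The underlying real Hilbert
  space carries the norm, the topology and completeness; positive definiteness of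
  \<open>cinner\<close> is that of its real part \<open>inner\<close>.\<close>

class chilbert_space = scaleC + real_inner + complete_space +
  fixes cinner :: "'a \<Rightarrow> 'a \<Rightarrow> complex"
  assumes scaleC_add_right: "c *\<^sub>C (x + y) = c *\<^sub>C x + c *\<^sub>C y"
    and scaleC_add_left: "(c + d) *\<^sub>C x = c *\<^sub>C x + d *\<^sub>C x"
    and scaleC_scaleC: "c *\<^sub>C d *\<^sub>C x = (c * d) *\<^sub>C x"
    and scaleR_scaleC: "r *\<^sub>R x = complex_of_real r *\<^sub>C x"
    and cinner_commute: "cinner x y = cnj (cinner y x)"
    and cinner_add_right: "cinner x (y + z) = cinner x y + cinner x z"
    and cinner_scaleC_right: "cinner x (c *\<^sub>C y) = c * cinner x y"
    and inner_cinner: "inner x y = Re (cinner x y)"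

lemma bounded_linear_scaleC: "bounded_linear (\<lambda>x::'a::chilbert_space. c *\<^sub>C x)"
proof (rule bounded_linear_intro)
  fix x y :: 'a and r :: real
  show "c *\<^sub>C (x + y) = c *\<^sub>C x + c *\<^sub>C y"
    by (rule scaleC_add_right)
  show "c *\<^sub>C (r *\<^sub>R x) = r *\<^sub>R (c *\<^sub>C x)"
    by (simp add: scaleR_scaleC scaleC_scaleC mult.commute)
  have left: "cinner (d *\<^sub>C z) w = cnj d * cinner z w" for d and z w :: 'a
    by (metis cinner_commute cinner_scaleC_right complex_cnj_mult)
  have "(norm (c *\<^sub>C x))\<^sup>2 = Re (cinner (c *\<^sub>C x) (c *\<^sub>C x))"
    by (simp add: power2_norm_eq_inner inner_cinner)
  also have "\<dots> = Re ((cmod c)\<^sup>2 * cinner x x)"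
    by (simp add: left cinner_scaleC_right complex_norm_square mult_ac del: of_real_power)
  also have "\<dots> = (norm x * cmod c)\<^sup>2"
    by (simp add: power2_norm_eq_inner inner_cinner power_mult_distrib mult.commute
        flip: of_real_power)
  finally show "norm (c *\<^sub>C x) \<le> norm x * cmod c"
    by (simp add: power2_eq_iff_nonneg)
qed

definition ocompl :: "'a::chilbert_space set \<Rightarrow> 'a set" where
  "ocompl S = {\<xi>. \<forall>\<eta>\<in>S. cinner \<eta> \<xi> = 0}"

typedef (overloaded) ('a::chilbert_space) bop =
  "{f :: 'a \<Rightarrow> 'a. bounded_linear f \<and> (\<forall>c \<xi>. f (c *\<^sub>C \<xi>) = c *\<^sub>C f \<xi>)}"
  morphisms ap Bop
  by (rule exI[of _ "\<lambda>\<xi>. \<xi>"]) simp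

setup_lifting type_definition_bop

instantiation bop :: (chilbert_space) "{ring, monoid_mult, scaleC}"
begin

lift_definition zero_bop :: "'a bop" is "\<lambda>\<xi>. 0"
  by (metis (mono_tags) bounded_linear_zero bounded_linear.linear linear_0 bounded_linear_scaleC)
lift_definition one_bop :: "'a bop" is "\<lambda>\<xi>. \<xi>"
  by simp
lift_definition plus_bop :: "'a bop \<Rightarrow> 'a bop \<Rightarrow> 'a bop" is "\<lambda>a b \<xi>. a \<xi> + b \<xi>"
  by (auto intro: bounded_linear_add simp: scaleC_add_right)
lift_definition uminus_bop :: "'a bop \<Rightarrow> 'a bop" is "\<lambda>a \<xi>. - a \<xi>"
  by (auto intro: bounded_linear_minus
      simp: linear_neg[OF bounded_linear.linear[OF bounded_linear_scaleC]])
lift_definition minus_bop :: "'a bop \<Rightarrow> 'a bop \<Rightarrow> 'a bop" is "\<lambda>a b \<xi>. a \<xi> - b \<xi>"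
  by (auto intro: bounded_linear_sub
      simp: linear_diff[OF bounded_linear.linear[OF bounded_linear_scaleC]])
lift_definition times_bop :: "'a bop \<Rightarrow> 'a bop \<Rightarrow> 'a bop" is "\<lambda>a b \<xi>. a (b \<xi>)"
  by (auto intro: bounded_linear_compose)
lift_definition scaleC_bop :: "complex \<Rightarrow> 'a bop \<Rightarrow> 'a bop" is "\<lambda>c a \<xi>. c *\<^sub>C a \<xi>"
  by (auto intro: bounded_linear_compose[OF bounded_linear_scaleC]
      simp: scaleC_scaleC mult.commute)

instance
proof
  fix a b c :: "'a bop"
  show "a * (b + c) = a * b + a * c"
    by transfer (auto simp: linear_add[OF bounded_linear.linear])
qed (transfer; auto simp: fun_eq_iff algebra_simps; fail)+

end

definition adj :: "'a::chilbert_space bop \<Rightarrow> 'a bop" where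
  "adj a = (THE b. \<forall>\<xi> \<eta>. cinner (ap b \<xi>) \<eta> = cinner \<xi> (ap a \<eta>))"

definition self_adj :: "'a::chilbert_space bop \<Rightarrow> bool" where
  "self_adj a \<longleftrightarrow> adj a = a"

definition positive_op :: "'a::chilbert_space bop \<Rightarrow> bool" where
  "positive_op a \<longleftrightarrow> (\<forall>\<xi>. cinner \<xi> (ap a \<xi>) \<in> \<real>\<^sub>\<ge>\<^sub>0)"

definition op_le :: "'a::chilbert_space bop \<Rightarrow> 'a bop \<Rightarrow> bool" where
  "op_le a b \<longleftrightarrow> positive_op (b - a)"

definition unitary :: "'a::chilbert_space bop \<Rightarrow> bool" where
  "unitary u \<longleftrightarrow> adj u * u = 1 \<and> u * adj u = 1"

definition ker_op :: "'a::chilbert_space bop \<Rightarrow> 'a set" where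
  "ker_op a = {\<xi>. ap a \<xi> = 0}"

definition Proj :: "'a::chilbert_space set \<Rightarrow> 'a bop" where
  "Proj S = (THE p. self_adj p \<and> p * p = p \<and> range (ap p) = S)"

definition initial_space :: "'a::chilbert_space bop \<Rightarrow> 'a set" where
  "initial_space v = ocompl (ker_op v)"

definition final_space :: "'a::chilbert_space bop \<Rightarrow> 'a set" where
  "final_space v = range (ap v)"

definition partial_isometry :: "'a::chilbert_space bop \<Rightarrow> bool" where
  "partial_isometry v \<longleftrightarrow> (\<forall>\<xi>\<in>initial_space v. norm (ap v \<xi>) = norm \<xi>)"

definition polar_decomposition :: "'a::chilbert_space bop \<Rightarrow> 'a bop \<Rightarrow> 'a bop \<Rightarrow> bool" where
  "polar_decomposition x v h \<longleftrightarrow>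
     x = v * h \<and> positive_op h \<and> ker_op h = ker_op x \<and>
     partial_isometry v \<and> initial_space v = ocompl (ker_op x) \<and>
     final_space v = closure (range (ap x))"

definition star_subalgebra :: "'a::chilbert_space bop set \<Rightarrow> bool" where
  "star_subalgebra A \<longleftrightarrow> 1 \<in> A \<and>
     (\<forall>a\<in>A. \<forall>b\<in>A. a + b \<in> A \<and> a * b \<in> A) \<and>
     (\<forall>c. \<forall>a\<in>A. c *\<^sub>C a \<in> A) \<and> (\<forall>a\<in>A. adj a \<in> A)"

definition generated_star_subalgebra :: "'a::chilbert_space bop set \<Rightarrow> 'a bop set" where
  "generated_star_subalgebra S = star_subalgebra hull S"

definition commutant :: "'a::chilbert_space bop set \<Rightarrow> 'a bop set" where
  "commutant S = {b. \<forall>a\<in>S. a * b = b * a}"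

definition von_neumann_algebra :: "'a::chilbert_space bop set \<Rightarrow> bool" where
  "von_neumann_algebra M \<longleftrightarrow> star_subalgebra M \<and> commutant (commutant M) = M"

text \<open>A functional is only ever constrained on \<open>M\<close>; its values elsewhere are irrelevant.\<close>

definition tracial_state_on :: "'a::chilbert_space bop set \<Rightarrow> ('a bop \<Rightarrow> complex) \<Rightarrow> bool" where
  "tracial_state_on M \<tau> \<longleftrightarrow>
     (\<forall>a\<in>M. \<forall>b\<in>M. \<tau> (a + b) = \<tau> a + \<tau> b) \<and>
     (\<forall>c. \<forall>a\<in>M. \<tau> (c *\<^sub>C a) = c * \<tau> a) \<and>
     \<tau> 1 = 1 \<and>
     (\<forall>a\<in>M. \<tau> (adj a * a) \<in> \<real>\<^sub>\<ge>\<^sub>0) \<and>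
     (\<forall>a\<in>M. \<forall>b\<in>M. \<tau> (a * b) = \<tau> (b * a))"

definition faithful_on :: "'a::chilbert_space bop set \<Rightarrow> ('a bop \<Rightarrow> complex) \<Rightarrow> bool" where
  "faithful_on M \<tau> \<longleftrightarrow> (\<forall>a\<in>M. \<tau> (adj a * a) = 0 \<longrightarrow> a = 0)"

definition is_sup_in :: "'a::chilbert_space bop set \<Rightarrow> 'a bop set \<Rightarrow> 'a bop \<Rightarrow> bool" where
  "is_sup_in M S s \<longleftrightarrow> s \<in> M \<and> self_adj s \<and> (\<forall>a\<in>S. op_le a s) \<and>
     (\<forall>t\<in>M. self_adj t \<and> (\<forall>a\<in>S. op_le a t) \<longrightarrow> op_le s t)"

text \<open>Normality: \<open>\<tau>\<close> preserves suprema of increasing nets of self-adjoint elements of \<open>M\<close>,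
  nets being represented by their (upward directed) ranges.\<close>

definition normal_on :: "'a::chilbert_space bop set \<Rightarrow> ('a bop \<Rightarrow> complex) \<Rightarrow> bool" where
  "normal_on M \<tau> \<longleftrightarrow>
     (\<forall>S s. S \<noteq> {} \<and> S \<subseteq> {a\<in>M. self_adj a} \<and>
        (\<forall>a\<in>S. \<forall>b\<in>S. \<exists>c\<in>S. op_le a c \<and> op_le b c) \<and> is_sup_in M S s \<longrightarrow>
        Re (\<tau> s) = (SUP a\<in>S. Re (\<tau> a)))"

definition wstar_prob_space :: "'a::chilbert_space bop set \<Rightarrow> ('a bop \<Rightarrow> complex) \<Rightarrow> bool" where
  "wstar_prob_space M \<tau> \<longleftrightarrow>
     von_neumann_algebra M \<and> tracial_state_on M \<tau> \<and> faithful_on M \<tau> \<and> normal_on M \<tau>"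

text \<open>A word \<open>(i\<^sub>1,x(1)) \<dots> (i\<^sub>n,x(n))\<close> is a nonempty list of pairs. With \<open>E = \<tau>\<close>
  scalar valued this is ordinary freeness; with \<open>E\<close> a conditional expectation onto \<open>D\<close>,
  and all \<open>A i\<close> containing \<open>D\<close>, it is freeness with amalgamation over \<open>D\<close>.\<close>

definition free_wrt :: "('m::monoid_mult \<Rightarrow> 'b::zero) \<Rightarrow> 'i set \<Rightarrow> ('i \<Rightarrow> 'm set) \<Rightarrow> bool" where
  "free_wrt E I A \<longleftrightarrow>
     (\<forall>w. w \<noteq> [] \<and> distinct_adj (map fst w) \<and>
          (\<forall>(i, a)\<in>set w. i \<in> I \<and> a \<in> A i \<and> E a = 0) \<longrightarrow>
        E (prod_list (map snd w)) = 0)"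

definition tau_free :: "('a::chilbert_space bop \<Rightarrow> complex) \<Rightarrow> 'a bop list \<Rightarrow> bool" where
  "tau_free \<tau> as \<longleftrightarrow>
     free_wrt \<tau> {..<length as} (\<lambda>i. generated_star_subalgebra {as ! i})"

definition amalgamated_free ::
  "'a::chilbert_space bop set \<Rightarrow> 'a bop set \<Rightarrow> ('a bop \<Rightarrow> 'a bop) \<Rightarrow> 'a bop list \<Rightarrow> bool" where
  "amalgamated_free M D E as \<longleftrightarrow>
     (\<exists>A. (\<forall>i<length as. star_subalgebra (A i) \<and> D \<subseteq> A i \<and> A i \<subseteq> M \<and> as ! i \<in> A i) \<and>
          free_wrt E {..<length as} A)"

definition span2 :: "'a::chilbert_space bop \<Rightarrow> 'a bop \<Rightarrow> 'a bop set" where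
  "span2 p1 p2 = {c1 *\<^sub>C p1 + c2 *\<^sub>C p2 | c1 c2. True}"

definition cond_exp ::
  "('a::chilbert_space bop \<Rightarrow> complex) \<Rightarrow> 'a bop \<Rightarrow> 'a bop \<Rightarrow> 'a bop \<Rightarrow> 'a bop" where
  "cond_exp \<tau> p1 p2 a =
     (\<tau> (p1 * a * p1) / \<tau> p1) *\<^sub>C p1 + (\<tau> (p2 * a * p2) / \<tau> p2) *\<^sub>C p2"

text \<open>The word \<open>X\<^bsup>\<epsilon>\<^sub>0\<^esup> d\<^sub>0 \<dots> X\<^bsup>\<epsilon>\<^sub>n\<^esup> d\<^sub>n\<close> is the list \<open>[(\<epsilon>\<^sub>0,d\<^sub>0), \<dots>, (\<epsilon>\<^sub>n,d\<^sub>n)]\<close>, where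
  \<open>True\<close> stands for the exponent \<open>*\<close>. The map is restricted to words with letters in \<open>D\<close>,
  so that equality of distributions is equality of functions.\<close>

definition D_distribution ::
  "'a::chilbert_space bop set \<Rightarrow> ('a bop \<Rightarrow> 'a bop) \<Rightarrow> 'a bop \<Rightarrow> (bool \<times> 'a bop) list \<Rightarrow> 'a bop"
  where
  "D_distribution D E a =
     (\<lambda>w\<in>{w. w \<noteq> [] \<and> snd ` set w \<subseteq> D}.
        E (prod_list (map (\<lambda>(star, d). (if star then adj a else a) * d) w)))"

text \<open>Negative powers of a unitary are powers of its adjoint.\<close>

definition haar_unitary :: "('a::chilbert_space bop \<Rightarrow> complex) \<Rightarrow> 'a bop \<Rightarrow> bool" where
  "haar_unitary \<tau> u \<longleftrightarrow> unitary u \<and> (\<forall>n::nat. n > 0 \<longrightarrow> \<tau> (u ^ n) = 0 \<and> \<tau> (adj u ^ n) = 0)"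

definition R_diagonal ::
  "'a::chilbert_space bop set \<Rightarrow> ('a bop \<Rightarrow> complex) \<Rightarrow> 'a bop \<Rightarrow> bool" where
  "R_diagonal M \<tau> x \<longleftrightarrow>
     (\<exists>u\<in>M. \<exists>h\<in>M. haar_unitary \<tau> u \<and> positive_op h \<and> tau_free \<tau> [u, h] \<and> x = u * h)"

end

theory Submission
  imports Defs
begin

text \<open>
  Write \<open>x = u h\<^sub>0\<close> with \<open>u\<close> a Haar unitary free from \<open>h\<^sub>0 \<ge> 0\<close>. Uniqueness of positive square
  roots and of the polar decomposition gives \<open>h = h\<^sub>0\<close> and \<open>v = u p\<^sub>2\<close>. The projection \<open>p\<^sub>2\<close> is the
  limit of the polynomials \<open>1 - (1 - h/r)\<^sup>n\<close> in \<open>h\<close>, strongly and, by normality, in the 2-norm, so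
  \<open>u\<close> is also free from an algebra \<open>B\<close> containing \<open>h\<close> and \<open>p\<^sub>2\<close>. Every element of the algebra
  generated by \<open>u\<close> and \<open>p\<^sub>2\<close> is an element of \<open>D\<close> plus a sum of alternating words in centred elements
  that contain a letter from the algebra of \<open>u\<close>; since \<open>B \<inter> ker E\<close> absorbs \<open>D\<close>, products
  of such words with elements of \<open>B\<close> have no component in \<open>D\<close>, which is freeness over \<open>D\<close>. The
  \<open>D\<close>-distribution of \<open>u p\<^sub>2\<close> is determined because freeness determines joint moments, that of \<open>h\<close>
  because \<open>h\<close> is a limit of polynomials in \<open>h\<^sup>2\<close>, and \<open>v v\<^sup>* = u p\<^sub>2 u\<^sup>*\<close> is free from \<open>h\<close> because
  \<open>u B u\<^sup>*\<close> is free from \<open>B\<close>.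
\<close>

subsection \<open>Orthogonal projection and adjoints\<close>

text \<open>The difficulty lies between two kinds of centring: freeness of \<open>u\<close> and
  \<open>h\<close> speaks of letters of trace zero, freeness over \<open>D\<close> of letters
  annihilated by \<open>E\<close>. The position of \<open>p1\<close> reconciles them. Since
  \<open>h\<close> vanishes on the range of \<open>p1\<close>, limits of polynomials in
  \<open>h\<close> act on \<open>p1\<close> as scalars. Hence an element of \<open>B\<close> in the
  kernel of \<open>E\<close> lies in the corner cut out by \<open>p2\<close>, has trace zero, and is
  merely rescaled by coefficients from \<open>D\<close>. Nothing similar holds for the algebra of
  \<open>u\<close> and \<open>p2\<close>, which is why its elements have to be rewritten as words.
  Spectral calculus is replaced by explicit sequences: square roots come from a contraction, kernel
  projections from powers of \<open>1 - k\<close>, odd moments from a polynomial iteration in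
  \<open>k * k\<close>. An operator norm bound accompanies every 2-norm limit, because
  multiplication is jointly continuous for the 2-norm only on bounded sets. Faithfulness of
  \<open>\<tau>\<close> makes the two denominators in \<open>E\<close> nonzero.\<close>

instance chilbert_space < banach ..

lemma cinner_scaleC_left: "cinner (c *\<^sub>C x) y = cnj c * cinner x y"
  for x y :: "'a::chilbert_space"
  by (metis cinner_commute cinner_scaleC_right complex_cnj_mult)

text \<open>Since Im z = Re (- i z), the real inner product determines the complex one. Hilbert
  space arguments can therefore be run with \<open>inner\<close> and transferred to
  \<open>cinner\<close> at the end.\<close>

lemma cinner_eq: "cinner x y = Complex (inner x y) (inner x ((- \<i>) *\<^sub>C y))"
  for x y :: "'a::chilbert_space"
  by (simp add: complex_eq_iff inner_cinner cinner_scaleC_right)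

lemma inner_scaleC_left: "inner (c *\<^sub>C x) y = inner x (cnj c *\<^sub>C y)"
  for x y :: "'a::chilbert_space"
  by (simp add: inner_cinner cinner_scaleC_right cinner_scaleC_left)

lemma scaleC_zero_left [simp]: "0 *\<^sub>C x = 0" for x :: "'a::chilbert_space"
  using scaleR_scaleC[of 0 x] by simp

lemma scaleC_one [simp]: "1 *\<^sub>C x = x" for x :: "'a::chilbert_space"
  using scaleR_scaleC[of 1 x] by simp

lemma cinner_cnj_eq_0: "cinner x y = 0 \<longleftrightarrow> cinner y x = 0" for x y :: "'a::chilbert_space"
  by (metis cinner_commute complex_cnj_zero_iff)

lemma inner_ortho_imp_cinner:
  fixes x :: "'a::chilbert_space"
  assumes "\<And>c z. z \<in> S \<Longrightarrow> c *\<^sub>C z \<in> S" and "\<And>z. z \<in> S \<Longrightarrow> inner x z = 0" and "z \<in> S"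
  shows "cinner z x = 0"
proof -
  have "cinner x z = 0"
    using assms by (simp add: cinner_eq complex_eq_iff)
  then show ?thesis
    by (metis cinner_cnj_eq_0)
qed

text \<open>A minimizing sequence for the distance to \<open>S\<close> converges, and varying its
  limit along \<open>S\<close> yields orthogonality.\<close>

lemma projection_theorem:
  fixes S :: "'a::{real_inner,complete_space} set"
  assumes S: "subspace S" "closed S"
  obtains y where "y \<in> S" and "\<And>z. z \<in> S \<Longrightarrow> inner (x - y) z = 0"
proof -
  define d where "d = (INF y\<in>S. (norm (x - y))\<^sup>2)"
  have ne: "S \<noteq> {}"
    using S(1) subspace_0 by blast
  have bdd: "bdd_below ((\<lambda>y. (norm (x - y))\<^sup>2) ` S)"
    by (rule bdd_belowI[of _ 0]) auto
  have dle: "d \<le> (norm (x - y))\<^sup>2" if "y \<in> S" for y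
    unfolding d_def using bdd that by (rule cINF_lower)
  have "\<exists>y\<in>S. (norm (x - y))\<^sup>2 < d + inverse (real (Suc n))" for n
  proof -
    have "d < d + inverse (real (Suc n))" by simp
    then show ?thesis
      unfolding d_def using cINF_less_iff[OF ne bdd] by blast
  qed
  then obtain Y where YS: "\<And>n. Y n \<in> S"
    and Y: "\<And>n. (norm (x - Y n))\<^sup>2 < d + inverse (real (Suc n))"
    by metis
  \<comment> \<open>The midpoint \<open>w\<close> lies in \<open>S\<close>, so its squared distance
    from \<open>x\<close> is at least \<open>d\<close>; the parallelogram identity then bounds the
    distance of two terms of the sequence.\<close>
  have par: "(norm (Y m - Y n))\<^sup>2 \<le> 2 * inverse (real (Suc m)) + 2 * inverse (real (Suc n))" for m n
  proof -
    define w where "w = (1/2) *\<^sub>R (Y m + Y n)"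
    have "w \<in> S"
      unfolding w_def using S(1) YS by (intro subspace_scale subspace_add)
    have "(norm (Y m - Y n))\<^sup>2 + 4 * (norm (x - w))\<^sup>2 = 2 * (norm (x - Y m))\<^sup>2 + 2 * (norm (x - Y n))\<^sup>2"
      unfolding w_def power2_norm_eq_inner
      by (simp add: inner_diff_left inner_diff_right inner_add_left inner_add_right inner_commute
          algebra_simps)
    then show ?thesis
      using dle[OF \<open>w \<in> S\<close>] Y[of m] Y[of n] by linarith
  qed
  have "Cauchy Y"
  proof (rule CauchyI)
    fix e :: real assume e: "e > 0"
    then obtain K where K: "inverse (real (Suc K)) < e\<^sup>2 / 4"
      using reals_Archimedean[of "e\<^sup>2/4"] by auto
    have "norm (Y m - Y n) < e" if "m \<ge> K" "n \<ge> K" for m n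
    proof -
      have "inverse (real (Suc m)) \<le> inverse (real (Suc K))" "inverse (real (Suc n)) \<le> inverse (real (Suc K))"
        using that by auto
      then have "(norm (Y m - Y n))\<^sup>2 < e\<^sup>2"
        using par[of m n] K by linarith
      then show ?thesis
        using e power_less_imp_less_base by fastforce
    qed
    then show "\<exists>M. \<forall>m\<ge>M. \<forall>n\<ge>M. norm (Y m - Y n) < e" by blast
  qed
  then obtain y where lim: "Y \<longlonglongrightarrow> y"
    using Cauchy_convergent_iff convergent_def by blast
  have yS: "y \<in> S"
    using S(2) YS lim closed_sequentially by blast
  have "(\<lambda>n. (norm (x - Y n))\<^sup>2) \<longlonglongrightarrow> (norm (x - y))\<^sup>2"
    by (intro tendsto_intros lim)
  moreover have "(\<lambda>n. d + inverse (real (Suc n))) \<longlonglongrightarrow> d + 0"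
    by (intro tendsto_intros LIMSEQ_inverse_real_of_nat)
  ultimately have min: "(norm (x - y))\<^sup>2 \<le> d"
    using Y by (intro LIMSEQ_le) (auto intro: less_imp_le)
  have "inner (x - y) z = 0" if z: "z \<in> S" for z
  proof (cases "z = 0")
    case False
    \<comment> \<open>This \<open>t\<close> minimizes the quadratic polynomial obtained by moving
      from \<open>y\<close> along \<open>z\<close>.\<close>
    define t where "t = inner (x - y) z / inner z z"
    have "y + t *\<^sub>R z \<in> S"
      using S(1) yS z by (intro subspace_add subspace_scale)
    then have "(norm (x - y))\<^sup>2 \<le> (norm (x - (y + t *\<^sub>R z)))\<^sup>2"
      using dle min by (meson order_trans)
    also have "\<dots> = (norm (x - y))\<^sup>2 - 2 * t * inner (x - y) z + t\<^sup>2 * inner z z"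
      unfolding power2_norm_eq_inner
      by (simp add: inner_diff_left inner_diff_right inner_add_left inner_add_right inner_commute
          algebra_simps power2_eq_square)
    also have "\<dots> = (norm (x - y))\<^sup>2 - (inner (x - y) z)\<^sup>2 / inner z z"
      using False by (simp add: t_def field_simps power2_eq_square)
    finally have "(inner (x - y) z)\<^sup>2 / inner z z \<le> 0" by simp
    moreover have "inner z z > 0" using False by simp
    ultimately have "(inner (x - y) z)\<^sup>2 \<le> 0" by (simp add: pos_divide_le_eq)
    then show ?thesis by simp
  qed simp
  with yS show thesis by (rule that)
qed

text \<open>The orthogonal complement of the kernel of a nonzero \<open>f\<close> is a line; a
  vector \<open>z\<close> spanning it represents \<open>f\<close> after rescaling.\<close>

lemma riesz_representation:
  fixes f :: "'a::{real_inner,complete_space} \<Rightarrow> real"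
  assumes "bounded_linear f"
  obtains y where "\<And>w. f w = inner y w"
proof (cases "\<forall>w. f w = 0")
  case True
  then show thesis by (intro that[of 0]) simp
next
  case False
  then obtain x where x: "f x \<noteq> 0" by blast
  interpret bounded_linear f by fact
  have "subspace {w. f w = 0}"
    by (auto simp: subspace_def add scaleR)
  moreover have "closed {w. f w = 0}"
    by (intro closed_Collect_eq continuous_on continuous_on_const) (auto intro: tendsto)
  ultimately obtain p where p: "f p = 0" and ort: "\<And>w. f w = 0 \<Longrightarrow> inner (x - p) w = 0"
    using projection_theorem[of "{w. f w = 0}" x] by auto
  define z where "z = x - p"
  have fz: "f z \<noteq> 0" using x p by (simp add: z_def diff)
  then have zz: "inner z z \<noteq> 0" by auto
  have "f w = inner ((f z / inner z z) *\<^sub>R z) w" for w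
  proof -
    have "f (w - (f w / f z) *\<^sub>R z) = 0"
      using fz by (simp add: diff scaleR)
    then have "inner z (w - (f w / f z) *\<^sub>R z) = 0"
      using ort unfolding z_def by blast
    then show ?thesis
      using fz zz by (simp add: inner_diff_right field_simps)
  qed
  then show thesis by (rule that)
qed

section \<open>Bounded operators as a Banach algebra\<close>

lemma bounded_linear_ap [simp]: "bounded_linear (ap a)"
  using ap[of a] by simp

lemma ap_scaleC [simp]: "ap a (c *\<^sub>C \<xi>) = c *\<^sub>C ap a \<xi>"
  using ap[of a] by simp

lemma linear_ap: "linear (ap a)"
  by (simp add: bounded_linear.linear)

lemmas ap_add [simp] = linear_add[OF linear_ap]
  and ap_diff [simp] = linear_diff[OF linear_ap]
  and ap_minus [simp] = linear_neg[OF linear_ap]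
  and ap_zero [simp] = linear_0[OF linear_ap]
  and ap_scaleR [simp] = linear_scale[OF linear_ap]

lemma ap_bop [simp]:
  "ap 0 \<xi> = 0" "ap 1 \<xi> = \<xi>" "ap (a + b) \<xi> = ap a \<xi> + ap b \<xi>" "ap (- a) \<xi> = - ap a \<xi>"
  "ap (a - b) \<xi> = ap a \<xi> - ap b \<xi>" "ap (a * b) \<xi> = ap a (ap b \<xi>)" "ap (c *\<^sub>C a) \<xi> = c *\<^sub>C ap a \<xi>"
  by (transfer; simp)+

lemma bop_eqI: "(\<And>\<xi>. ap a \<xi> = ap b \<xi>) \<Longrightarrow> a = b"
  by transfer auto

lemma continuous_ap: "(X \<longlongrightarrow> l) F \<Longrightarrow> ((\<lambda>n. ap a (X n)) \<longlongrightarrow> ap a l) F"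
  by (rule bounded_linear.tendsto[OF bounded_linear_ap])

lemma scaleC_bop_simps [simp]:
  fixes a b :: "'a::chilbert_space bop"
  shows "(c *\<^sub>C a) * b = c *\<^sub>C (a * b)" "a * (c *\<^sub>C b) = c *\<^sub>C (a * b)"
    "c *\<^sub>C d *\<^sub>C a = (c * d) *\<^sub>C a" "0 *\<^sub>C a = 0" "1 *\<^sub>C a = a" "c *\<^sub>C (0 :: 'a bop) = 0"
    and scaleC_bop_add: "c *\<^sub>C (a + b) = c *\<^sub>C a + c *\<^sub>C b" "(c + d) *\<^sub>C a = c *\<^sub>C a + d *\<^sub>C a"
    and scaleC_bop_diff: "c *\<^sub>C (a - b) = c *\<^sub>C a - c *\<^sub>C b" "(c - d) *\<^sub>C a = c *\<^sub>C a - d *\<^sub>C a"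
    and scaleC_bop_minus: "(- c) *\<^sub>C a = - (c *\<^sub>C a)" "c *\<^sub>C (- a) = - (c *\<^sub>C a)"
proof -
  have min: "(- c) *\<^sub>C x = - (c *\<^sub>C x)" "c *\<^sub>C (- x) = - (c *\<^sub>C x)" for x :: 'a and c
    using linear_neg[OF bounded_linear.linear[OF bounded_linear_scaleC], of c x]
      scaleC_add_left[of c "- c" x] by (auto simp: add_eq_0_iff)
  have dif: "c *\<^sub>C (x - y) = c *\<^sub>C x - c *\<^sub>C y" "(c - d) *\<^sub>C x = c *\<^sub>C x - d *\<^sub>C x" for x y :: 'a and c d
    using linear_diff[OF bounded_linear.linear[OF bounded_linear_scaleC], of c x y]
      scaleC_add_left[of c "- d" x] by (auto simp: min)
  have [simp]: "c *\<^sub>C (0::'a) = 0" by (metis add_0 dif(1) diff_self)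
  show "(c *\<^sub>C a) * b = c *\<^sub>C (a * b)" "a * (c *\<^sub>C b) = c *\<^sub>C (a * b)"
    "c *\<^sub>C d *\<^sub>C a = (c * d) *\<^sub>C a" "0 *\<^sub>C a = 0" "1 *\<^sub>C a = a" "c *\<^sub>C (0 :: 'a bop) = 0"
    "c *\<^sub>C (a + b) = c *\<^sub>C a + c *\<^sub>C b" "(c + d) *\<^sub>C a = c *\<^sub>C a + d *\<^sub>C a"
    "c *\<^sub>C (a - b) = c *\<^sub>C a - c *\<^sub>C b" "(c - d) *\<^sub>C a = c *\<^sub>C a - d *\<^sub>C a"
    "(- c) *\<^sub>C a = - (c *\<^sub>C a)" "c *\<^sub>C (- a) = - (c *\<^sub>C a)"
    by (rule bop_eqI; simp add: scaleC_scaleC scaleC_add_right scaleC_add_left min dif)+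
qed

text \<open>The norm is introduced for the contraction argument that produces square roots. The
  class with \<open>norm 1 = 1\<close> is out of reach: the Hilbert space may be zero, and then
  \<open>norm 1 = 0\<close>.\<close>

instantiation bop :: (chilbert_space) real_normed_algebra
begin

definition norm_bop :: "'a bop \<Rightarrow> real" where "norm_bop a = onorm (ap a)"
definition scaleR_bop :: "real \<Rightarrow> 'a bop \<Rightarrow> 'a bop" where "scaleR_bop r a = complex_of_real r *\<^sub>C a"
definition dist_bop :: "'a bop \<Rightarrow> 'a bop \<Rightarrow> real" where "dist_bop a b = norm (a - b)"
definition sgn_bop :: "'a bop \<Rightarrow> 'a bop" where "sgn_bop a = inverse (norm a) *\<^sub>R a"
definition uniformity_bop :: "('a bop \<times> 'a bop) filter" where
  "uniformity_bop = (INF e\<in>{0 <..}. principal {(x, y). dist x y < e})"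
definition open_bop :: "'a bop set \<Rightarrow> bool" where
  "open_bop S \<longleftrightarrow> (\<forall>x\<in>S. \<forall>\<^sub>F (x', y) in uniformity. x' = x \<longrightarrow> y \<in> S)"

lemma norm_bop_blinfun: "norm a = norm (Blinfun (ap a))" for a :: "'a bop"
  by (simp add: norm_bop_def norm_blinfun_def bounded_linear_Blinfun_apply)

lemma Blinfun_ap_diff: "Blinfun (ap (a - b)) = Blinfun (ap a) - Blinfun (ap b)" for a b :: "'a bop"
  by (rule blinfun_eqI) (simp add: bounded_linear_Blinfun_apply blinfun.diff_left)

lemma ap_scaleR_bop [simp]: "ap (r *\<^sub>R a) \<xi> = r *\<^sub>R ap a \<xi>" for a :: "'a bop"
  by (simp add: scaleR_bop_def scaleR_scaleC)

instance
proof
  fix a b c :: "'a bop" and r s :: real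
  show "dist a b = norm (a - b)" "sgn a = inverse (norm a) *\<^sub>R a"
    by (simp_all add: dist_bop_def sgn_bop_def)
  show "(uniformity :: ('a bop \<times> 'a bop) filter) = (INF e\<in>{0 <..}. principal {(x, y). dist x y < e})"
    by (simp add: uniformity_bop_def)
  show "open U = (\<forall>x\<in>U. \<forall>\<^sub>F (x', y) in uniformity. x' = x \<longrightarrow> y \<in> U)" for U :: "'a bop set"
    by (simp add: open_bop_def)
  show "r *\<^sub>R (a + b) = r *\<^sub>R a + r *\<^sub>R b" "(r + s) *\<^sub>R a = r *\<^sub>R a + s *\<^sub>R a"
    "r *\<^sub>R s *\<^sub>R a = (r * s) *\<^sub>R a" "1 *\<^sub>R a = a" "r *\<^sub>R a * b = r *\<^sub>R (a * b)" "a * r *\<^sub>R b = r *\<^sub>R (a * b)"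
    by (rule bop_eqI; simp add: scaleR_add_left scaleR_add_right)+
  show "norm a = 0 \<longleftrightarrow> a = 0"
    unfolding norm_bop_def by (subst onorm_eq_0) (auto intro: bop_eqI)
  show "norm (a + b) \<le> norm a + norm b"
    unfolding norm_bop_def using onorm_triangle[of "ap a" "ap b"] by (simp add: plus_bop.rep_eq)
  show "norm (r *\<^sub>R a) = \<bar>r\<bar> * norm a"
  proof -
    have "ap (r *\<^sub>R a) = (\<lambda>\<xi>. r *\<^sub>R ap a \<xi>)" by (rule ext) simp
    then show ?thesis unfolding norm_bop_def by (simp add: onorm_scaleR)
  qed
  show "norm (a * b) \<le> norm a * norm b"
    unfolding norm_bop_def using onorm_compose[of "ap a" "ap b"] by (simp add: times_bop.rep_eq o_def)
qed

end

text \<open>Completeness is inherited from \<open>blinfun\<close>: the limit exists there, and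
  pointwise convergence shows that it still commutes with complex scalars.\<close>

instance bop :: (chilbert_space) banach
proof
  fix X :: "nat \<Rightarrow> 'a bop" assume X: "Cauchy X"
  have "Cauchy (\<lambda>n. Blinfun (ap (X n)))"
    using X by (simp add: Cauchy_def dist_norm norm_bop_blinfun Blinfun_ap_diff)
  then obtain L where L: "(\<lambda>n. Blinfun (ap (X n))) \<longlonglongrightarrow> L"
    using Cauchy_convergent_iff convergent_def by blast
  have pt: "(\<lambda>n. ap (X n) \<xi>) \<longlonglongrightarrow> blinfun_apply L \<xi>" for \<xi>
    using tendsto_compose[OF _ L, of "\<lambda>f. blinfun_apply f \<xi>"]
      blinfun.tendsto[OF L tendsto_const[of \<xi>]] by (simp add: bounded_linear_Blinfun_apply)
  have "blinfun_apply L (c *\<^sub>C \<xi>) = c *\<^sub>C blinfun_apply L \<xi>" for c \<xi>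
    using LIMSEQ_unique[OF pt[of "c *\<^sub>C \<xi>"]]
      bounded_linear.tendsto[OF bounded_linear_scaleC pt[of \<xi>], of c] by simp
  then have ap: "ap (Bop (blinfun_apply L)) = blinfun_apply L"
    by (intro Bop_inverse) (simp add: blinfun.bounded_linear_right)
  have "X \<longlonglongrightarrow> Bop (blinfun_apply L)"
  proof (rule metric_LIMSEQ_I)
    fix e :: real assume "e > 0"
    have "dist (X n) (Bop (blinfun_apply L)) = dist (Blinfun (ap (X n))) L" for n
      by (simp add: dist_bop_def dist_norm norm_bop_blinfun Blinfun_ap_diff ap
          blinfun_apply_inverse)
    then show "\<exists>no. \<forall>n\<ge>no. dist (X n) (Bop (blinfun_apply L)) < e"
      using metric_LIMSEQ_D[OF L \<open>e > 0\<close>] by simp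
  qed
  then show "convergent X" by (auto simp: convergent_def)
qed

lemma norm_ap: "norm (ap a \<xi>) \<le> norm a * norm \<xi>"
  unfolding norm_bop_def by (rule onorm) simp

lemma norm_bop_leI: "0 \<le> c \<Longrightarrow> (\<And>\<xi>. norm (ap a \<xi>) \<le> c * norm \<xi>) \<Longrightarrow> norm a \<le> c"
  unfolding norm_bop_def by (rule onorm_bound)

text \<open>Riesz representation is applied for each \<xi> separately. Additivity, homogeneity and
  complex linearity of the resulting map all follow because a vector is determined by its inner
  products.\<close>

lemma adjoint_exists:
  fixes a :: "'a::chilbert_space bop"
  obtains b where "\<And>\<xi> \<eta>. inner (ap b \<xi>) \<eta> = inner \<xi> (ap a \<eta>)"
proof -
  have "\<exists>y. \<forall>\<eta>. inner y \<eta> = inner \<xi> (ap a \<eta>)" for \<xi>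
  proof -
    have "bounded_linear (\<lambda>\<eta>. inner \<xi> (ap a \<eta>))"
      by (intro bounded_linear_inner_right_comp) simp
    then show ?thesis by (metis riesz_representation)
  qed
  then obtain f where f: "\<And>\<xi> \<eta>. inner (f \<xi>) \<eta> = inner \<xi> (ap a \<eta>)"
    by metis
  have eq: "x = y" if "\<And>\<eta>. inner x \<eta> = inner y \<eta>" for x y :: 'a
    using that by (metis inner_diff_left inner_eq_zero_iff right_minus_eq)
  have "bounded_linear f"
  proof (rule bounded_linear_intro[where K = "norm a"])
    show "f (x + y) = f x + f y" for x y
      by (rule eq) (simp add: f inner_add_left)
    show "f (r *\<^sub>R x) = r *\<^sub>R f x" for x r
      by (rule eq) (simp add: f)
    show "norm (f x) \<le> norm x * norm a" for x
    proof -
      have "(norm (f x))\<^sup>2 = inner x (ap a (f x))"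
        by (simp add: power2_norm_eq_inner f)
      also have "\<dots> \<le> norm x * (norm a * norm (f x))"
        by (meson norm_ap norm_cauchy_schwarz norm_ge_zero mult_left_mono order_trans)
      finally show ?thesis
        by (cases "f x = 0") (auto simp: power2_eq_square mult_ac)
    qed
  qed
  moreover have "f (c *\<^sub>C x) = c *\<^sub>C f x" for c x
    by (rule eq) (simp add: f inner_scaleC_left)
  ultimately have "ap (Bop f) = f" by (intro Bop_inverse) simp
  with f show thesis by (intro that[of "Bop f"]) simp
qed

lemma adj_cinner: "cinner (ap (adj a) \<xi>) \<eta> = cinner \<xi> (ap a \<eta>)"
proof -
  obtain b where b: "\<And>\<xi> \<eta>. inner (ap b \<xi>) \<eta> = inner \<xi> (ap a \<eta>)"
    using adjoint_exists[of a] by blast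
  have bc: "cinner (ap b \<xi>) \<eta> = cinner \<xi> (ap a \<eta>)" for \<xi> \<eta>
    by (simp add: cinner_eq b)
  have "adj a = b"
    unfolding adj_def
  proof (rule the_equality)
    fix c assume c: "\<forall>\<xi> \<eta>. cinner (ap c \<xi>) \<eta> = cinner \<xi> (ap a \<eta>)"
    show "c = b"
    proof (rule bop_eqI)
      fix \<xi>
      have "inner (ap c \<xi> - ap b \<xi>) \<eta> = 0" for \<eta>
        using c b[of \<xi> \<eta>] by (metis inner_cinner inner_diff_left right_minus_eq)
      then show "ap c \<xi> = ap b \<xi>"
        by (metis inner_eq_zero_iff right_minus_eq)
    qed
  qed (simp add: bc)
  then show ?thesis by (simp add: bc)
qed

lemma adj_inner: "inner (ap (adj a) \<xi>) \<eta> = inner \<xi> (ap a \<eta>)"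
  by (simp add: inner_cinner adj_cinner)

lemma adj_inner_right: "inner \<xi> (ap (adj a) \<eta>) = inner (ap a \<xi>) \<eta>"
  by (metis adj_inner inner_commute)

lemma adj_unique: "(\<And>\<xi> \<eta>. inner (ap b \<xi>) \<eta> = inner \<xi> (ap a \<eta>)) \<Longrightarrow> adj a = b"
proof (rule bop_eqI)
  fix \<xi> assume b: "\<And>\<xi> \<eta>. inner (ap b \<xi>) \<eta> = inner \<xi> (ap a \<eta>)"
  have "inner (ap (adj a) \<xi> - ap b \<xi>) \<eta> = 0" for \<eta>
    by (simp add: inner_diff_left b adj_inner)
  then show "ap (adj a) \<xi> = ap b \<xi>"
    by (metis inner_eq_zero_iff right_minus_eq)
qed

lemma adj_adj [simp]: "adj (adj a) = a"
  by (rule adj_unique) (simp add: adj_inner_right)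

lemma adj_simps [simp]:
  "adj (a + b) = adj a + adj b" "adj (a - b) = adj a - adj b" "adj (- a) = - adj a"
  "adj (a * b) = adj b * adj a" "adj 1 = 1" "adj 0 = 0" "adj (c *\<^sub>C a) = cnj c *\<^sub>C adj a"
  "adj (r *\<^sub>R a) = r *\<^sub>R adj a"
  by (rule adj_unique;
      simp add: adj_inner inner_add_left inner_add_right inner_diff_left inner_diff_right
        inner_scaleC_left)+

lemma adj_power [simp]: "adj (a ^ n) = adj a ^ n"
  by (induction n) (simp_all add: power_commutes)

lemma norm_adj_le: "norm (adj a) \<le> norm a"
proof (rule norm_bop_leI)
  fix \<xi>
  have "(norm (ap (adj a) \<xi>))\<^sup>2 = inner \<xi> (ap a (ap (adj a) \<xi>))"
    by (simp add: power2_norm_eq_inner adj_inner)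
  also have "\<dots> \<le> norm \<xi> * (norm a * norm (ap (adj a) \<xi>))"
    by (meson norm_ap norm_cauchy_schwarz norm_ge_zero mult_left_mono order_trans)
  finally show "norm (ap (adj a) \<xi>) \<le> norm a * norm \<xi>"
    by (cases "ap (adj a) \<xi> = 0") (auto simp: power2_eq_square mult_ac)
qed simp

lemma norm_adj [simp]: "norm (adj a) = norm a"
  by (metis adj_adj norm_adj_le order_antisym)

lemma tendsto_adj:
  fixes l :: "'a::chilbert_space bop"
  shows "(X \<longlongrightarrow> l) F \<Longrightarrow> ((\<lambda>n. adj (X n)) \<longlongrightarrow> adj l) F"
proof -
  have "bounded_linear (adj :: 'a bop \<Rightarrow> _)"
    by (rule bounded_linear_intro[where K = 1]) simp_all
  then show "(X \<longlongrightarrow> l) F \<Longrightarrow> ((\<lambda>n. adj (X n)) \<longlongrightarrow> adj l) F"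
    by (rule bounded_linear.tendsto)
qed

lemma adj_image_ortho_ker: "ap (adj a) \<xi> \<in> ocompl (ker_op a)"
  by (auto simp: ocompl_def ker_op_def) (metis adj_cinner ap_zero cinner_cnj_eq_0 cinner_scaleC_right mult_zero_left scaleC_zero_left)

text \<open>Self-adjoint idempotents \<open>p\<close> and \<open>q\<close> with the same range
  satisfy \<open>p * q = q\<close> and \<open>q * p = p\<close>; taking adjoints in one of these
  identities makes them equal. This justifies the definite description in
  \<open>Proj\<close>.\<close>

lemma Proj_eqI:
  assumes "self_adj p" "p * p = p" "range (ap p) = S"
  shows "Proj S = p"
  unfolding Proj_def
proof (rule the_equality)
  fix q :: "'a bop" assume q: "self_adj q \<and> q * q = q \<and> range (ap q) = S"
  have *: "a * b = b" if a: "a * a = a" and ab: "range (ap b) = range (ap a)" for a b :: "'a bop"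
  proof (rule bop_eqI)
    fix \<xi>
    obtain \<eta> where "ap b \<xi> = ap a \<eta>" using ab by blast
    then show "ap (a * b) \<xi> = ap b \<xi>"
      using a by (metis ap_bop(6))
  qed
  have "p * q = q" "q * p = p" using * q assms by metis+
  then show "q = p"
    using q assms(1) by (metis adj_simps(4) self_adj_def)
qed (use assms in auto)

lemma ker_op_subspace:
  fixes a :: "'a::chilbert_space bop"
  shows "subspace (ker_op a)" "closed (ker_op a)" "\<xi> \<in> ker_op a \<Longrightarrow> c *\<^sub>C \<xi> \<in> ker_op a"
proof -
  show "subspace (ker_op a)" by (auto simp: subspace_def ker_op_def)
  have "continuous_on UNIV (ap a)"
    using bounded_linear.continuous_on[OF bounded_linear_ap continuous_on_id] by simp
  then show "closed (ker_op a)"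
    unfolding ker_op_def by (intro closed_Collect_eq continuous_on_const)
  show "\<xi> \<in> ker_op a \<Longrightarrow> c *\<^sub>C \<xi> \<in> ker_op a"
    by (simp add: ker_op_def) (metis scaleC_add_right add_cancel_right_left add.right_neutral)
qed

lemma Proj_ker:
  fixes a :: "'a::chilbert_space bop"
  defines "p \<equiv> Proj (ker_op a)"
  shows "self_adj p" "p * p = p" "range (ap p) = ker_op a"
proof -
  define K where "K = ker_op a"
  note K = ker_op_subspace[where a = a, folded K_def]
  have "\<exists>y. y \<in> K \<and> (\<forall>z\<in>K. inner (\<xi> - y) z = 0)" for \<xi>
    using projection_theorem[OF K(1,2), of \<xi>] by metis
  then obtain f where fK: "\<And>\<xi>. f \<xi> \<in> K" and f: "\<And>\<xi> z. z \<in> K \<Longrightarrow> inner (\<xi> - f \<xi>) z = 0"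
    by metis
  \<comment> \<open>All algebraic properties of the nearest point map \<open>f\<close> are read off
    from this characterization of its values.\<close>
  have uniq: "f \<xi> = y" if "y \<in> K" "\<And>z. z \<in> K \<Longrightarrow> inner (\<xi> - y) z = 0" for \<xi> y
  proof -
    have "f \<xi> - y \<in> K" using fK that(1) K(1) subspace_diff by blast
    then have "inner (\<xi> - y) (f \<xi> - y) = 0" "inner (\<xi> - f \<xi>) (f \<xi> - y) = 0"
      using that(2) f by blast+
    then have "inner ((\<xi> - y) - (\<xi> - f \<xi>)) (f \<xi> - y) = 0"
      by (metis inner_diff_left diff_0_right)
    then show ?thesis by simp
  qed
  have "bounded_linear f"
  proof (rule bounded_linear_intro[where K = 1])
    show "f (x + y) = f x + f y" for x y
      using f[of _ x] f[of _ y] fK K(1)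
      by (intro uniq) (auto simp: subspace_add inner_diff_left inner_add_left)
    show "f (r *\<^sub>R x) = r *\<^sub>R f x" for x r
      using f[of _ x] fK K(1)
      by (intro uniq) (auto simp: subspace_scale inner_diff_left)
    show "norm (f x) \<le> norm x * 1" for x
    proof -
      have "inner (f x) (f x) = inner x (f x)"
        using f[OF fK, of x x] by (simp add: inner_diff_left)
      also have "\<dots> \<le> norm x * norm (f x)" by (rule norm_cauchy_schwarz)
      finally show ?thesis
        by (cases "f x = 0") (auto simp: power2_norm_eq_inner[symmetric] power2_eq_square)
    qed
  qed
  moreover have "f (c *\<^sub>C x) = c *\<^sub>C f x" for c x
  proof (rule uniq)
    show "c *\<^sub>C f x \<in> K" using fK K(3) by blast
    have "c *\<^sub>C x - c *\<^sub>C f x = c *\<^sub>C (x - f x)"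
      by (simp add: linear_diff[OF bounded_linear.linear[OF bounded_linear_scaleC]])
    then show "inner (c *\<^sub>C x - c *\<^sub>C f x) z = 0" if "z \<in> K" for z
      using f K(3) that by (simp add: inner_scaleC_left)
  qed
  ultimately have P: "ap (Bop f) = f" by (intro Bop_inverse) simp
  have fixK: "f \<xi> = \<xi>" if "\<xi> \<in> K" for \<xi>
    using that by (intro uniq) auto
  have "self_adj (Bop f)"
    unfolding self_adj_def
  proof (rule adj_unique)
    fix \<xi> \<eta>
    show "inner (ap (Bop f) \<xi>) \<eta> = inner \<xi> (ap (Bop f) \<eta>)"
      using f[OF fK, of \<xi> \<eta>] f[OF fK, of \<eta> \<xi>] unfolding P inner_diff_left
      by (metis eq_iff_diff_eq_0 inner_commute)
  qed
  moreover have "Bop f * Bop f = Bop f"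
    by (rule bop_eqI) (simp add: P fixK fK)
  moreover have "range (ap (Bop f)) = K"
    using fK fixK by (auto simp: P image_iff) metis
  ultimately have "Proj K = Bop f" "self_adj (Bop f)" "Bop f * Bop f = Bop f" "range (ap (Bop f)) = K"
    using Proj_eqI by blast+
  then show "self_adj p" "p * p = p" "range (ap p) = ker_op a"
    by (simp_all add: p_def K_def)
qed

subsection \<open>Positive operators\<close>

lemma cinner_minus_right: "cinner x (- y) = - cinner x y" for x y :: "'a::chilbert_space"
  using cinner_scaleC_right[of x "-1" y] scaleR_scaleC[of "-1" y] by simp

lemma form_polarization:
  fixes a :: "'a::chilbert_space bop"
  shows "inner (\<xi> + \<eta>) (ap a (\<xi> + \<eta>)) =
    inner \<xi> (ap a \<xi>) + inner \<eta> (ap a \<eta>) + (inner \<xi> (ap a \<eta>) + inner \<eta> (ap a \<xi>))"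
  by (simp add: inner_add_left inner_add_right)

text \<open>For a self-adjoint difference the real bilinear form is symmetric, so polarization
  recovers it from its diagonal.\<close>

lemma self_adj_form_eqI:
  assumes "adj a = a" "adj b = b" "\<And>\<xi>. inner \<xi> (ap a \<xi>) = inner \<xi> (ap b \<xi>)"
  shows "a = b"
proof (rule bop_eqI)
  fix \<eta>
  define d where "d = a - b"
  have d: "adj d = d" and 0: "inner \<xi> (ap d \<xi>) = 0" for \<xi>
    using assms by (simp_all add: d_def inner_diff_right)
  have "inner \<xi> (ap d \<eta>) = 0" for \<xi>
  proof -
    have "inner \<xi> (ap d \<eta>) = inner \<eta> (ap d \<xi>)"
      by (metis adj_inner d inner_commute)
    then show ?thesis
      using form_polarization[of \<xi> \<eta> d] by (simp only: 0)
  qed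
  then have "ap d \<eta> = 0" by (metis inner_eq_zero_iff)
  then show "ap a \<eta> = ap b \<eta>" by (simp add: d_def)
qed

lemma positive_op_self_adj:
  assumes "positive_op a"
  shows "adj a = a"
proof (rule adj_unique)
  fix \<xi> \<eta>
  have im: "inner \<xi> (ap ((- \<i>) *\<^sub>C a) \<xi>) = 0" for \<xi>
    using assms by (simp add: positive_op_def complex_nonneg_Reals_iff inner_cinner cinner_scaleC_right
        cinner_minus_right)
  \<comment> \<open>With \<i>\<eta> as second vector the factors \<i> cancel up to a sign, so the
    polarized vanishing form is the difference of the two sides to be compared.\<close>
  have "inner \<xi> (ap ((- \<i>) *\<^sub>C a) (\<i> *\<^sub>C \<eta>)) + inner (\<i> *\<^sub>C \<eta>) (ap ((- \<i>) *\<^sub>C a) \<xi>) = 0"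
    using form_polarization[of \<xi> "\<i> *\<^sub>C \<eta>" "(- \<i>) *\<^sub>C a"] by (simp only: im)
  then show "inner (ap a \<xi>) \<eta> = inner \<xi> (ap a \<eta>)"
    unfolding inner_scaleC_left ap_bop ap_scaleC scaleC_scaleC
    using scaleR_scaleC[of "-1" "ap a \<xi>", symmetric] by (simp add: inner_commute)
qed

lemma positive_op_iff: "positive_op a \<longleftrightarrow> adj a = a \<and> (\<forall>\<xi>. 0 \<le> inner \<xi> (ap a \<xi>))"
proof
  show "adj a = a \<and> (\<forall>\<xi>. 0 \<le> inner \<xi> (ap a \<xi>))" if "positive_op a"
    using that positive_op_self_adj[OF that]
    by (auto simp: positive_op_def complex_nonneg_Reals_iff inner_cinner)
  show "positive_op a" if a: "adj a = a \<and> (\<forall>\<xi>. 0 \<le> inner \<xi> (ap a \<xi>))"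
    unfolding positive_op_def complex_nonneg_Reals_iff
  proof (intro allI conjI)
    fix \<xi>
    show "0 \<le> Re (cinner \<xi> (ap a \<xi>))" using a by (simp add: inner_cinner)
    have "cinner \<xi> (ap a \<xi>) = cnj (cinner \<xi> (ap a \<xi>))"
      by (metis a adj_cinner cinner_commute)
    then show "Im (cinner \<xi> (ap a \<xi>)) = 0"
      by (metis Reals_cnj_iff complex_is_Real_iff)
  qed
qed

lemma positive_op_form: "positive_op a \<Longrightarrow> 0 \<le> inner \<xi> (ap a \<xi>)"
  by (simp add: positive_op_iff)

lemma positive_op_add: "positive_op a \<Longrightarrow> positive_op b \<Longrightarrow> positive_op (a + b)"
  by (simp add: positive_op_iff inner_add_right)

lemma positive_op_scaleR: "positive_op a \<Longrightarrow> 0 \<le> r \<Longrightarrow> positive_op (r *\<^sub>R a)"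
  by (simp add: positive_op_iff)

lemma positive_op_conj: "positive_op a \<Longrightarrow> positive_op (adj c * a * c)"
  by (simp add: positive_op_iff adj_inner_right mult.assoc)

lemma positive_op_0_1 [simp]: "positive_op 0" "positive_op 1"
  by (simp_all add: positive_op_iff)

lemma positive_op_adj_mult: "positive_op (adj c * c)"
  using positive_op_conj[of 1 c] by simp

lemma positive_op_square: "adj c = c \<Longrightarrow> positive_op (c * c)"
  using positive_op_adj_mult[of c] by simp

lemma positive_op_le_norm:
  assumes "adj a = a"
  shows "positive_op (norm a *\<^sub>R 1 - a)"
  unfolding positive_op_iff
proof (intro conjI allI)
  show "adj (norm a *\<^sub>R 1 - a) = norm a *\<^sub>R 1 - a" by (simp add: assms)
  fix \<xi>
  have "inner \<xi> (ap a \<xi>) \<le> norm \<xi> * (norm a * norm \<xi>)"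
    by (meson norm_ap norm_cauchy_schwarz norm_ge_zero mult_left_mono order_trans)
  then show "0 \<le> inner \<xi> (ap (norm a *\<^sub>R 1 - a) \<xi>)"
    by (simp add: inner_diff_right power2_norm_eq_inner[symmetric] power2_eq_square mult_ac)
qed

text \<open>The operator is a sum of two conjugates of positive operators,
  \<open>b * (1 - b) * b\<close> and \<open>(1 - b) * b * (1 - b)\<close>, so the inequality
  precedes any construction of square roots.\<close>

lemma positive_op_le_square:
  assumes b: "positive_op b" "positive_op (1 - b)"
  shows "positive_op (b - b * b)"
proof -
  have sa: "adj b = b" using b by (simp add: positive_op_iff)
  have "b - b * b = adj b * (1 - b) * b + adj (1 - b) * b * (1 - b)"
    by (simp add: sa algebra_simps)
  then show ?thesis
    using positive_op_add[OF positive_op_conj[OF b(2), of b] positive_op_conj[OF b(1), of "1 - b"]]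
    by simp
qed

lemma norm_ap_le_form:
  assumes b: "positive_op b" "positive_op (1 - b)"
  shows "(norm (ap b \<xi>))\<^sup>2 \<le> inner \<xi> (ap b \<xi>)"
proof -
  have sa: "adj b = b" using b by (simp add: positive_op_iff)
  have "(norm (ap b \<xi>))\<^sup>2 = inner \<xi> (ap (b * b) \<xi>)"
    by (metis adj_inner ap_bop(6) power2_norm_eq_inner sa)
  then show ?thesis
    using positive_op_form[OF positive_op_le_square[OF b], of \<xi>] by (simp add: inner_diff_right)
qed

lemma norm_le_one_of_positive:
  assumes b: "positive_op b" "positive_op (1 - b)"
  shows "norm b \<le> 1"
proof (rule norm_bop_leI)
  fix \<xi>
  have "(norm (ap b \<xi>))\<^sup>2 \<le> (norm \<xi>)\<^sup>2"
    using norm_ap_le_form[OF b, of \<xi>] positive_op_form[OF b(2), of \<xi>]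
    by (simp add: power2_norm_eq_inner inner_diff_right del: dot_square_norm)
  then show "norm (ap b \<xi>) \<le> 1 * norm \<xi>"
    by (simp only: mult_1 power2_le_imp_le norm_ge_zero)
qed simp

lemma norm_le_of_positive:
  assumes b: "positive_op b" "positive_op (r *\<^sub>R 1 - b)" and r: "r > 0"
  shows "norm b \<le> r"
proof -
  have "positive_op (inverse r *\<^sub>R b)" "positive_op (inverse r *\<^sub>R (r *\<^sub>R 1 - b))"
    using b r by (simp_all add: positive_op_scaleR del: scaleR_diff_right)
  then have "norm (inverse r *\<^sub>R b) \<le> 1"
    using r by (intro norm_le_one_of_positive) (simp_all add: scaleR_diff_right)
  then show ?thesis using r by (simp add: field_simps)
qed

text \<open>After rescaling \<open>s\<close> lies between 0 and 1; then the squared norm of the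
  image of \<xi> is bounded by the form at \<xi>, which is zero.\<close>

lemma positive_op_kernel:
  assumes s: "positive_op s" and 0: "inner \<xi> (ap s \<xi>) = 0"
  shows "ap s \<xi> = 0"
proof -
  define r where "r = norm s + 1"
  have r: "r > 0" by (simp add: r_def add_nonneg_pos)
  have "positive_op (inverse r *\<^sub>R ((norm s *\<^sub>R 1 - s) + 1))"
    using r s positive_op_le_norm[of s]
    by (intro positive_op_scaleR positive_op_add) (auto simp: positive_op_iff)
  moreover have "inverse r *\<^sub>R ((norm s *\<^sub>R 1 - s) + 1) = 1 - inverse r *\<^sub>R s"
  proof -
    have "(norm s *\<^sub>R 1 - s) + 1 = r *\<^sub>R 1 - s" by (simp add: r_def scaleR_add_left)
    then have "inverse r *\<^sub>R ((norm s *\<^sub>R 1 - s) + 1) = inverse r *\<^sub>R (r *\<^sub>R 1 - s)"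
      by (simp only:)
    then show ?thesis using r by (simp only: scaleR_diff_right) simp
  qed
  ultimately have "(norm (ap (inverse r *\<^sub>R s) \<xi>))\<^sup>2 \<le> inner \<xi> (ap (inverse r *\<^sub>R s) \<xi>)"
    using r s by (intro norm_ap_le_form) (auto intro: positive_op_scaleR)
  then show ?thesis using 0 r by simp
qed

section \<open>Commutants, square roots and commuting products of positive operators\<close>

lemma commutant_mono: "S \<subseteq> T \<Longrightarrow> commutant T \<subseteq> commutant S"
  by (auto simp: commutant_def)

lemma commutant_algebra:
  fixes a b :: "'a::chilbert_space bop"
  shows "1 \<in> commutant S" "0 \<in> commutant S"
  "a \<in> commutant S \<Longrightarrow> b \<in> commutant S \<Longrightarrow> a + b \<in> commutant S"
  "a \<in> commutant S \<Longrightarrow> b \<in> commutant S \<Longrightarrow> a - b \<in> commutant S"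
  "a \<in> commutant S \<Longrightarrow> b \<in> commutant S \<Longrightarrow> a * b \<in> commutant S"
  "a \<in> commutant S \<Longrightarrow> r *\<^sub>R a \<in> commutant S"
proof -
  have "s * (a + b) = (a + b) * s \<and> s * (a - b) = (a - b) * s \<and> s * (a * b) = a * b * s"
    if sa: "s * a = a * s" and sb: "s * b = b * s" for s
  proof -
    have "s * (a * b) = s * a * b" by (rule mult.assoc[symmetric])
    also have "\<dots> = a * (s * b)" by (simp only: sa mult.assoc)
    also have "\<dots> = a * b * s" by (simp only: sb mult.assoc)
    finally show ?thesis
      by (simp add: distrib_left distrib_right left_diff_distrib right_diff_distrib sa sb)
  qed
  then show "a \<in> commutant S \<Longrightarrow> b \<in> commutant S \<Longrightarrow> a + b \<in> commutant S"
    "a \<in> commutant S \<Longrightarrow> b \<in> commutant S \<Longrightarrow> a - b \<in> commutant S"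
    "a \<in> commutant S \<Longrightarrow> b \<in> commutant S \<Longrightarrow> a * b \<in> commutant S"
    unfolding commutant_def by blast+
qed (simp_all add: commutant_def)

lemma closed_commutant: "closed (commutant S)"
proof -
  have "commutant S = (\<Inter>s\<in>S. {b. s * b = b * s})" by (auto simp: commutant_def)
  moreover have "closed {b. s * b = b * s}" for s :: "'a bop"
    by (intro closed_Collect_eq continuous_intros)
  ultimately show ?thesis by auto
qed

lemma bicommutant_self: "a \<in> commutant (commutant {a})"
  by (auto simp: commutant_def)

lemma closed_self_adj: "closed {y :: 'a::chilbert_space bop. adj y = y}"
proof (intro closed_Collect_eq continuous_on_id)
  show "continuous_on UNIV (adj :: 'a bop \<Rightarrow> _)"
    unfolding continuous_on_def by (auto intro: tendsto_adj)
qed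

text \<open>The square root of \<open>1 - z\<close> for \<open>\<parallel>z\<parallel> < 1\<close> is \<open>1 - y\<close>, where \<open>y\<close> is the
  fixed point of the contraction \<open>y \<mapsto> (z + y\<^sup>2)/2\<close>.\<close>

lemma sqrt_exists:
  assumes a: "positive_op a" and e: "e > 0"
  obtains c where "adj c = c" "c * c = a + e *\<^sub>R 1" "c \<in> commutant (commutant {a})"
proof -
  define r where "r = norm a + e"
  have r: "r > 0" using e by (simp add: r_def add_nonneg_pos)
  define z where "z = 1 - inverse r *\<^sub>R (a + e *\<^sub>R 1)"
  \<comment> \<open>Since \<open>z\<close> equals \<open>norm a *\<^sub>R 1 - a\<close> divided by
    \<open>r\<close>, it lies between 0 and \<open>norm a / r\<close>, which is this \<rho>. The
    added \<open>e\<close> makes it smaller than 1.\<close>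
  define \<rho> where "\<rho> = 1 - e / r"
  have \<rho>: "0 \<le> \<rho>" "\<rho> < 1"
    using r e by (simp_all add: \<rho>_def r_def field_simps)
  have zr: "z = inverse r *\<^sub>R (norm a *\<^sub>R 1 - a)"
  proof -
    have "z = inverse r *\<^sub>R (r *\<^sub>R 1 - (a + e *\<^sub>R 1))"
      unfolding scaleR_diff_right using r by (simp add: z_def)
    moreover have "r *\<^sub>R 1 - (a + e *\<^sub>R 1) = norm a *\<^sub>R 1 - a"
      by (simp add: r_def scaleR_add_left)
    ultimately show ?thesis by simp
  qed
  have sa: "adj a = a" using a by (simp add: positive_op_iff)
  have zpos: "positive_op z"
    unfolding zr using r sa by (intro positive_op_scaleR positive_op_le_norm) auto
  have "\<rho> *\<^sub>R 1 - z = inverse r *\<^sub>R a"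
    by (simp add: \<rho>_def z_def scaleR_diff_left scaleR_add_right divide_inverse mult.commute)
  then have zle: "positive_op (\<rho> *\<^sub>R 1 - z)"
    using a r by (simp add: positive_op_scaleR)
  have nz: "norm z \<le> \<rho>"
  proof (cases "\<rho> = 0")
    case True
    then have "inner \<xi> (ap z \<xi>) = 0" for \<xi>
      using positive_op_form[OF zle, of \<xi>] positive_op_form[OF zpos, of \<xi>] by simp
    then have "z = 0"
      using positive_op_kernel[OF zpos] by (intro bop_eqI) simp
    then show ?thesis using \<rho> by simp
  qed (use \<rho> norm_le_of_positive[OF zpos zle] in auto)
  \<comment> \<open>The fixed point is sought in a closed set that already encodes self-adjointness
    and membership in the bicommutant, so that the limit inherits both.\<close>
  define S where "S = {y. adj y = y} \<inter> commutant (commutant {a}) \<inter> cball 0 \<rho>"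
  define f where "f y = (1/2) *\<^sub>R (z + y * y)" for y :: "'a bop"
  have "closed S"
    unfolding S_def by (intro closed_Int closed_self_adj closed_commutant closed_cball)
  then have comp: "complete S" by (simp add: complete_eq_closed)
  have zS: "z \<in> commutant (commutant {a})" "adj z = z"
    using zpos by (auto simp: z_def positive_op_iff intro!: commutant_algebra bicommutant_self)
  have "\<exists>!y. y \<in> S \<and> f y = y"
  proof (rule Banach_fix[OF comp _ \<rho>])
    have "0 \<in> S" using \<rho> by (auto simp: S_def intro!: commutant_algebra)
    then show "S \<noteq> {}" by blast
    show "f ` S \<subseteq> S"
    proof
      fix w assume "w \<in> f ` S"
      then obtain y where y: "y \<in> S" and w: "w = f y" by blast
      have "norm (y * y) \<le> norm y * norm y" by (rule norm_mult_ineq)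
      also have "\<dots> \<le> \<rho> * 1" using y \<rho> by (intro mult_mono) (auto simp: S_def)
      finally have "norm (z + y * y) \<le> 2 * \<rho>"
        using nz norm_triangle_ineq[of z "y * y"] by linarith
      then show "w \<in> S"
        using y zS unfolding w f_def S_def
        by (auto intro!: commutant_algebra)
    qed
    show "dist (f x) (f y) \<le> \<rho> * dist x y" if "x \<in> S" "y \<in> S" for x y
    proof -
      have "f x - f y = (1/2) *\<^sub>R ((x - y) * x + y * (x - y))"
        by (simp add: f_def algebra_simps)
      then have "dist (f x) (f y) = norm ((x - y) * x + y * (x - y)) / 2"
        by (simp add: dist_norm)
      also have "norm ((x - y) * x + y * (x - y)) \<le> norm (x - y) * norm x + norm y * norm (x - y)"
        by (meson add_mono norm_mult_ineq norm_triangle_le order_trans order_refl)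
      also have "\<dots> \<le> norm (x - y) * \<rho> + \<rho> * norm (x - y)"
        using that \<rho> by (intro add_mono mult_mono) (auto simp: S_def)
      finally show ?thesis by (simp add: dist_norm)
    qed
  qed
  then obtain y where y: "y \<in> S" "f y = y" by blast
  have y2: "y + y = z + y * y"
  proof -
    have "2 *\<^sub>R f y = z + y * y" by (simp add: f_def)
    then show ?thesis by (simp add: y scaleR_2)
  qed
  define c where "c = sqrt r *\<^sub>R (1 - y)"
  show thesis
  proof (rule that)
    show "adj c = c" using y by (simp add: c_def S_def)
    have "(1 - y) * (1 - y) = 1 - (y + y) + y * y" by (simp add: algebra_simps)
    also have "\<dots> = inverse r *\<^sub>R (a + e *\<^sub>R 1)" unfolding y2 by (simp add: z_def)
    finally show "c * c = a + e *\<^sub>R 1"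
      using r by (simp add: c_def mult.assoc[symmetric] real_sqrt_mult_self[unfolded abs_of_pos])
    show "c \<in> commutant (commutant {a})"
      using y by (auto simp: c_def S_def intro!: commutant_algebra)
  qed
qed

lemma nonneg_of_perturbation:
  fixes x y :: real
  assumes "0 \<le> y" "\<And>e. e > 0 \<Longrightarrow> 0 \<le> x + e * y"
  shows "0 \<le> x"
proof (rule field_le_epsilon)
  fix e :: real assume "e > 0"
  then have "0 \<le> x + e / (y + 1) * y" using assms by (intro assms(2)) auto
  moreover have "e / (y + 1) * y \<le> e" using \<open>e > 0\<close> assms(1) by (simp add: field_simps)
  ultimately show "0 \<le> x + e" by linarith
qed

text \<open>A root \<open>c\<close> of \<open>b + e *\<^sub>R 1\<close> lies in the bicommutant of
  \<open>b\<close> and so commutes with \<open>a\<close>. Hence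
  \<open>a * (b + e *\<^sub>R 1) = c * a * c\<close> is positive, and \<open>e\<close> tends to
  0.\<close>

lemma positive_op_mult_commuting:
  assumes a: "positive_op a" and b: "positive_op b" and ab: "a * b = b * a"
  shows "positive_op (a * b)"
  unfolding positive_op_iff
proof (intro conjI allI)
  show "adj (a * b) = a * b"
    using a b ab by (simp add: positive_op_iff)
  fix \<xi>
  have "0 \<le> inner \<xi> (ap (a * b) \<xi>) + e * inner \<xi> (ap a \<xi>)" if e: "e > 0" for e
  proof -
    obtain c where c: "adj c = c" "c * c = b + e *\<^sub>R 1" "c \<in> commutant (commutant {b})"
      using sqrt_exists[OF b e] .
    have "a \<in> commutant {b}" using ab by (simp add: commutant_def)
    with c(3) have "a * c = c * a" by (simp add: commutant_def)
    then have "a * (c * c) = adj c * a * c" by (metis c(1) mult.assoc)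
    then have "positive_op (a * (b + e *\<^sub>R 1))"
      using positive_op_conj[OF a, of c] c(2) by simp
    then show ?thesis
      using positive_op_form by (fastforce simp: distrib_left inner_add_right)
  qed
  then show "0 \<le> inner \<xi> (ap (a * b) \<xi>)"
    using positive_op_form[OF a, of \<xi>] nonneg_of_perturbation by blast
qed


lemma positive_op_power: "positive_op k \<Longrightarrow> positive_op (k ^ n)"
proof (induction n)
  case (Suc n)
  then show ?case by (simp add: positive_op_mult_commuting power_commutes)
qed simp

text \<open>With \<open>d = a - b\<close> and \<open>s = a + b\<close> the hypothesis says \<open>d s = - s d\<close>, so the positive
  operator \<open>d\<^sup>2 s\<close> is the negative of the positive operator \<open>d s d\<close>.\<close>

lemma positive_sqrt_unique:
  assumes a: "positive_op a" and b: "positive_op b" and sq: "a * a = b * b"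
  shows "a = b"
proof -
  define d where "d = a - b"
  define s where "s = a + b"
  have d: "adj d = d" and s: "positive_op s"
    using a b by (simp_all add: d_def s_def positive_op_iff inner_add_right)
  have ds: "d * s = - (s * d)"
    using sq by (simp add: d_def s_def algebra_simps)
  have dds: "d * d * s = - (adj d * s * d)"
  proof -
    have "d * d * s = d * (d * s)" by (rule mult.assoc)
    also have "\<dots> = - (d * s * d)" by (subst ds) (simp add: mult.assoc)
    finally show ?thesis by (simp only: d)
  qed
  moreover have "d * s * d = - (s * (d * d))"
    by (subst ds) (simp add: mult.assoc)
  ultimately have "d * d * s = s * (d * d)" by (simp only: d minus_minus)
  then have pos: "positive_op (d * d * s)"
    using positive_op_mult_commuting[OF positive_op_square[OF d] s] by simp
  have "ap d (ap d \<xi>) = 0" for \<xi>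
  proof -
    define \<eta> where "\<eta> = ap d \<xi>"
    have "inner \<xi> (ap (d * d * s) \<xi>) = - inner \<eta> (ap s \<eta>)"
      unfolding dds \<eta>_def by (simp add: adj_inner_right)
    then have "inner \<eta> (ap s \<eta>) = 0"
      using positive_op_form[OF pos, of \<xi>] positive_op_form[OF s, of \<eta>] by simp
    then have "inner \<eta> (ap a \<eta>) + inner \<eta> (ap b \<eta>) = 0"
      by (simp add: s_def inner_add_right)
    then have "inner \<eta> (ap a \<eta>) = 0" "inner \<eta> (ap b \<eta>) = 0"
      using positive_op_form[OF a, of \<eta>] positive_op_form[OF b, of \<eta>] by linarith+
    then have "ap a \<eta> = 0" "ap b \<eta> = 0" using positive_op_kernel a b by blast+
    then show ?thesis by (simp add: d_def \<eta>_def)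
  qed
  then have "inner (ap d \<xi>) (ap d \<xi>) = 0" for \<xi>
    by (metis adj_inner d inner_zero_right)
  then have "ap d \<xi> = 0" for \<xi> by simp
  then show ?thesis by (intro bop_eqI) (simp add: d_def)
qed

lemma Proj_ker_mult:
  assumes "positive_op k"
  shows "k * Proj (ker_op k) = 0" "Proj (ker_op k) * k = 0"
proof -
  note P = Proj_ker[of k]
  have "ap k (ap (Proj (ker_op k)) \<xi>) = 0" for \<xi>
    using P(3) by (auto simp: ker_op_def)
  then show 0: "k * Proj (ker_op k) = 0" by (intro bop_eqI) simp
  then show "Proj (ker_op k) * k = 0"
    using P(1) assms by (metis adj_simps(4,6) positive_op_self_adj self_adj_def)
qed

text \<open>The forms \<open>\<langle>\<xi>, (1-k)\<^sup>n \<xi>\<rangle>\<close> decrease, so the vectors \<open>(1-k)\<^sup>n \<xi>\<close> form a Cauchy sequence,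
  and \<open>k\<close> annihilates their limit.\<close>

lemma power_tendsto_Proj_ker:
  assumes k: "positive_op k" "positive_op (1 - k)"
  shows "(\<lambda>n. ap ((1 - k) ^ n) \<xi>) \<longlonglongrightarrow> ap (Proj (ker_op k)) \<xi>"
proof -
  define b where "b = 1 - k"
  define q where "q n = inner \<xi> (ap (b ^ n) \<xi>)" for n
  have bpos: "positive_op (b ^ n)" for n
    using k(2) by (simp add: b_def positive_op_power)
  have sa: "adj b = b" using k by (simp add: b_def positive_op_iff)
  have comm: "b ^ n * k = k * b ^ n" for n
  proof -
    have "k = 1 - b" by (simp add: b_def)
    then show ?thesis by (simp add: left_diff_distrib right_diff_distrib power_commutes)
  qed
  have diff: "b ^ n - b ^ Suc n = b ^ n * k" for n
  proof -
    have "b ^ Suc n = b ^ n * b" by (simp add: power_commutes)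
    then show ?thesis by (simp add: b_def right_diff_distrib)
  qed
  have "q (Suc n) \<le> q n" for n
    using positive_op_form[OF positive_op_mult_commuting[OF bpos k(1) comm], of \<xi> n]
    by (simp only: diff[symmetric] q_def ap_bop inner_diff_right)
  then have "decseq q" by (simp add: decseq_Suc_iff)
  moreover have "0 \<le> q n" for n unfolding q_def using bpos by (rule positive_op_form)
  ultimately obtain L where L: "q \<longlonglongrightarrow> L"
    using decseq_convergent by blast
  \<comment> \<open>Powers of the self-adjoint \<open>b\<close> can be moved across the inner
    product, so the squared distance is a combination of values of the convergent sequence
    \<open>q\<close> with coefficients 1, -2 and 1.\<close>
  have nrm: "(norm (ap (b ^ m) \<xi> - ap (b ^ n) \<xi>))\<^sup>2 = q (m + m) - 2 * q (m + n) + q (n + n)" for m n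
  proof -
    have "inner (ap (b ^ i) \<xi>) (ap (b ^ j) \<xi>) = q (i + j)" for i j
      unfolding q_def power_add by (metis adj_inner_right adj_power ap_bop(6) sa)
    then show ?thesis
      by (simp add: power2_norm_eq_inner inner_diff_left inner_diff_right add.commute)
  qed
  have "Cauchy (\<lambda>n. ap (b ^ n) \<xi>)"
  proof (rule CauchyI)
    fix e :: real assume e: "e > 0"
    then have "e\<^sup>2 / 4 > 0" by simp
    then obtain K where K: "\<And>n. n \<ge> K \<Longrightarrow> norm (q n - L) < e\<^sup>2 / 4"
      using LIMSEQ_D[OF L] by blast
    have "norm (ap (b ^ m) \<xi> - ap (b ^ n) \<xi>) < e" if "m \<ge> K" "n \<ge> K" for m n
    proof -
      have "\<bar>q (m + m) - L\<bar> < e\<^sup>2 / 4" "\<bar>q (m + n) - L\<bar> < e\<^sup>2 / 4" "\<bar>q (n + n) - L\<bar> < e\<^sup>2 / 4"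
        using K[of "m + m"] K[of "m + n"] K[of "n + n"] that by auto
      then have "(norm (ap (b ^ m) \<xi> - ap (b ^ n) \<xi>))\<^sup>2 < e\<^sup>2"
        unfolding nrm by linarith
      then show ?thesis using e power_less_imp_less_base by fastforce
    qed
    then show "\<exists>M. \<forall>m\<ge>M. \<forall>n\<ge>M. norm (ap (b ^ m) \<xi> - ap (b ^ n) \<xi>) < e" by blast
  qed
  then obtain \<eta> where \<eta>: "(\<lambda>n. ap (b ^ n) \<xi>) \<longlonglongrightarrow> \<eta>"
    using Cauchy_convergent_iff convergent_def by blast
  define p where "p = Proj (ker_op k)"
  have "(\<lambda>n. ap k (ap (b ^ n) \<xi>)) \<longlonglongrightarrow> \<eta> - \<eta>"
  proof -
    have "ap k (ap (b ^ n) \<xi>) = ap (b ^ n) \<xi> - ap (b ^ Suc n) \<xi>" for n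
      by (metis ap_bop(5,6) comm diff)
    then show ?thesis
      using tendsto_diff[OF \<eta> LIMSEQ_Suc[OF \<eta>]] by simp
  qed
  then have "ap k \<eta> = 0"
    using LIMSEQ_unique[OF continuous_ap[OF \<eta>, of k]] by simp
  then have "\<eta> \<in> range (ap p)" using Proj_ker(3)[of k] by (simp add: ker_op_def p_def)
  then have p\<eta>: "ap p \<eta> = \<eta>" using Proj_ker(2)[of k] by (metis ap_bop(6) imageE p_def)
  \<comment> \<open>The limit is fixed by \<open>p\<close>; applying \<open>p\<close> before passing
    to the limit identifies it as the image of \<xi> under \<open>p\<close>.\<close>
  have "p * b ^ n = p" for n
  proof (induction n)
    case (Suc n)
    have "p * b = p" using Proj_ker_mult[OF k(1)] by (simp add: b_def p_def right_diff_distrib)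
    then show ?case using Suc by (simp add: mult.assoc[symmetric])
  qed simp
  then have "ap p (ap (b ^ n) \<xi>) = ap p \<xi>" for n by (metis ap_bop(6))
  then have "ap p \<eta> = ap p \<xi>"
    using LIMSEQ_unique[OF continuous_ap[OF \<eta>, of p]] by simp
  then show ?thesis using \<eta> p\<eta> by (simp add: b_def p_def)
qed

subsection \<open>Tracial states and the 2-norm\<close>

lemma star_subalgebraD:
  assumes "star_subalgebra A"
  shows "1 \<in> A" "0 \<in> A" "a \<in> A \<Longrightarrow> b \<in> A \<Longrightarrow> a + b \<in> A" "a \<in> A \<Longrightarrow> b \<in> A \<Longrightarrow> a * b \<in> A"
    "a \<in> A \<Longrightarrow> c *\<^sub>C a \<in> A" "a \<in> A \<Longrightarrow> adj a \<in> A" "a \<in> A \<Longrightarrow> - a \<in> A"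
    "a \<in> A \<Longrightarrow> b \<in> A \<Longrightarrow> a - b \<in> A" "a \<in> A \<Longrightarrow> r *\<^sub>R a \<in> A" "a \<in> A \<Longrightarrow> a ^ n \<in> A"
    "set as \<subseteq> A \<Longrightarrow> prod_list as \<in> A"
proof -
  show 1: "1 \<in> A" "a \<in> A \<Longrightarrow> b \<in> A \<Longrightarrow> a + b \<in> A" and m: "a \<in> A \<Longrightarrow> b \<in> A \<Longrightarrow> a * b \<in> A"
    and c: "a \<in> A \<Longrightarrow> c *\<^sub>C a \<in> A" and "a \<in> A \<Longrightarrow> adj a \<in> A" for a b c
    using assms unfolding star_subalgebra_def by blast+
  show "0 \<in> A" using c[OF 1(1), of 0] by simp
  show min: "a \<in> A \<Longrightarrow> - a \<in> A" for a using c[of a "-1"] by (simp add: scaleC_bop_minus)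
  show "a \<in> A \<Longrightarrow> b \<in> A \<Longrightarrow> a - b \<in> A" using 1(2)[of a "- b"] min[of b] by simp
  show "a \<in> A \<Longrightarrow> r *\<^sub>R a \<in> A" by (simp add: scaleR_bop_def c)
  show "a \<in> A \<Longrightarrow> a ^ n \<in> A" by (induction n) (auto intro: 1 m)
  show "set as \<subseteq> A \<Longrightarrow> prod_list as \<in> A" by (induction as) (auto intro: 1 m)
qed

lemma star_subalgebra_generated: "star_subalgebra (generated_star_subalgebra S)"
  unfolding generated_star_subalgebra_def
  by (rule hull_in) (simp add: star_subalgebra_def)

lemma generated_superset: "S \<subseteq> generated_star_subalgebra S"
  unfolding generated_star_subalgebra_def by (rule hull_subset)

lemma generated_minimal: "S \<subseteq> A \<Longrightarrow> star_subalgebra A \<Longrightarrow> generated_star_subalgebra S \<subseteq> A"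
  unfolding generated_star_subalgebra_def by (rule hull_minimal)

lemma norm_scaleC: "norm (c *\<^sub>C x) = cmod c * norm x" for x :: "'a::chilbert_space"
proof -
  have "(norm (c *\<^sub>C x))\<^sup>2 = Re (cinner (c *\<^sub>C x) (c *\<^sub>C x))"
    by (simp only: power2_norm_eq_inner inner_cinner)
  also have "\<dots> = Re (of_real ((cmod c)\<^sup>2) * cinner x x)"
    by (simp add: cinner_scaleC_left cinner_scaleC_right complex_norm_square mult_ac
        del: of_real_power)
  also have "\<dots> = (cmod c)\<^sup>2 * Re (cinner x x)" by (simp del: of_real_power)
  also have "\<dots> = (cmod c * norm x)\<^sup>2"
    by (simp only: power_mult_distrib power2_norm_eq_inner[of x] inner_cinner[of x])
  finally show ?thesis by (simp add: power2_eq_iff_nonneg)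
qed

lemma positive_op_norm_square: "positive_op ((norm a)\<^sup>2 *\<^sub>R 1 - adj a * a)"
  unfolding positive_op_iff
proof (intro conjI allI)
  fix \<xi>
  have "(norm (ap a \<xi>))\<^sup>2 \<le> (norm a * norm \<xi>)\<^sup>2"
    by (intro power_mono norm_ap norm_ge_zero)
  then show "0 \<le> inner \<xi> (ap ((norm a)\<^sup>2 *\<^sub>R 1 - adj a * a) \<xi>)"
    by (simp add: inner_diff_right adj_inner_right power_mult_distrib power2_norm_eq_inner
        del: dot_square_norm)
qed simp

locale wstar_space =
  fixes M :: "'a::chilbert_space bop set" and \<tau> :: "'a bop \<Rightarrow> complex"
  assumes wstar: "wstar_prob_space M \<tau>"
begin

lemma star_M: "star_subalgebra M"
  using wstar by (simp add: wstar_prob_space_def von_neumann_algebra_def)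

lemmas M_simps [simp] = star_subalgebraD[OF star_M]

lemma bicommutant_M: "commutant (commutant M) = M"
  using wstar by (simp add: wstar_prob_space_def von_neumann_algebra_def)

lemma tau_add: "a \<in> M \<Longrightarrow> b \<in> M \<Longrightarrow> \<tau> (a + b) = \<tau> a + \<tau> b"
  and tau_scaleC: "a \<in> M \<Longrightarrow> \<tau> (c *\<^sub>C a) = c * \<tau> a"
  and tau_one [simp]: "\<tau> 1 = 1"
  and tau_square: "a \<in> M \<Longrightarrow> \<tau> (adj a * a) \<in> \<real>\<^sub>\<ge>\<^sub>0"
  and tau_commute: "a \<in> M \<Longrightarrow> b \<in> M \<Longrightarrow> \<tau> (a * b) = \<tau> (b * a)"
  using wstar unfolding wstar_prob_space_def tracial_state_on_def by blast+

lemma tau_zero [simp]: "\<tau> 0 = 0"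
  using tau_scaleC[of 0 0] by simp

lemma tau_minus: "a \<in> M \<Longrightarrow> \<tau> (- a) = - \<tau> a"
  using tau_scaleC[of a "-1"] by (simp add: scaleC_bop_minus)

lemma tau_diff: "a \<in> M \<Longrightarrow> b \<in> M \<Longrightarrow> \<tau> (a - b) = \<tau> a - \<tau> b"
  using tau_add[of a "- b"] by (simp add: tau_minus)

lemma tau_scaleR: "a \<in> M \<Longrightarrow> \<tau> (r *\<^sub>R a) = r * \<tau> a"
  by (simp add: scaleR_bop_def tau_scaleC)

lemmas tau_simps = tau_add tau_diff tau_minus tau_scaleC tau_scaleR

text \<open>A state is only assumed to be positive on products \<open>adj c * c\<close>. The root of
  \<open>a + e *\<^sub>R 1\<close> lies in the bicommutant of \<open>a\<close>, hence in
  \<open>M\<close>, which brings \<open>a\<close> into that form up to an arbitrarily small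
  scalar.\<close>

lemma tau_positive:
  assumes "a \<in> M" "positive_op a"
  shows "0 \<le> Re (\<tau> a)" "Im (\<tau> a) = 0"
proof -
  have *: "\<tau> a + of_real e \<in> \<real>\<^sub>\<ge>\<^sub>0" if e: "e > 0" for e
  proof -
    obtain c where c: "adj c = c" "c * c = a + e *\<^sub>R 1" "c \<in> commutant (commutant {a})"
      using sqrt_exists[OF assms(2) e] .
    have "commutant (commutant {a}) \<subseteq> M"
      using commutant_mono[OF commutant_mono, of "{a}" M] assms(1) bicommutant_M by simp
    then have "\<tau> (adj c * c) \<in> \<real>\<^sub>\<ge>\<^sub>0" using c(3) by (intro tau_square) auto
    then show ?thesis by (simp add: c assms tau_simps)
  qed
  show "Im (\<tau> a) = 0" using *[of 1] by (simp add: complex_nonneg_Reals_iff)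
  show "0 \<le> Re (\<tau> a)"
    using * by (rule_tac field_le_epsilon) (simp add: complex_nonneg_Reals_iff)
qed

lemma tau_mono: "a \<in> M \<Longrightarrow> b \<in> M \<Longrightarrow> positive_op (b - a) \<Longrightarrow> Re (\<tau> a) \<le> Re (\<tau> b)"
  using tau_positive(1)[of "b - a"] by (simp add: tau_diff)

lemma tau_self_adj: "a \<in> M \<Longrightarrow> adj a = a \<Longrightarrow> Im (\<tau> a) = 0"
  using tau_positive(2)[of "norm a *\<^sub>R 1 - a"] positive_op_le_norm[of a] by (simp add: tau_simps)

text \<open>The trace is real on the self-adjoint elements \<open>a + adj a\<close> and \<i> times
  \<open>a - adj a\<close>, which gives its real and imaginary parts at
  \<open>adj a\<close>.\<close>

lemma tau_adj:
  assumes "a \<in> M"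
  shows "\<tau> (adj a) = cnj (\<tau> a)"
proof -
  have "Im (\<tau> (a + adj a)) = 0" "Im (\<tau> (\<i> *\<^sub>C (a - adj a))) = 0"
    using assms by (intro tau_self_adj; simp add: add.commute scaleC_bop_diff scaleC_bop_minus)+
  then show ?thesis
    using assms by (simp add: tau_simps complex_eq_iff)
qed

text \<open>This is the square of the 2-norm. With squares the parallelogram identity takes the
  place of the triangle inequality, at the cost of a factor 2.\<close>

definition N2 :: "'a bop \<Rightarrow> real" where "N2 a = Re (\<tau> (adj a * a))"

lemma N2_nonneg: "a \<in> M \<Longrightarrow> 0 \<le> N2 a"
  unfolding N2_def using tau_square[of a] by (simp add: complex_nonneg_Reals_iff)

lemma N2_adj: "a \<in> M \<Longrightarrow> N2 (adj a) = N2 a"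
  unfolding N2_def by (simp add: tau_commute[of a])

lemma N2_add_le:
  assumes "a \<in> M" "b \<in> M"
  shows "N2 (a + b) \<le> 2 * N2 a + 2 * N2 b"
proof -
  have "N2 (a + b) + N2 (a - b) = 2 * N2 a + 2 * N2 b"
    using assms by (simp add: N2_def tau_simps distrib_left distrib_right
        left_diff_distrib right_diff_distrib)
  then show ?thesis using N2_nonneg[of "a - b"] assms by simp
qed

lemma N2_scaleC:
  assumes "a \<in> M"
  shows "N2 (c *\<^sub>C a) = (cmod c)\<^sup>2 * N2 a"
proof -
  have "\<tau> (adj (c *\<^sub>C a) * (c *\<^sub>C a)) = of_real ((cmod c)\<^sup>2) * \<tau> (adj a * a)"
    using assms by (simp add: tau_scaleC complex_norm_square mult_ac del: of_real_power)
  then show ?thesis unfolding N2_def by (simp del: of_real_power)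
qed

lemma N2_mult_left:
  assumes "a \<in> M" "b \<in> M"
  shows "N2 (a * b) \<le> (norm a)\<^sup>2 * N2 b"
proof -
  have "positive_op (adj b * ((norm a)\<^sup>2 *\<^sub>R 1 - adj a * a) * b)"
    by (rule positive_op_conj[OF positive_op_norm_square])
  then have "Re (\<tau> (adj b * (adj a * a) * b)) \<le> Re (\<tau> ((norm a)\<^sup>2 *\<^sub>R (adj b * b)))"
    using assms by (intro tau_mono) (simp_all add: left_diff_distrib right_diff_distrib)
  then show ?thesis using assms by (simp add: N2_def tau_simps mult.assoc)
qed

text \<open>Traciality makes the adjoint isometric for the 2-norm, which turns the bound for left
  factors into one for right factors.\<close>

lemma N2_mult_right: "a \<in> M \<Longrightarrow> b \<in> M \<Longrightarrow> N2 (a * b) \<le> (norm b)\<^sup>2 * N2 a"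
  using N2_mult_left[of "adj b" "adj a"] N2_adj[of "a * b"] N2_adj[of a] by simp

text \<open>The variance \<open>N2 a\<close> minus the squared modulus of \<open>\<tau> a\<close> is
  the value of \<open>N2\<close> at the centred element, hence nonnegative.\<close>

lemma tau_le_N2:
  assumes "a \<in> M"
  shows "(cmod (\<tau> a))\<^sup>2 \<le> N2 a"
proof -
  have "N2 (a - \<tau> a *\<^sub>C 1) = N2 a - (cmod (\<tau> a))\<^sup>2"
    using assms unfolding cmod_power2
    by (simp add: N2_def left_diff_distrib right_diff_distrib tau_simps tau_adj power2_eq_square)
  then show ?thesis using N2_nonneg[of "a - \<tau> a *\<^sub>C 1"] assms by simp
qed

text \<open>Bounded convergence in the 2-norm; on bounded sets it is strong convergence in the
  GNS representation, so algebraic operations are sequentially continuous.\<close>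

definition conv2 :: "(nat \<Rightarrow> 'a bop) \<Rightarrow> 'a bop \<Rightarrow> bool" where
  "conv2 X a \<longleftrightarrow> a \<in> M \<and> (\<forall>n. X n \<in> M) \<and> (\<exists>K. \<forall>n. norm (X n) \<le> K) \<and> (\<lambda>n. N2 (X n - a)) \<longlonglongrightarrow> 0"

lemma conv2I:
  assumes "a \<in> M" "\<And>n. X n \<in> M" "\<And>n. norm (X n) \<le> K"
    and "\<And>n. N2 (X n - a) \<le> f n" "f \<longlonglongrightarrow> 0"
  shows "conv2 X a"
  unfolding conv2_def
proof (intro conjI)
  show "(\<lambda>n. N2 (X n - a)) \<longlonglongrightarrow> 0"
    using assms by (intro tendsto_sandwich[OF _ _ tendsto_const assms(5)]) (auto simp: N2_nonneg)
qed (use assms in auto)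

lemma conv2D: "conv2 X a \<Longrightarrow> a \<in> M" "conv2 X a \<Longrightarrow> X n \<in> M" "conv2 X a \<Longrightarrow> (\<lambda>n. N2 (X n - a)) \<longlonglongrightarrow> 0"
  by (auto simp: conv2_def)

lemma conv2_const: "a \<in> M \<Longrightarrow> conv2 (\<lambda>n. a) a"
  by (rule conv2I[where f = "\<lambda>n. 0" and K = "norm a"]) (auto simp: N2_def)

lemma conv2_add:
  assumes X: "conv2 X a" and Y: "conv2 Y b"
  shows "conv2 (\<lambda>n. X n + Y n) (a + b)"
proof -
  obtain K L where KL: "\<And>n. norm (X n) \<le> K" "\<And>n. norm (Y n) \<le> L"
    using X Y by (auto simp: conv2_def)
  note D = conv2D[OF X] conv2D[OF Y]
  show ?thesis
  proof (rule conv2I)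
    show "norm (X n + Y n) \<le> K + L" for n
      using KL by (meson add_mono norm_triangle_le)
    show "N2 (X n + Y n - (a + b)) \<le> 2 * N2 (X n - a) + 2 * N2 (Y n - b)" for n
    proof -
      have "X n + Y n - (a + b) = (X n - a) + (Y n - b)" by simp
      then show ?thesis using N2_add_le[of "X n - a" "Y n - b"] D by (simp only: M_simps)
    qed
    show "(\<lambda>n. 2 * N2 (X n - a) + 2 * N2 (Y n - b)) \<longlonglongrightarrow> 0"
      using tendsto_add[OF tendsto_mult_left[OF D(3), of 2] tendsto_mult_left[OF D(6), of 2]] by simp
  qed (use D in auto)
qed

lemma conv2_mult:
  assumes X: "conv2 X a" and Y: "conv2 Y b"
  shows "conv2 (\<lambda>n. X n * Y n) (a * b)"
proof -
  obtain K L where KL: "\<And>n. norm (X n) \<le> K" "\<And>n. norm (Y n) \<le> L"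
    using X Y by (auto simp: conv2_def)
  note D = conv2D[OF X] conv2D[OF Y]
  have K0: "0 \<le> K" using KL(1)[of 0] norm_ge_zero order_trans by blast
  show ?thesis
  proof (rule conv2I)
    show "norm (X n * Y n) \<le> K * L" for n
      using KL K0 by (meson mult_mono norm_ge_zero norm_mult_ineq order_trans)
    show "N2 (X n * Y n - a * b) \<le> 2 * (K\<^sup>2 * N2 (Y n - b)) + 2 * ((norm b)\<^sup>2 * N2 (X n - a))" for n
    proof -
      \<comment> \<open>In this splitting the left factor \<open>X n\<close> varies with
        \<open>n\<close>, and its uniform norm bound controls the first summand.\<close>
      have "X n * Y n - a * b = X n * (Y n - b) + (X n - a) * b"
        by (simp add: left_diff_distrib right_diff_distrib)
      moreover have "N2 (X n * (Y n - b)) \<le> K\<^sup>2 * N2 (Y n - b)"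
        using N2_mult_left[of "X n" "Y n - b"] D KL(1)[of n] N2_nonneg[of "Y n - b"]
        by (meson M_simps(8) mult_right_mono norm_ge_zero order_trans power_mono)
      moreover have "N2 ((X n - a) * b) \<le> (norm b)\<^sup>2 * N2 (X n - a)"
        using N2_mult_right D by simp
      ultimately show ?thesis
        using N2_add_le[of "X n * (Y n - b)" "(X n - a) * b"] D by simp
    qed
    have "(\<lambda>n. 2 * (K\<^sup>2 * N2 (Y n - b)) + 2 * ((norm b)\<^sup>2 * N2 (X n - a))) \<longlonglongrightarrow> 2 * (K\<^sup>2 * 0) + 2 * ((norm b)\<^sup>2 * 0)"
      by (intro tendsto_intros D)
    then show "(\<lambda>n. 2 * (K\<^sup>2 * N2 (Y n - b)) + 2 * ((norm b)\<^sup>2 * N2 (X n - a))) \<longlonglongrightarrow> 0" by simp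
  qed (use D in auto)
qed

lemma conv2_scaleC: "conv2 X a \<Longrightarrow> conv2 (\<lambda>n. c *\<^sub>C X n) (c *\<^sub>C a)"
  using conv2_mult[OF conv2_const[of "c *\<^sub>C 1"], of X a] by simp

lemma conv2_adj:
  assumes "conv2 X a"
  shows "conv2 (\<lambda>n. adj (X n)) (adj a)"
proof -
  have "N2 (adj (X n) - adj a) = N2 (X n - a)" for n
    using N2_adj[of "X n - a"] conv2D[OF assms] by simp
  then show ?thesis using assms by (simp add: conv2_def)
qed

lemma conv2_tau:
  assumes "conv2 X a"
  shows "(\<lambda>n. \<tau> (X n)) \<longlonglongrightarrow> \<tau> a"
proof -
  note D = conv2D[OF assms]
  have "(\<lambda>n. (cmod (\<tau> (X n) - \<tau> a))\<^sup>2) \<longlonglongrightarrow> 0"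
    using tau_le_N2[of "X _ - a"] D
    by (intro tendsto_sandwich[OF _ _ tendsto_const D(3)]) (auto simp: tau_diff)
  then have "(\<lambda>n. cmod (\<tau> (X n) - \<tau> a)) \<longlonglongrightarrow> 0"
    using tendsto_real_sqrt[of "\<lambda>n. (cmod (\<tau> (X n) - \<tau> a))\<^sup>2" 0] by simp
  then show ?thesis by (rule LIM_zero_cancel[OF tendsto_norm_zero_cancel])
qed

lemma conv2_center:
  assumes "conv2 X a"
  shows "conv2 (\<lambda>n. X n - \<tau> (X n) *\<^sub>C 1) (a - \<tau> a *\<^sub>C 1)"
proof -
  note D = conv2D[OF assms]
  obtain K where K: "\<And>n. norm (X n) \<le> K" using assms by (auto simp: conv2_def)
  have t: "(\<lambda>n. - \<tau> (X n)) \<longlonglongrightarrow> - \<tau> a" by (intro tendsto_intros conv2_tau assms)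
  then obtain L where L: "\<And>n. cmod (- \<tau> (X n)) \<le> L"
    using Bseq_def convergent_imp_Bseq convergentI by metis
  have nc: "norm (c *\<^sub>C (1 :: 'a bop)) \<le> cmod c" for c
  proof (rule norm_bop_leI)
    show "norm (ap (c *\<^sub>C 1) \<xi>) \<le> cmod c * norm \<xi>" for \<xi> :: 'a
      by (simp add: norm_scaleC)
  qed simp
  have "conv2 (\<lambda>n. (- \<tau> (X n)) *\<^sub>C 1) ((- \<tau> a) *\<^sub>C 1)"
  proof (rule conv2I)
    show "norm ((- \<tau> (X n)) *\<^sub>C (1 :: 'a bop)) \<le> L" for n using nc L order_trans by blast
    show "N2 ((- \<tau> (X n)) *\<^sub>C 1 - (- \<tau> a) *\<^sub>C 1) \<le> (cmod (- \<tau> (X n) - - \<tau> a))\<^sup>2" for n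
    proof -
      have "N2 1 = 1" by (simp add: N2_def)
      then show ?thesis
        unfolding scaleC_bop_diff(2)[symmetric]
        using N2_scaleC[OF M_simps(1), of "- \<tau> (X n) - - \<tau> a"] by (simp only: mult_1_right order_refl)
    qed
    have "(\<lambda>n. (cmod (- \<tau> (X n) - - \<tau> a))\<^sup>2) \<longlonglongrightarrow> (cmod (- \<tau> a - - \<tau> a))\<^sup>2"
      by (intro tendsto_intros t conv2_tau assms)
    then show "(\<lambda>n. (cmod (- \<tau> (X n) - - \<tau> a))\<^sup>2) \<longlonglongrightarrow> 0" by simp
  qed simp_all
  from conv2_add[OF assms this] show ?thesis by (simp add: scaleC_bop_minus)
qed

text \<open>A strong limit of elements of \<open>M\<close> still commutes with every element of the
  commutant, so it lies in the bicommutant.\<close>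

lemma kernel_projection_in_M:
  assumes "k \<in> M" "positive_op k" "positive_op (1 - k)"
  shows "Proj (ker_op k) \<in> M"
proof -
  have "Proj (ker_op k) \<in> commutant (commutant M)"
    unfolding commutant_def[of "commutant M"]
  proof (intro CollectI ballI bop_eqI)
    fix b \<xi> assume "b \<in> commutant M"
    then have "(1 - k) ^ n * b = b * (1 - k) ^ n" for n
      using assms(1) by (simp add: commutant_def)
    then have "ap ((1 - k) ^ n) (ap b \<xi>) = ap b (ap ((1 - k) ^ n) \<xi>)" for n
      by (metis ap_bop(6))
    then have "(\<lambda>n. ap b (ap ((1 - k) ^ n) \<xi>)) \<longlonglongrightarrow> ap (Proj (ker_op k)) (ap b \<xi>)"
      using power_tendsto_Proj_ker[OF assms(2,3), of "ap b \<xi>"] by simp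
    then show "ap (b * Proj (ker_op k)) \<xi> = ap (Proj (ker_op k) * b) \<xi>"
      using LIMSEQ_unique[OF continuous_ap[OF power_tendsto_Proj_ker[OF assms(2,3), of \<xi>], of b]]
      by simp
  qed
  then show ?thesis by (simp add: bicommutant_M)
qed

text \<open>Here normality enters: the elements \<open>1 - (1 - k) ^ n\<close> increase to their
  supremum, the complement of the kernel projection, so their traces converge. Convergence of traces
  is already convergence in the 2-norm.\<close>

lemma power_conv2_Proj_ker:
  assumes k: "k \<in> M" "positive_op k" "positive_op (1 - k)"
  shows "conv2 (\<lambda>n. (1 - k) ^ n) (Proj (ker_op k))"
proof -
  define b where "b = 1 - k"
  define p where "p = Proj (ker_op k)"
  define X where "X n = 1 - b ^ n" for n
  have pM: "p \<in> M" using kernel_projection_in_M[OF k] by (simp add: p_def)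
  have pp: "p * p = p" and sap: "adj p = p"
    using Proj_ker[of k] by (simp_all add: p_def self_adj_def)
  have bM: "b ^ n \<in> M" for n using k by (simp add: b_def)
  have sab: "adj b = b" using k(3) by (simp add: b_def positive_op_iff)
  have bpos: "positive_op (b ^ n)" for n using k(3) by (simp add: b_def positive_op_power)
  have comm: "b ^ n * k = k * b ^ n" for n
  proof -
    have "k = 1 - b" by (simp add: b_def)
    then show ?thesis by (simp add: left_diff_distrib right_diff_distrib power_commutes)
  qed
  have "b * p = p" "p * b = p"
    using Proj_ker_mult[OF k(2)] by (simp_all add: b_def p_def left_diff_distrib right_diff_distrib)
  then have bp: "b ^ n * p = p" "p * b ^ n = p" for n
    by (induction n) (simp_all add: mult.assoc mult.assoc[symmetric] power_commutes)
  have inc: "positive_op (X (Suc n) - X n)" for n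
  proof -
    have "X (Suc n) - X n = b ^ n * k"
      by (simp add: X_def b_def right_diff_distrib power_Suc2 del: power_Suc)
    then show ?thesis using positive_op_mult_commuting[OF bpos k(2) comm] by simp
  qed
  have mono: "positive_op (X n - X m)" if "m \<le> n" for m n
    using that
  proof (induction n rule: dec_induct)
    case (step n)
    then show ?case using positive_op_add[OF inc[of n] step.IH] by simp
  qed simp
  have X_sup: "positive_op (1 - p - X n)" for n
  proof -
    have eq: "1 - p - X n = b ^ n * (1 - p)" by (simp add: X_def bp right_diff_distrib)
    have "positive_op (1 - p)"
      using positive_op_square[of "1 - p"] by (simp add: sap pp left_diff_distrib right_diff_distrib)
    then show ?thesis
      unfolding eq
      by (intro positive_op_mult_commuting bpos) (simp_all add: bp left_diff_distrib right_diff_distrib)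
  qed
  have sup: "is_sup_in M (range X) (1 - p)"
    unfolding is_sup_in_def
  proof (intro conjI ballI impI)
    show "1 - p \<in> M" using pM by simp
    show "self_adj (1 - p)" by (simp add: self_adj_def sap)
    show "op_le a (1 - p)" if "a \<in> range X" for a using that X_sup by (auto simp: op_le_def)
    fix t assume "t \<in> M" and t: "self_adj t \<and> (\<forall>a\<in>range X. op_le a t)"
    show "op_le (1 - p) t"
      unfolding op_le_def positive_op_iff
    proof (intro conjI allI)
      show "adj (t - (1 - p)) = t - (1 - p)" using t by (simp add: self_adj_def sap)
      fix \<xi>
      \<comment> \<open>Inequalities between quadratic forms survive strong limits, so every upper
        bound \<open>t\<close> dominates \<open>1 - p\<close>.\<close>
      have "(\<lambda>n. inner \<xi> (ap t \<xi> - (\<xi> - ap (b ^ n) \<xi>))) \<longlonglongrightarrow> inner \<xi> (ap t \<xi> - (\<xi> - ap p \<xi>))"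
        unfolding b_def p_def by (intro tendsto_intros power_tendsto_Proj_ker k)
      moreover have "0 \<le> inner \<xi> (ap t \<xi> - (\<xi> - ap (b ^ n) \<xi>))" for n
        using t positive_op_form[of "t - X n" \<xi>] by (auto simp: op_le_def X_def)
      ultimately have "0 \<le> inner \<xi> (ap t \<xi> - (\<xi> - ap p \<xi>))"
        by (intro LIMSEQ_le_const) auto
      then show "0 \<le> inner \<xi> (ap (t - (1 - p)) \<xi>)" by simp
    qed
  qed
  have XM: "X n \<in> M" for n using bM by (simp add: X_def)
  have normal: "Re (\<tau> (1 - p)) = (SUP a\<in>range X. Re (\<tau> a))"
  proof -
    have "range X \<subseteq> {a \<in> M. self_adj a}"
      using XM by (auto simp: X_def self_adj_def sab)
    moreover have "\<forall>a\<in>range X. \<forall>c\<in>range X. \<exists>d\<in>range X. op_le a d \<and> op_le c d"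
    proof clarify
      fix m n
      show "\<exists>d\<in>range X. op_le (X m) d \<and> op_le (X n) d"
        using mono[of m "max m n"] mono[of n "max m n"] by (auto simp: op_le_def)
    qed
    ultimately show ?thesis
      using wstar sup unfolding wstar_prob_space_def normal_on_def by blast
  qed
  have "(\<lambda>n. Re (\<tau> (X n))) \<longlonglongrightarrow> (SUP n. Re (\<tau> (X n)))"
  proof (rule LIMSEQ_incseq_SUP)
    show "bdd_above (range (\<lambda>n. Re (\<tau> (X n))))"
      using tau_mono[OF XM _ X_sup] pM by (intro bdd_aboveI[of _ "Re (\<tau> (1 - p))"]) auto
    show "incseq (\<lambda>n. Re (\<tau> (X n)))"
      using tau_mono[OF XM XM mono] by (simp add: incseq_def)
  qed
  then have lim: "(\<lambda>n. Re (\<tau> (X n))) \<longlonglongrightarrow> Re (\<tau> (1 - p))"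
    by (simp only: normal image_image)
  \<comment> \<open>As \<open>b ^ n * p = p = p * b ^ n\<close>, the square of
    \<open>b ^ n - p\<close> is \<open>b ^ (n + n) - p\<close>.\<close>
  have N2: "N2 (b ^ n - p) = Re (\<tau> (1 - p)) - Re (\<tau> (X (n + n)))" for n
    using bM pM by (simp add: N2_def left_diff_distrib right_diff_distrib bp pp sap sab tau_simps
        X_def power_add)
  have "conv2 (\<lambda>n. b ^ n) p"
  proof (rule conv2I)
    show "norm (b ^ n) \<le> 1" for n
    proof (rule norm_le_one_of_positive[OF bpos])
      show "positive_op (1 - b ^ n)" using mono[of 0 n] by (simp add: X_def)
    qed
    show "N2 (b ^ n - p) \<le> Re (\<tau> (1 - p)) - Re (\<tau> (X (n + n)))" for n by (simp add: N2)
    have "filterlim (\<lambda>n::nat. n + n) sequentially sequentially"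
      by (rule filterlim_at_top_mono[OF filterlim_ident]) auto
    from tendsto_diff[OF tendsto_const filterlim_compose[OF lim this], of "Re (\<tau> (1 - p))"]
    show "(\<lambda>n. Re (\<tau> (1 - p)) - Re (\<tau> (X (n + n)))) \<longlonglongrightarrow> 0" by simp
  qed (use pM bM in auto)
  then show ?thesis by (simp add: b_def p_def)
qed

end

subsection \<open>Alternating words\<close>

text \<open>Both ends of a word are letters from \<open>C\<close>, so that elements of
  \<open>B\<close> can be attached on either side without meeting a letter of their own
  kind.\<close>

inductive_set altw :: "'a::chilbert_space bop set \<Rightarrow> 'a bop set \<Rightarrow> 'a bop set" for C B where
  single: "c \<in> C \<Longrightarrow> c \<in> altw C B"
| step: "c \<in> C \<Longrightarrow> b \<in> B \<Longrightarrow> w \<in> altw C B \<Longrightarrow> c * b * w \<in> altw C B"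

text \<open>Finite sums of words with outer coefficients. The coefficient sets are separate from the
  letters because coefficients need not be centred, and the two sides may have to be controlled
  differently.\<close>

inductive_set words ::
  "'a::chilbert_space bop set \<Rightarrow> 'a bop set \<Rightarrow> 'a bop set \<Rightarrow> 'a bop set \<Rightarrow> 'a bop set"
  for C B P Q where
  zero: "0 \<in> words C B P Q"
| add: "x \<in> words C B P Q \<Longrightarrow> p \<in> P \<Longrightarrow> w \<in> altw C B \<Longrightarrow> q \<in> Q \<Longrightarrow> x + p * w * q \<in> words C B P Q"

lemma altw_join:
  assumes "w \<in> altw C B" "b \<in> B" "w' \<in> altw C B"
  shows "w * b * w' \<in> altw C B"
  using assms(1)
proof induction
  case (single c)
  then show ?case using assms by (intro altw.step)
next
  case (step c b' w)
  then show ?case using altw.step[of c C b' B "w * b * w'"] by (simp add: mult.assoc)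
qed

lemma altw_mono:
  assumes "w \<in> altw C B" "B \<subseteq> B'"
  shows "w \<in> altw C B'"
  using assms(1) by induction (use assms(2) in \<open>auto intro: altw.intros\<close>)

lemma words_single: "p \<in> P \<Longrightarrow> w \<in> altw C B \<Longrightarrow> q \<in> Q \<Longrightarrow> p * w * q \<in> words C B P Q"
  using words.add[OF words.zero] by fastforce

lemma words_add:
  assumes "y \<in> words C B P Q" "x \<in> words C B P Q"
  shows "x + y \<in> words C B P Q"
  using assms(1)
proof induction
  case zero
  show ?case using assms(2) by simp
next
  case (add y p w q)
  then show ?case using words.add[of "x + y"] by (simp add: add.assoc)
qed

lemma words_mono:
  assumes "x \<in> words C B P Q" "B \<subseteq> B'" "P \<subseteq> P'" "Q \<subseteq> Q'"
  shows "x \<in> words C B' P' Q'"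
  using assms(1) by induction (use assms in \<open>auto intro!: words.intros intro: altw_mono\<close>)

lemma words_mult_left:
  assumes "x \<in> words C B P Q" "\<And>p. p \<in> P \<Longrightarrow> r * p \<in> P'"
  shows "r * x \<in> words C B P' Q"
  using assms(1)
proof induction
  case (add x p w q)
  then show ?case
    using words.add[of "r * x" C B P' Q "r * p" w q] assms(2) by (simp add: distrib_left mult.assoc)
qed (simp add: words.zero)

lemma words_mult_right:
  assumes "x \<in> words C B P Q" "\<And>q. q \<in> Q \<Longrightarrow> q * r \<in> Q'"
  shows "x * r \<in> words C B P Q'"
  using assms(1)
proof induction
  case (add x p w q)
  then show ?case
    using words.add[of "x * r" C B P Q' p w "q * r"] assms(2) by (simp add: distrib_right mult.assoc)
qed (simp add: words.zero)

text \<open>The inner coefficients \<open>q\<close> and \<open>p\<close> together with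
  \<open>b\<close> form one new letter; the hypothesis says that this letter is admissible.\<close>

lemma words_join:
  assumes x: "x \<in> words C B P Q" and y: "y \<in> words C B P' Q'"
    and b: "\<And>q p. q \<in> Q \<Longrightarrow> p \<in> P' \<Longrightarrow> q * b * p \<in> B"
  shows "x * b * y \<in> words C B P Q'"
  using x
proof induction
  case (add x p w q)
  have "p * w * q * b * y \<in> words C B P Q'"
    using y
  proof induction
    case (add y p' w' q')
    have "p * (w * (q * b * p') * w') * q' \<in> words C B P Q'"
      using add \<open>p \<in> P\<close> \<open>w \<in> altw C B\<close> \<open>q \<in> Q\<close> b by (intro words_single altw_join) auto
    from words_add[OF this add.IH] show ?case by (simp add: distrib_left mult.assoc)
  qed (simp add: words.zero)
  from words_add[OF this add.IH] show ?case by (simp add: distrib_right)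
qed (simp add: words.zero)

text \<open>The letters of \<open>KB\<close> absorb the coefficients in \<open>D\<close> of the neighbouring words.\<close>

lemma alternating_product_words:
  fixes l :: "(nat \<times> 'a::chilbert_space bop) list"
  assumes "l \<noteq> []" "distinct_adj (map fst l)"
    and "\<And>i a. (i, a) \<in> set l \<Longrightarrow> i = 0 \<and> a \<in> KA \<or> i = 1 \<and> a \<in> KB"
    and D: "D \<subseteq> B" and BB: "\<And>a b. a \<in> B \<Longrightarrow> b \<in> B \<Longrightarrow> a * b \<in> B"
    and KA: "KA \<subseteq> words C B0 D D" and KB: "KB \<subseteq> B"
    and DK: "\<And>d b d'. d \<in> D \<Longrightarrow> b \<in> KB \<Longrightarrow> d' \<in> D \<Longrightarrow> d * b * d' \<in> B0"
  shows "prod_list (map snd l) \<in> KB \<union> words C B0 B B"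
proof -
  \<comment> \<open>The induction keeps the left coefficients in \<open>D\<close>, where they can
    still be absorbed by a letter of \<open>KB\<close> in front. For this reason such a first letter
    is kept apart from the remaining words.\<close>
  have "(fst (hd l) = 0 \<longrightarrow> prod_list (map snd l) \<in> words C B0 D B) \<and>
    (fst (hd l) = 1 \<longrightarrow> prod_list (map snd l) \<in> KB \<or>
      (\<exists>b\<in>KB. \<exists>z\<in>words C B0 D B. prod_list (map snd l) = b * z))"
    using assms(1-3)
  proof (induction l)
    case (Cons x l)
    obtain i a where x: "x = (i, a)" by (cases x)
    then consider "i = 0" "a \<in> KA" | "i = 1" "a \<in> KB" using Cons.prems(3)[of i a] by auto
    note ia = this
    show ?case
    proof (cases "l = []")
      case True
      then show ?thesis using ia x KA D words_mono[of a C B0 D D B0 D B] by auto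
    next
      case False
      then have ne: "fst (hd l) \<noteq> i" and da: "distinct_adj (map fst l)"
        using Cons.prems(2) x by (cases l; simp)+
      have IH: "(fst (hd l) = 0 \<longrightarrow> prod_list (map snd l) \<in> words C B0 D B) \<and>
        (fst (hd l) = 1 \<longrightarrow> prod_list (map snd l) \<in> KB \<or>
          (\<exists>b\<in>KB. \<exists>z\<in>words C B0 D B. prod_list (map snd l) = b * z))"
        using False da Cons.prems(3) by (intro Cons.IH) auto
      have hd: "fst (hd l) = 0 \<or> fst (hd l) = 1"
        using Cons.prems(3)[of "fst (hd l)" "snd (hd l)"] False by auto
      from ia show ?thesis
      proof cases
        case 1
        then have a: "a \<in> words C B0 D D" using KA by auto
        from 1 ne hd IH consider "prod_list (map snd l) \<in> KB"
          | b z where "b \<in> KB" "z \<in> words C B0 D B" "prod_list (map snd l) = b * z" by auto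
        then have "a * prod_list (map snd l) \<in> words C B0 D B"
        proof cases
          case 1
          then show ?thesis using a D KB BB by (intro words_mult_right[OF a]) auto
        next
          case (2 b z)
          then show ?thesis using words_join[OF a, of z D B b] DK by (simp add: mult.assoc)
        qed
        then show ?thesis using x 1 by simp
      next
        case 2
        then show ?thesis using x ne hd IH by auto
      qed
    qed
  qed simp
  moreover have "fst (hd l) = 0 \<or> fst (hd l) = 1"
    using assms(3)[of "fst (hd l)" "snd (hd l)"] assms(1) by auto
  moreover have "words C B0 D B \<subseteq> words C B0 B B" using D words_mono by blast
  moreover have "b * z \<in> words C B0 B B" if "b \<in> KB" "z \<in> words C B0 D B" for b z
    using that D KB BB by (intro words_mult_left[of z C B0 D B]) auto
  ultimately show ?thesis by auto
qed

section \<open>Freeness: traces of words, limits, joint moments, generated algebras\<close>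

lemma free_wrt_cong:
  "(\<And>i. i \<in> I \<Longrightarrow> A i = A' i) \<Longrightarrow> free_wrt E I A \<longleftrightarrow> free_wrt E I A'"
  unfolding free_wrt_def by (intro all_cong1 imp_cong conj_cong refl ball_cong) auto

lemma free_wrtD:
  assumes "free_wrt E I A" "w \<noteq> []" "distinct_adj (map fst w)"
    and "\<forall>(i, a)\<in>set w. i \<in> I \<and> a \<in> A i \<and> E a = 0"
  shows "E (prod_list (map snd w)) = 0"
  using assms unfolding free_wrt_def by blast

lemma free_wrt_mono:
  assumes "free_wrt E I A" "\<And>i. i \<in> I \<Longrightarrow> A' i \<subseteq> A i"
  shows "free_wrt E I A'"
  unfolding free_wrt_def
proof (intro allI impI, elim conjE)
  fix w :: "('c \<times> 'a) list"
  assume w: "w \<noteq> []" "distinct_adj (map fst w)" "\<forall>(i, a)\<in>set w. i \<in> I \<and> a \<in> A' i \<and> E a = 0"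
  then have "\<forall>(i, a)\<in>set w. i \<in> I \<and> a \<in> A i \<and> E a = 0" using assms(2) by fast
  with w assms(1) show "E (prod_list (map snd w)) = 0" by (intro free_wrtD)
qed

lemma not_distinct_adjE:
  assumes "\<not> distinct_adj (map fst l)"
  obtains xs i x y ys where "l = xs @ (i, x) # (i, y) # ys"
  using assms
proof (induction l arbitrary: thesis)
  case (Cons a l)
  show ?case
  proof (cases "distinct_adj (map fst l)")
    case True
    with Cons.prems(2) obtain b l' where "l = b # l'" "fst a = fst b"
      by (cases l) auto
    then have "a # l = [] @ (fst a, snd a) # (fst a, snd b) # l'" by (simp add: prod_eq_iff)
    then show ?thesis using Cons.prems(1) by blast
  next
    case False
    then obtain xs i x y ys where "l = xs @ (i, x) # (i, y) # ys" using Cons.IH by blast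
    then show ?thesis using Cons.prems(1)[of "a # xs"] by simp
  qed
qed simp

context wstar_space
begin

definition centred :: "'a bop set \<Rightarrow> 'a bop set" where "centred A = {a \<in> A. \<tau> a = 0}"

lemma centre_in:
  assumes "star_subalgebra A" "A \<subseteq> M" "a \<in> A"
  shows "a - \<tau> a *\<^sub>C 1 \<in> centred A"
  using assms star_subalgebraD[OF assms(1)] by (auto simp: centred_def tau_simps)

lemma altw_list:
  assumes "w \<in> altw (centred C) (centred B)"
  shows "\<exists>l. l \<noteq> [] \<and> distinct_adj (map fst l) \<and> fst (hd l) = (0::nat) \<and> fst (last l) = 0 \<and>
    (\<forall>(i, a)\<in>set l. i \<in> {..<2} \<and> a \<in> (if i = 0 then C else B) \<and> \<tau> a = 0) \<and> prod_list (map snd l) = w"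
  using assms
proof induction
  case (single c)
  then show ?case by (intro exI[of _ "[(0, c)]"]) (auto simp: centred_def)
next
  case (step c b w)
  then obtain l where l: "l \<noteq> []" "distinct_adj (map fst l)" "fst (hd l) = (0::nat)" "fst (last l) = 0"
    "\<forall>(i, a)\<in>set l. i \<in> {..<2} \<and> a \<in> (if i = 0 then C else B) \<and> \<tau> a = 0"
    "prod_list (map snd l) = w" by blast
  then show ?case using step.hyps
    by (intro exI[of _ "(0, c) # (1, b) # l"])
      (auto simp: centred_def mult.assoc distinct_adj_Cons hd_map)
qed

text \<open>Each outer coefficient splits into a centred letter and a scalar. The four resulting
  words all alternate and contain a centred letter from \<open>C\<close>, so freeness gives trace
  zero.\<close>

lemma tau_words:
  assumes C: "C \<subseteq> M" and B: "star_subalgebra B" "B \<subseteq> M"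
    and free: "free_wrt \<tau> {..<2} (\<lambda>i::nat. if i = 0 then C else B)"
    and x: "x \<in> words (centred C) (centred B) B B"
  shows "x \<in> M \<and> \<tau> x = 0"
proof -
  note Bs = star_subalgebraD[OF B(1)]
  have wM: "w \<in> M" if "w \<in> altw (centred C) (centred B)" for w
    using that by induction (use C B in \<open>auto simp: centred_def subset_iff\<close>)
  have 0: "\<tau> (prod_list (map snd l)) = 0"
    if "l \<noteq> []" "distinct_adj (map fst l)"
      "\<forall>(i, a)\<in>set l. i \<in> {..<2} \<and> a \<in> (if i = 0 then C else B) \<and> \<tau> a = 0" for l :: "(nat \<times> 'a bop) list"
    using that free unfolding free_wrt_def by blast
  have tw: "\<tau> w = 0 \<and> (\<forall>b\<in>centred B. \<tau> (b * w) = 0 \<and> \<tau> (w * b) = 0 \<and> (\<forall>b'\<in>centred B. \<tau> (b * w * b') = 0))"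
    if "w \<in> altw (centred C) (centred B)" for w
  proof -
    obtain l where l: "l \<noteq> []" "distinct_adj (map fst l)" "fst (hd l) = (0::nat)" "fst (last l) = 0"
      "\<forall>(i, a)\<in>set l. i \<in> {..<2} \<and> a \<in> (if i = 0 then C else B) \<and> \<tau> a = 0"
      "prod_list (map snd l) = w" using altw_list \<open>w \<in> _\<close> by blast
    have "\<tau> (b * w) = 0 \<and> \<tau> (w * b) = 0" if "b \<in> centred B" for b
      using 0[of "(1, b) # l"] 0[of "l @ [(1, b)]"] l that
      by (auto simp: centred_def distinct_adj_Cons distinct_adj_append_iff hd_map last_map)
    moreover have "\<tau> (b * w * b') = 0" if "b \<in> centred B" "b' \<in> centred B" for b b'
      using 0[of "(1, b) # l @ [(1, b')]"] l that
      by (auto simp: centred_def distinct_adj_Cons distinct_adj_append_iff hd_map last_map mult.assoc)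
    ultimately show ?thesis using 0[of l] l by auto
  qed
  have "\<tau> (b * w * b') = 0" if w: "w \<in> altw (centred C) (centred B)" and b: "b \<in> B" "b' \<in> B" for b w b'
  proof -
    define c where "c = b - \<tau> b *\<^sub>C 1"
    define c' where "c' = b' - \<tau> b' *\<^sub>C 1"
    have c: "c \<in> centred B" "c' \<in> centred B" using b B by (auto simp: c_def c'_def centre_in)
    then have cM: "c \<in> M" "c' \<in> M" using B by (auto simp: centred_def)
    have "b * w * b' = c * w * c' + \<tau> b *\<^sub>C (w * c') + \<tau> b' *\<^sub>C (c * w) + (\<tau> b * \<tau> b') *\<^sub>C w"
      by (simp add: c_def c'_def left_diff_distrib right_diff_distrib scaleC_bop_diff mult.assoc mult.commute)
    then show ?thesis using tw[OF w] c cM wM[OF w] by (simp add: tau_simps)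
  qed
  note bwb = this
  show ?thesis
    using x
  proof induction
    case (add x p w q)
    then have "p \<in> M" "w \<in> M" "q \<in> M" using wM B by auto
    with add bwb[of w p q] show ?case by (simp add: tau_simps)
  qed simp
qed

text \<open>Letters from \<open>B\<close> are replaced by approximants in \<open>A\<close>, centred
  again at every stage, while letters from \<open>C\<close> stay constant. Products and traces pass
  to the limit.\<close>

lemma free_wrt_conv2_closure:
  assumes C: "C \<subseteq> M" and A: "star_subalgebra A" "A \<subseteq> M"
    and free: "free_wrt \<tau> {..<2} (\<lambda>i::nat. if i = 0 then C else A)"
    and B: "\<And>b. b \<in> B \<Longrightarrow> \<exists>X. (\<forall>n. X n \<in> A) \<and> conv2 X b"
  shows "free_wrt \<tau> {..<2} (\<lambda>i::nat. if i = 0 then C else B)"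
  unfolding free_wrt_def
proof (intro allI impI, elim conjE)
  fix w :: "(nat \<times> 'a bop) list"
  assume w: "w \<noteq> []" "distinct_adj (map fst w)"
    and W: "\<forall>(i, a)\<in>set w. i \<in> {..<2} \<and> a \<in> (if i = 0 then C else B) \<and> \<tau> a = 0"
  have "\<forall>y. \<exists>Y. y \<in> set w \<longrightarrow> (\<forall>n. Y n \<in> (if fst y = 0 then C else A) \<and> \<tau> (Y n) = 0) \<and> conv2 Y (snd y)"
  proof
    fix y
    show "\<exists>Y. y \<in> set w \<longrightarrow> (\<forall>n. Y n \<in> (if fst y = 0 then C else A) \<and> \<tau> (Y n) = 0) \<and> conv2 Y (snd y)"
    proof (cases "y \<in> set w \<and> fst y \<noteq> 0")
      case True
      then have y: "snd y \<in> B" "\<tau> (snd y) = 0" using W by (auto simp: case_prod_beta)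
      obtain X where X: "\<And>n. X n \<in> A" "conv2 X (snd y)" using B[OF y(1)] by blast
      have "conv2 (\<lambda>n. X n - \<tau> (X n) *\<^sub>C 1) (snd y)"
        using conv2_center[OF X(2)] y by simp
      then show ?thesis
        using centre_in[OF A X(1)] True by (intro exI[of _ "\<lambda>n. X n - \<tau> (X n) *\<^sub>C 1"]) (auto simp: centred_def)
    next
      case False
      have "y \<in> set w \<Longrightarrow> snd y \<in> (if fst y = 0 then C else B)" using W by (auto simp: case_prod_beta)
      with False C have "y \<in> set w \<Longrightarrow> snd y \<in> M" by auto
      then show ?thesis
        using W False by (intro exI[of _ "\<lambda>n. snd y"]) (auto simp: case_prod_beta intro!: conv2_const)
    qed
  qed
  then obtain F where F: "\<And>y n. y \<in> set w \<Longrightarrow> F y n \<in> (if fst y = 0 then C else A) \<and> \<tau> (F y n) = 0"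
    "\<And>y. y \<in> set w \<Longrightarrow> conv2 (F y) (snd y)" by metis
  have conv: "conv2 (\<lambda>n. prod_list (map (\<lambda>y. F y n) v)) (prod_list (map snd v))" if "set v \<subseteq> set w" for v
    using that by (induction v) (auto intro: conv2_const conv2_mult F(2))
  have "\<tau> (prod_list (map (\<lambda>y. F y n) w)) = 0" for n
  proof -
    define v where "v = map (\<lambda>y. (fst y, F y n)) w"
    have "map fst v = map fst w" "map snd v = map (\<lambda>y. F y n) w" by (auto simp: v_def)
    moreover have "\<forall>(i, a)\<in>set v. i \<in> {..<2} \<and> a \<in> (if i = 0 then C else A) \<and> \<tau> a = 0"
      using F(1) W by (fastforce simp: v_def)
    moreover have "v \<noteq> []" using w by (simp add: v_def)
    ultimately show ?thesis
      using free_wrtD[OF free, of v] w(2) by simp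
  qed
  then show "\<tau> (prod_list (map snd w)) = 0"
    using LIMSEQ_unique[OF conv2_tau[OF conv[OF order_refl]]] by simp
qed

text \<open>Equal neighbours are merged, and letters are centred one
  at a time, the scalar part giving a shorter word.\<close>

lemma free_moments_eq:
  fixes R :: "nat \<Rightarrow> ('a bop \<times> 'a bop) set"
  assumes free: "free_wrt \<tau> I A" "free_wrt \<tau> I A'"
    and R: "\<And>i a a'. (a, a') \<in> R i \<Longrightarrow> i \<in> I \<and> a \<in> A i \<and> a' \<in> A' i \<and> a \<in> M \<and> a' \<in> M \<and> \<tau> a = \<tau> a'"
    and Rm: "\<And>i a a' b b'. (a, a') \<in> R i \<Longrightarrow> (b, b') \<in> R i \<Longrightarrow> (a * b, a' * b') \<in> R i"
    and Rc: "\<And>i a a'. (a, a') \<in> R i \<Longrightarrow> (a - \<tau> a *\<^sub>C 1, a' - \<tau> a' *\<^sub>C 1) \<in> R i"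
    and l: "\<And>i x. (i, x) \<in> set l \<Longrightarrow> x \<in> R i"
  shows "\<tau> (prod_list (map (fst \<circ> snd) l)) = \<tau> (prod_list (map (snd \<circ> snd) l))"
  using l
proof (induction "length l" arbitrary: l rule: less_induct)
  case less
  let ?L = "\<lambda>l. prod_list (map (fst \<circ> snd) l)" and ?R = "\<lambda>l. prod_list (map (snd \<circ> snd) l)"
  have PM: "?L v \<in> M \<and> ?R v \<in> M" if "\<And>i x. (i, x) \<in> set v \<Longrightarrow> x \<in> R i" for v :: "(nat \<times> 'a bop \<times> 'a bop) list"
    using that
  proof (induction v)
    case (Cons y v)
    obtain i a a' where y: "y = (i, a, a')" by (cases y) auto
    have "?L v \<in> M \<and> ?R v \<in> M" using Cons.prems by (intro Cons.IH) auto
    then show ?case using R[of a a' i] Cons.prems[of i "(a, a')"] y by (simp add: o_def)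
  qed simp
  show ?case
  proof (cases "distinct_adj (map fst l)")
    case False
    then obtain xs i x y ys where l: "l = xs @ (i, x) # (i, y) # ys" by (rule not_distinct_adjE)
    define l' where "l' = xs @ (i, (fst x * fst y, snd x * snd y)) # ys"
    have xy: "x \<in> R i" "y \<in> R i" using less.prems by (auto simp: l)
    then have "(fst x * fst y, snd x * snd y) \<in> R i" by (intro Rm) auto
    then have "\<tau> (?L l') = \<tau> (?R l')"
      using less.prems by (intro less.hyps) (auto simp: l l'_def)
    then show ?thesis by (simp add: l l'_def mult.assoc)
  next
    case True
    \<comment> \<open>The prefix \<open>pre\<close> holds the letters already centred, and the inner
      induction moves through \<open>suf\<close>.\<close>
    have "\<tau> (?L (pre @ suf)) = \<tau> (?R (pre @ suf))"
      if "length (pre @ suf) = length l" "distinct_adj (map fst (pre @ suf))"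
        "\<And>i x. (i, x) \<in> set (pre @ suf) \<Longrightarrow> x \<in> R i"
        "\<And>i x. (i, x) \<in> set pre \<Longrightarrow> \<tau> (fst x) = 0" for pre suf
      using that
    proof (induction suf arbitrary: pre)
      case Nil
      show ?case
      proof (cases "pre = []")
        case False
        define v where "v = map (\<lambda>y. (fst y, fst (snd y))) pre"
        define v' where "v' = map (\<lambda>y. (fst y, snd (snd y))) pre"
        have "v \<noteq> []" "v' \<noteq> []" using False by (auto simp: v_def v'_def)
        moreover have "map fst v = map fst pre" "map fst v' = map fst pre"
          "map snd v = map (fst \<circ> snd) pre" "map snd v' = map (snd \<circ> snd) pre"
          by (auto simp: v_def v'_def)
        moreover have *: "i \<in> I \<and> a \<in> A i \<and> \<tau> a = 0 \<and> a' \<in> A' i \<and> \<tau> a' = 0" if "(i, a, a') \<in> set pre" for i a a'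
          using R[of a a' i] Nil.prems(3)[of i "(a, a')"] Nil.prems(4)[of i "(a, a')"] that by auto
        moreover have "\<forall>(i, a)\<in>set v. i \<in> I \<and> a \<in> A i \<and> \<tau> a = 0" "\<forall>(i, a)\<in>set v'. i \<in> I \<and> a \<in> A' i \<and> \<tau> a = 0"
          using * by (auto simp: v_def v'_def)
        ultimately show ?thesis
          using free_wrtD[OF free(1), of v] free_wrtD[OF free(2), of v'] Nil.prems(2)
          by (simp add: o_def)
      qed simp
    next
      case (Cons y suf)
      obtain i a a' where y: "y = (i, a, a')" by (cases y) auto
      have aR: "(a, a') \<in> R i" using Cons.prems(3)[of i "(a, a')"] y by auto
      note Ra = R[OF aR]
      define z where "z = (i, a - \<tau> a *\<^sub>C 1, a' - \<tau> a' *\<^sub>C 1)"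
      have 1: "\<tau> (?L ((pre @ [z]) @ suf)) = \<tau> (?R ((pre @ [z]) @ suf))"
      proof (rule Cons.IH)
        show "length ((pre @ [z]) @ suf) = length l" using Cons.prems by simp
        show "distinct_adj (map fst ((pre @ [z]) @ suf))" using Cons.prems(2) by (simp add: y z_def)
        show "x \<in> R j" if "(j, x) \<in> set ((pre @ [z]) @ suf)" for j x
          using that Cons.prems(3)[of j x] Rc[OF aR] by (auto simp: z_def)
        show "\<tau> (fst x) = 0" if "(j, x) \<in> set (pre @ [z])" for j x
          using that Cons.prems(4)[of j x] Ra by (auto simp: z_def tau_simps)
      qed
      \<comment> \<open>Dropping a letter may bring equal indices together; the outer induction on
        the length covers such words as well.\<close>
      have 2: "\<tau> (?L (pre @ suf)) = \<tau> (?R (pre @ suf))"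
        using Cons.prems(1,3) by (intro less.hyps) auto
      have M: "?L pre \<in> M \<and> ?R pre \<in> M" "?L suf \<in> M \<and> ?R suf \<in> M"
        by (rule PM; use Cons.prems(3) in force)+
      have "?L (pre @ y # suf) = ?L ((pre @ [z]) @ suf) + \<tau> a *\<^sub>C ?L (pre @ suf)"
        "?R (pre @ y # suf) = ?R ((pre @ [z]) @ suf) + \<tau> a' *\<^sub>C ?R (pre @ suf)"
        by (simp_all add: y z_def left_diff_distrib right_diff_distrib mult.assoc)
      moreover have "?L ((pre @ [z]) @ suf) \<in> M" "?R ((pre @ [z]) @ suf) \<in> M"
        "?L (pre @ suf) \<in> M" "?R (pre @ suf) \<in> M"
        using M Ra by (simp_all add: z_def)
      ultimately show ?case using 1 2 Ra by (simp only: tau_simps M_simps)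
    qed
    from this[of "[]" l] show ?thesis using True less.prems by simp
  qed
qed

text \<open>The span of \<open>D\<close> and the words is stable under left multiplication by the generators.\<close>

lemma generated_decomposition:
  assumes C: "star_subalgebra C" "C \<subseteq> M" and D: "star_subalgebra D" "D \<subseteq> M"
    and S: "S \<subseteq> C \<union> D" and y: "y \<in> generated_star_subalgebra S"
  shows "\<exists>d\<in>D. \<exists>x\<in>words (centred C) (centred D) D D. y = d + x"
proof -
  let ?W = "words (centred C) (centred D) D D"
  define G where "G = {d + x |d x. d \<in> D \<and> x \<in> ?W}"
  note Cs = star_subalgebraD[OF C(1)] and Ds = star_subalgebraD[OF D(1)]
  have WG: "x \<in> G" if "x \<in> ?W" for x using that Ds(2) by (force simp: G_def)
  have DG: "d \<in> G" if "d \<in> D" for d using that words.zero by (force simp: G_def)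
  have Gadd: "x + y \<in> G" if x: "x \<in> G" and y: "y \<in> G" for x y
  proof -
    obtain d v where v: "x = d + v" "d \<in> D" "v \<in> ?W" using x by (auto simp: G_def)
    obtain e w where w: "y = e + w" "e \<in> D" "w \<in> ?W" using y by (auto simp: G_def)
    have "x + y = (d + e) + (v + w)" by (simp add: v w add_ac)
    moreover have "d + e \<in> D" "v + w \<in> ?W" using v w Ds(3) words_add by auto
    ultimately show ?thesis unfolding G_def by blast
  qed
  have Dmul: "d * x \<in> G" if d: "d \<in> D" and x: "x \<in> G" for d x
  proof -
    obtain e w where w: "x = e + w" "e \<in> D" "w \<in> ?W" using x by (auto simp: G_def)
    have "d * w \<in> ?W" using d Ds by (intro words_mult_left[OF w(3)]) auto
    then show ?thesis using w d Ds(4) by (auto simp: G_def distrib_left)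
  qed
  have Gsc: "c *\<^sub>C x \<in> G" if "x \<in> G" for c x
    using Dmul[OF Ds(5)[OF Ds(1)] that, of c] by simp
  have one: "1 * w * q \<in> G" if "w \<in> altw (centred C) (centred D)" "q \<in> D" for w q
    using that Ds by (intro WG words_single) auto
  have cw: "c * w * q \<in> G" if c: "c \<in> C" and w: "w \<in> altw (centred C) (centred D)" and q: "q \<in> D" for c w q
    using w
  proof cases
    case single
    then have m: "c * w \<in> C" using c Cs by (auto simp: centred_def)
    have "c * w * q = 1 * (c * w - \<tau> (c * w) *\<^sub>C 1) * q + \<tau> (c * w) *\<^sub>C q"
      by (simp add: left_diff_distrib)
    then show ?thesis
      using one[OF altw.single[OF centre_in[OF C m]] q] Gsc[OF DG[OF q]] Gadd by simp
  next
    case (step c' b w')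
    then have m: "c * c' \<in> C" and b: "b \<in> D" using c Cs by (auto simp: centred_def)
    \<comment> \<open>The letter \<open>c\<close> merges with the leading \<open>c'\<close>. The
      scalar part of the product exposes \<open>b\<close>, which becomes a left coefficient of the
      shorter word.\<close>
    have "c * w * q = 1 * ((c * c' - \<tau> (c * c') *\<^sub>C 1) * b * w') * q + \<tau> (c * c') *\<^sub>C (b * (1 * w' * q))"
      by (simp add: left_diff_distrib step(1) mult.assoc)
    then show ?thesis
      using one[OF altw.step[OF centre_in[OF C m] step(3,4)] q] Gsc[OF Dmul[OF b one[OF step(4) q]]] Gadd
      by simp
  qed
  have Cmul: "c * x \<in> G" if c: "c \<in> C" and x: "x \<in> G" for c x
  proof -
    obtain e w where w: "x = e + w" "e \<in> D" "w \<in> ?W" using x by (auto simp: G_def)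
    define c0 where "c0 = c - \<tau> c *\<^sub>C 1"
    have c0: "c0 \<in> centred C" using centre_in C c by (simp add: c0_def)
    then have c0C: "c0 \<in> C" by (simp add: centred_def)
    have "c * e = 1 * c0 * e + \<tau> c *\<^sub>C e" by (simp add: c0_def left_diff_distrib)
    then have e: "c * e \<in> G" using one[OF altw.single[OF c0] w(2)] Gsc[OF DG[OF w(2)]] Gadd by simp
    have "c * w \<in> G"
      using w(3)
    proof induction
      case zero
      then show ?case using DG Ds by simp
    next
      case (add x p w q)
      define p0 where "p0 = p - \<tau> p *\<^sub>C 1"
      have p0: "p0 \<in> centred D" using centre_in D add by (simp add: p0_def)
      have pwq: "p * w * q \<in> G" using add by (intro WG words_single)
      have "c * (p * w * q) = 1 * (c0 * p0 * w) * q + \<tau> p *\<^sub>C (c0 * w * q) + \<tau> c *\<^sub>C (p * w * q)"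
        by (simp add: c0_def p0_def left_diff_distrib right_diff_distrib mult.assoc scaleC_bop_diff)
      moreover have "1 * (c0 * p0 * w) * q \<in> G"
        using add c0 p0 by (intro one altw.step)
      ultimately have "c * (p * w * q) \<in> G"
        using Gadd Gsc cw[OF c0C add(3,4)] pwq by metis
      then show ?case using Gadd add.IH by (simp add: distrib_left)
    qed
    then show ?thesis using e Gadd by (simp add: w(1) distrib_left)
  qed
  \<comment> \<open>Requiring stability for \<open>adj y\<close> as well makes \<open>T\<close> a
    *-subalgebra. Applied to 1, stability shows that \<open>y\<close> itself lies in
    \<open>G\<close>.\<close>
  define T where "T = {y. (\<forall>g\<in>G. y * g \<in> G) \<and> (\<forall>g\<in>G. adj y * g \<in> G)}"
  have "star_subalgebra T"
    unfolding star_subalgebra_def T_def using Gadd Gsc by (auto simp: distrib_right mult.assoc)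
  moreover have "S \<subseteq> T"
    using S Cs(6) Ds(6) Cmul Dmul unfolding T_def by blast
  ultimately have "y \<in> T" using y generated_minimal by blast
  then have "y * 1 \<in> G" using DG Ds(1) unfolding T_def by blast
  then show ?thesis by (auto simp: G_def)
qed

end

subsection \<open>Moments of a positive operator\<close>

text \<open>Since \<open>k\<close> commutes with itself, the bicommutant of \<open>k\<close> is
  contained in its commutant. This supplies the commutation relations for products of positive
  operators built from \<open>k\<close>.\<close>

lemma bicommutant_commute:
  assumes "a \<in> commutant (commutant {k})" "b \<in> commutant (commutant {k})"
  shows "a * b = b * a"
proof -
  have "b \<in> commutant {k}" using assms(2) by (simp add: commutant_def)
  then show ?thesis using assms(1) by (simp add: commutant_def)
qed

lemma commutant_power:
  "a \<in> commutant S \<Longrightarrow> a ^ n \<in> commutant S"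
  by (induction n) (auto intro: commutant_algebra)

lemma positive_op_one_minus_scaled:
  assumes "positive_op a" "norm a \<le> r" "0 < r"
  shows "positive_op (1 - inverse r *\<^sub>R a)"
proof -
  have "positive_op (inverse r *\<^sub>R ((norm a *\<^sub>R 1 - a) + (r - norm a) *\<^sub>R 1))"
    using assms
    by (intro positive_op_scaleR positive_op_add positive_op_le_norm) (auto simp: positive_op_self_adj)
  moreover have "(norm a *\<^sub>R 1 - a) + (r - norm a) *\<^sub>R 1 = r *\<^sub>R 1 - a"
    by (simp add: scaleR_diff_left)
  ultimately have "positive_op (inverse r *\<^sub>R (r *\<^sub>R 1 - a))" by (simp only:)
  then show ?thesis using assms(3) by (simp only: scaleR_diff_right) simp
qed

text \<open>Polynomials in \<open>k\<^sup>2\<close> increasing to \<open>k\<close> when \<open>0 \<le> k \<le> 1\<close>, evaluated at \<open>s = k\<^sup>2\<close>.\<close>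

primrec sqrt_iter :: "'a::chilbert_space bop \<Rightarrow> nat \<Rightarrow> 'a bop" where
  "sqrt_iter s 0 = 0"
| "sqrt_iter s (Suc n) = sqrt_iter s n + (1/2) *\<^sub>R (s - sqrt_iter s n * sqrt_iter s n)"

text \<open>Pairs of values at \<open>s\<close> and \<open>t\<close> of one real polynomial, kept
  together so that agreement of moments is transferred by induction.\<close>

inductive_set poly_pairs :: "'a::chilbert_space bop \<Rightarrow> 'a bop \<Rightarrow> ('a bop \<times> 'a bop) set" for s t where
  monomial: "(r *\<^sub>R s ^ i, r *\<^sub>R t ^ i) \<in> poly_pairs s t"
| add: "(a, b) \<in> poly_pairs s t \<Longrightarrow> (a', b') \<in> poly_pairs s t \<Longrightarrow> (a + a', b + b') \<in> poly_pairs s t"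

lemma poly_pairs_mult_monomial:
  assumes "(a, b) \<in> poly_pairs s t"
  shows "(r *\<^sub>R s ^ i * a, r *\<^sub>R t ^ i * b) \<in> poly_pairs s t"
  using assms
proof induction
  case (monomial r' j)
  show ?case using poly_pairs.monomial[of "r * r'" s "i + j" t] by (simp add: power_add mult.commute)
qed (simp add: distrib_left poly_pairs.add)

lemma poly_pairs_mult:
  assumes "(a, b) \<in> poly_pairs s t" "(a', b') \<in> poly_pairs s t"
  shows "(a * a', b * b') \<in> poly_pairs s t"
  using assms(1)
proof induction
  case (monomial r i)
  show ?case by (rule poly_pairs_mult_monomial[OF assms(2)])
qed (simp add: distrib_right poly_pairs.add)

lemma sqrt_iter_poly_pairs: "(sqrt_iter s n, sqrt_iter t n) \<in> poly_pairs s t"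
proof (induction n)
  case 0
  show ?case using poly_pairs.monomial[of 0 s 0 t] by simp
next
  case (Suc n)
  have "((1/2) *\<^sub>R s ^ 1, (1/2) *\<^sub>R t ^ 1) \<in> poly_pairs s t" by (rule poly_pairs.monomial)
  moreover have "((-1/2) *\<^sub>R s ^ 0 * (sqrt_iter s n * sqrt_iter s n), (-1/2) *\<^sub>R t ^ 0 * (sqrt_iter t n * sqrt_iter t n))
      \<in> poly_pairs s t"
    by (intro poly_pairs_mult_monomial poly_pairs_mult Suc)
  ultimately have "(sqrt_iter s n + ((1/2) *\<^sub>R s ^ 1 + (-1/2) *\<^sub>R s ^ 0 * (sqrt_iter s n * sqrt_iter s n)),
    sqrt_iter t n + ((1/2) *\<^sub>R t ^ 1 + (-1/2) *\<^sub>R t ^ 0 * (sqrt_iter t n * sqrt_iter t n))) \<in> poly_pairs s t"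
    by (intro poly_pairs.add Suc)
  then show ?case by (simp add: scaleR_diff_right)
qed

text \<open>With \<open>r\<close> the iterate, the error \<open>e = k - r\<close> is multiplied in
  each step by 1 - (k + r)/2. This factor is positive, and as \<open>r\<close> is positive it is at
  most 1 - k/2, whence the geometric bound.\<close>

lemma sqrt_iter_bounds:
  assumes k: "positive_op k" "positive_op (1 - k)"
  shows "sqrt_iter (k * k) n \<in> commutant (commutant {k}) \<and> positive_op (sqrt_iter (k * k) n) \<and>
    positive_op (k - sqrt_iter (k * k) n) \<and>
    positive_op (k * (1 - (1/2) *\<^sub>R k) ^ n - (k - sqrt_iter (k * k) n))"
proof (induction n)
  case 0
  then show ?case using k by (simp add: commutant_algebra)
next
  case (Suc n)
  let ?B = "commutant (commutant {k})"
  define r where "r = sqrt_iter (k * k) n"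
  define e where "e = k - r"
  define g where "g = k * (1 - (1/2) *\<^sub>R k) ^ n"
  have rB: "r \<in> ?B" and r: "positive_op r" and e: "positive_op e" and ge: "positive_op (g - e)"
    using Suc.IH by (simp_all add: r_def e_def g_def)
  have kB: "k \<in> ?B" by (rule bicommutant_self)
  have eB: "e \<in> ?B" and gB: "g \<in> ?B"
    using kB rB by (auto simp: e_def g_def intro!: commutant_algebra commutant_power)
  have kr: "k * r = r * k" using bicommutant_commute kB rB by blast
  have half: "(1/2) *\<^sub>R a + (1/2) *\<^sub>R a = a" for a :: "'a bop"
    by (simp add: scaleR_add_left[symmetric])
  have step: "sqrt_iter (k * k) (Suc n) = r + (1/2) *\<^sub>R (e * (k + r))"
    by (simp add: r_def[symmetric] e_def distrib_left left_diff_distrib kr)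
  have e': "k - sqrt_iter (k * k) (Suc n) = e * ((1 - k) + (1/2) *\<^sub>R e)"
    unfolding step
    by (simp add: e_def kr algebra_simps half)
  have g': "k * (1 - (1/2) *\<^sub>R k) ^ Suc n - (k - sqrt_iter (k * k) (Suc n)) =
    (g - e) * ((1/2) *\<^sub>R 1 + (1/2) *\<^sub>R (1 - k)) + (1/2) *\<^sub>R (e * r)"
  proof -
    have "(1/2) *\<^sub>R 1 + (1/2) *\<^sub>R (1 - k) = 1 - (1/2) *\<^sub>R k"
      by (simp add: scaleR_diff_right scaleR_add_left[symmetric])
    moreover have "k * (1 - (1/2) *\<^sub>R k) ^ Suc n = g * (1 - (1/2) *\<^sub>R k)"
      by (simp only: g_def power_Suc2 mult.assoc)
    moreover have "e * ((1 - k) + (1/2) *\<^sub>R e) = e * (1 - (1/2) *\<^sub>R k) - (1/2) *\<^sub>R (e * r)"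
    proof -
      have eq: "(1 - k) + (1/2) *\<^sub>R e = (1 - (1/2) *\<^sub>R k) - (1/2) *\<^sub>R r"
      proof -
        have "k = (1/2) *\<^sub>R k + (1/2) *\<^sub>R k" by (simp add: scaleR_add_left[symmetric])
        then show ?thesis by (simp add: e_def scaleR_diff_right algebra_simps)
      qed
      show ?thesis unfolding eq by (simp add: right_diff_distrib)
    qed
    ultimately show ?thesis unfolding e' by (simp add: left_diff_distrib)
  qed
  have cB: "(1 - k) + (1/2) *\<^sub>R e \<in> ?B" "(1/2) *\<^sub>R 1 + (1/2) *\<^sub>R (1 - k) \<in> ?B" "g - e \<in> ?B" "k + r \<in> ?B"
    using kB eB gB rB by (auto intro!: commutant_algebra)
  have "sqrt_iter (k * k) (Suc n) \<in> ?B"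
    unfolding step by (intro commutant_algebra rB eB cB)
  moreover have "positive_op (sqrt_iter (k * k) (Suc n))"
    unfolding step using r e k kB eB rB cB
    by (intro positive_op_add positive_op_scaleR positive_op_mult_commuting bicommutant_commute[of _ k]) auto
  moreover have "positive_op (k - sqrt_iter (k * k) (Suc n))"
    unfolding e' using e k kB eB cB
    by (intro positive_op_add positive_op_scaleR positive_op_mult_commuting bicommutant_commute[of _ k]) auto
  moreover have "positive_op (k * (1 - (1/2) *\<^sub>R k) ^ Suc n - (k - sqrt_iter (k * k) (Suc n)))"
    unfolding g' using e r k ge kB eB rB cB
    by (intro positive_op_add positive_op_scaleR positive_op_mult_commuting bicommutant_commute[of _ k]) auto
  ultimately show ?case by blast
qed

lemma ker_op_scaleR: "r \<noteq> 0 \<Longrightarrow> ker_op (r *\<^sub>R a) = ker_op a"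
  by (simp add: ker_op_def)

context wstar_space
begin

lemma sqrt_iter_in_M: "s \<in> M \<Longrightarrow> sqrt_iter s n \<in> M"
  by (induction n) auto

text \<open>As \<open>(k * k) ^ m\<close> is at most 1, the weighted error lies between 0 and the
  bound \<open>k * (1 - (1/2) *\<^sub>R k) ^ n\<close>. The latter tends in the 2-norm to
  \<open>k\<close> times its kernel projection, which is 0.\<close>

lemma odd_moment_limit:
  assumes k: "k \<in> M" "positive_op k" "positive_op (1 - k)"
  shows "(\<lambda>n. \<tau> ((k * k) ^ m * sqrt_iter (k * k) n)) \<longlonglongrightarrow> \<tau> ((k * k) ^ m * k)"
proof -
  let ?r = "sqrt_iter (k * k)"
  define s where "s = (k * k) ^ m"
  define g where "g n = k * (1 - (1/2) *\<^sub>R k) ^ n" for n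
  have rM: "?r n \<in> M" and gM: "g n \<in> M" and sM: "s \<in> M" for n
    using k by (simp_all add: sqrt_iter_in_M g_def s_def)
  have sB: "s \<in> commutant (commutant {k})"
    by (simp add: s_def commutant_power commutant_algebra bicommutant_self)
  have kpos: "positive_op (1 - k ^ j)" for j
  proof (induction j)
    case (Suc j)
    have "1 - k ^ Suc j = (1 - k ^ j) + k ^ j * (1 - k)" by (simp add: right_diff_distrib power_commutes)
    moreover have "positive_op (k ^ j * (1 - k))"
      using k by (intro positive_op_mult_commuting positive_op_power)
        (simp_all add: left_diff_distrib right_diff_distrib power_commutes)
    ultimately show ?case using positive_op_add[OF Suc, of "k ^ j * (1 - k)"] by (simp only:)
  qed simp
  have sk: "s = k ^ (2 * m)" by (simp add: s_def power_mult power2_eq_square)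
  have kB: "k \<in> commutant (commutant {k})" by (rule bicommutant_self)
  have b: "0 \<le> Re (\<tau> (s * (k - ?r n))) \<and> Re (\<tau> (s * (k - ?r n))) \<le> Re (\<tau> (g n)) \<and> Im (\<tau> (s * (k - ?r n))) = 0" for n
  proof -
    note B = sqrt_iter_bounds[OF k(2,3), of n]
    have eB: "k - ?r n \<in> commutant (commutant {k})" using B kB by (intro commutant_algebra) auto
    have "positive_op (s * (k - ?r n))"
      using B eB sB k unfolding sk
      by (intro positive_op_mult_commuting positive_op_power bicommutant_commute[of _ k]) (auto simp: sk)
    moreover have "positive_op ((1 - s) * (k - ?r n))"
      using B eB kpos commutant_algebra(4)[OF commutant_algebra(1) sB]
      by (intro positive_op_mult_commuting bicommutant_commute[of _ k]) (auto simp: sk)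
    then have "positive_op (g n - s * (k - ?r n))"
      using positive_op_add[of "(1 - s) * (k - ?r n)" "g n - (k - ?r n)"] B
      by (simp add: g_def left_diff_distrib)
    ultimately show ?thesis
      using tau_positive[of "s * (k - ?r n)"] tau_mono[of "s * (k - ?r n)" "g n"] k rM gM sM by simp
  qed
  have "positive_op ((1/2) *\<^sub>R k)" "positive_op (1 - (1/2) *\<^sub>R k)"
  proof -
    show "positive_op ((1/2) *\<^sub>R k)" using k by (intro positive_op_scaleR) auto
    have "positive_op ((1 - k) + (1/2) *\<^sub>R k)" using k by (intro positive_op_add positive_op_scaleR) auto
    moreover have "(1 - k) + (1/2) *\<^sub>R k = 1 - (1/2) *\<^sub>R k"
    proof -
      have "k = (1/2) *\<^sub>R k + (1/2) *\<^sub>R k" by (simp add: scaleR_add_left[symmetric])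
      then show ?thesis by (simp add: algebra_simps)
    qed
    ultimately show "positive_op (1 - (1/2) *\<^sub>R k)" by simp
  qed
  note half = this
  have "conv2 (\<lambda>n. k * (1 - (1/2) *\<^sub>R k) ^ n) (k * Proj (ker_op ((1/2) *\<^sub>R k)))"
    using k half by (intro conv2_mult conv2_const power_conv2_Proj_ker) auto
  moreover have "k * Proj (ker_op ((1/2) *\<^sub>R k)) = 0"
    using Proj_ker_mult(1)[OF k(2)] by (simp add: ker_op_scaleR)
  ultimately have "(\<lambda>n. \<tau> (g n)) \<longlonglongrightarrow> 0"
    using conv2_tau[of g 0] by (simp add: g_def[abs_def])
  then have g0: "(\<lambda>n. Re (\<tau> (g n))) \<longlonglongrightarrow> 0" using tendsto_Re by fastforce
  have "(\<lambda>n. Re (\<tau> (s * (k - ?r n)))) \<longlonglongrightarrow> 0"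
    by (rule real_tendsto_sandwich[OF _ _ tendsto_const g0]) (simp_all add: b)
  then have "(\<lambda>n. \<tau> (s * (k - ?r n))) \<longlonglongrightarrow> 0"
    by (simp add: tendsto_complex_iff b)
  then have "(\<lambda>n. \<tau> (s * k) - \<tau> (s * (k - ?r n))) \<longlonglongrightarrow> \<tau> (s * k) - 0"
    by (intro tendsto_intros)
  moreover have "\<tau> (s * k) - \<tau> (s * (k - ?r n)) = \<tau> (s * ?r n)" for n
    using k rM sM by (simp add: right_diff_distrib tau_simps)
  ultimately show ?thesis by (simp add: s_def)
qed

lemma moments_determined_by_even:
  assumes k: "k \<in> M" "positive_op k" and h: "h \<in> M" "positive_op h"
    and even: "\<And>m. \<tau> ((k * k) ^ m) = \<tau> ((h * h) ^ m)"
  shows "\<tau> (k ^ n) = \<tau> (h ^ n)"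
proof -
  \<comment> \<open>One common scale brings both operators below 1, so that their moments change by
    the same factors.\<close>
  define R where "R = norm k + norm h + 1"
  have R: "R > 0" "norm k \<le> R" "norm h \<le> R"
    by (simp_all add: R_def add_nonneg_pos)
  define k' where "k' = inverse R *\<^sub>R k"
  define h' where "h' = inverse R *\<^sub>R h"
  have k': "k' \<in> M" "positive_op k'" "positive_op (1 - k')" and h': "h' \<in> M" "positive_op h'" "positive_op (1 - h')"
    using k h R by (auto simp: k'_def h'_def intro!: positive_op_scaleR positive_op_one_minus_scaled)
  have pw: "(a *\<^sub>R b) ^ j = a ^ j *\<^sub>R b ^ j" for a :: real and b :: "'a bop" and j
    by (induction j) simp_all
  have ev: "\<tau> ((k' * k') ^ m) = \<tau> ((h' * h') ^ m)" for m
    using even[of m] k h by (simp add: k'_def h'_def pw tau_scaleR)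
  have poly: "\<tau> ((k' * k') ^ m * a) = \<tau> ((h' * h') ^ m * b) \<and> a \<in> M \<and> b \<in> M"
    if "(a, b) \<in> poly_pairs (k' * k') (h' * h')" for a b m
    using that
  proof (induction)
    case (monomial r i)
    then show ?case using k' h' ev[of "m + i"] by (simp add: tau_scaleR power_add)
  next
    case (add a b a' b')
    then show ?case using k' h' by (simp add: distrib_left tau_add)
  qed
  have odd: "\<tau> ((k' * k') ^ m * k') = \<tau> ((h' * h') ^ m * h')" for m
    using LIMSEQ_unique[OF odd_moment_limit[OF k', of m]] odd_moment_limit[OF h', of m]
      poly[OF sqrt_iter_poly_pairs] by simp
  have "\<tau> (k' ^ n) = \<tau> (h' ^ n)"
  proof (cases "even n")
    case True
    then show ?thesis using ev[of "n div 2"] by (auto simp: power_mult power2_eq_square elim!: evenE)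
  next
    case False
    then obtain b where n: "n = 2 * b + 1" by (rule oddE)
    have "a ^ n = (a * a) ^ b * a" for a :: "'a bop"
      by (simp add: n power_Suc2 power_mult power2_eq_square del: power_Suc)
    then show ?thesis using odd[of b] by simp
  qed
  then show ?thesis using k h R by (simp add: k'_def h'_def pw tau_scaleR)
qed

end

subsection \<open>The polar decomposition of an R-diagonal element\<close>

text \<open>The component of \<xi> orthogonal to the kernel of \<open>v\<close> lies in the initial
  space, hence is orthogonal to the kernel of \<open>x\<close> and thus to \<xi> itself; so it
  vanishes.\<close>

lemma polar_kernel:
  assumes "polar_decomposition x v h" "\<xi> \<in> ker_op x"
  shows "\<xi> \<in> ker_op v"
proof -
  obtain y where y: "y \<in> ker_op v" and ort: "\<And>z. z \<in> ker_op v \<Longrightarrow> inner (\<xi> - y) z = 0"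
    using projection_theorem[OF ker_op_subspace(1,2)[of v], of \<xi>] by blast
  have "\<xi> - y \<in> ocompl (ker_op v)"
    unfolding ocompl_def using inner_ortho_imp_cinner[of "ker_op v" "\<xi> - y"] ker_op_subspace(3) ort by blast
  then have "\<xi> - y \<in> ocompl (ker_op x)"
    using assms(1) by (simp add: polar_decomposition_def initial_space_def)
  then have "inner \<xi> (\<xi> - y) = 0" using assms(2) by (simp add: ocompl_def inner_cinner)
  then have "inner (\<xi> - y) (\<xi> - y) = 0" using ort[OF y] by (simp add: inner_diff_left inner_commute)
  then show ?thesis using y by simp
qed

text \<open>Since \<open>(v - u) h = 0\<close>, also \<open>(v - u) (1 - h/r)\<^sup>n = v - u\<close>, and \<open>(1 - h/r)\<^sup>n\<close> tends to the
  projection onto \<open>ker h\<close>.\<close>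

lemma polar_identification:
  assumes u: "unitary u" and h0: "positive_op h0" and x: "x = u * h0"
    and pol: "polar_decomposition x v h"
  shows "h = h0" "v = u * (1 - Proj (ker_op x))" "ker_op x = ker_op h"
proof -
  have h: "positive_op h" and ker: "ker_op h = ker_op x" and xvh: "x = v * h"
    using pol by (auto simp: polar_decomposition_def)
  show "ker_op x = ker_op h" using ker by simp
  have sh: "adj h = h" and sh0: "adj h0 = h0" using h h0 by (auto simp: positive_op_self_adj)
  \<comment> \<open>The range of the self-adjoint \<open>h\<close> is orthogonal to its kernel, so
    it lies in the initial space, where \<open>v\<close> is isometric. Equality of norms yields
    \<open>adj x * x = h * h\<close>.\<close>
  have nrm: "norm (ap x \<xi>) = norm (ap h \<xi>)" for \<xi>
  proof -
    have "ap h \<xi> \<in> initial_space v"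
      using adj_image_ortho_ker[of h \<xi>] pol sh ker by (simp add: polar_decomposition_def)
    then show ?thesis using pol xvh by (simp add: polar_decomposition_def partial_isometry_def)
  qed
  have "adj x * x = h * h"
  proof (rule self_adj_form_eqI)
    fix \<xi>
    have "inner \<xi> (ap (adj x * x) \<xi>) = (norm (ap x \<xi>))\<^sup>2"
      by (simp add: adj_inner_right power2_norm_eq_inner del: dot_square_norm)
    also have "\<dots> = inner \<xi> (ap (adj h * h) \<xi>)"
      unfolding nrm by (simp add: adj_inner_right power2_norm_eq_inner del: dot_square_norm)
    finally show "inner \<xi> (ap (adj x * x) \<xi>) = inner \<xi> (ap (h * h) \<xi>)" by (simp add: sh)
  qed (simp_all add: sh)
  moreover have "adj x * x = h0 * (adj u * u) * h0" by (simp add: x sh0 mult.assoc)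
  ultimately have "h * h = h0 * h0" using u by (simp add: unitary_def)
  then show "h = h0" using positive_sqrt_unique h h0 by blast
  then have vu: "(v - u) * h = 0" using xvh x by (simp add: left_diff_distrib)
  define r where "r = norm h + 1"
  have r: "r > 0" "norm h \<le> r" by (simp_all add: r_def add_nonneg_pos)
  define k where "k = inverse r *\<^sub>R h"
  have k: "positive_op k" "positive_op (1 - k)"
    using r h by (auto simp: k_def intro!: positive_op_scaleR positive_op_one_minus_scaled)
  have kk: "ker_op k = ker_op x" using r by (simp add: k_def ker_op_scaleR ker)
  have pw: "(v - u) * (1 - k) ^ n = v - u" for n
  proof (induction n)
    case (Suc n)
    have "(v - u) * (1 - k) = v - u" using vu by (simp add: k_def right_diff_distrib)
    then have "(v - u) * (1 - k) ^ Suc n = (v - u) * (1 - k) ^ n" by (simp add: mult.assoc[symmetric])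
    then show ?case by (simp add: Suc)
  qed simp
  show "v = u * (1 - Proj (ker_op x))"
  proof (rule bop_eqI)
    fix \<xi>
    let ?p = "ap (Proj (ker_op x)) \<xi>"
    have "ap (v - u) (ap ((1 - k) ^ n) \<xi>) = ap (v - u) \<xi>" for n
      by (metis ap_bop(6) pw)
    then have "ap (v - u) ?p = ap (v - u) \<xi>"
      using LIMSEQ_unique[OF continuous_ap[OF power_tendsto_Proj_ker[OF k, of \<xi>], of "v - u"]]
      by (simp only: kk tendsto_const)
    moreover have "?p \<in> ker_op v"
      using Proj_ker(3)[of x] by (intro polar_kernel[OF pol]) blast
    ultimately show "ap v \<xi> = ap (u * (1 - Proj (ker_op x))) \<xi>"
      by (simp add: ker_op_def algebra_simps)
  qed
qed

text \<open>Integer powers, with the adjoint as inverse. Their scalar multiples are closed under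
  products, and for a Haar unitary centring either leaves such a multiple unchanged or kills it; the
  comparison of joint moments relies on both.\<close>

definition upow :: "'a::chilbert_space bop \<Rightarrow> int \<Rightarrow> 'a bop" where
  "upow u k = (if 0 \<le> k then u ^ nat k else adj u ^ nat (- k))"

lemma upow_Suc: "unitary u \<Longrightarrow> upow u (k + 1) = u * upow u k"
proof (cases "0 \<le> k")
  case True
  then show ?thesis by (simp add: upow_def nat_add_distrib)
next
  case False
  assume u: "unitary u"
  define n where "n = nat (- k) - 1"
  have n: "nat (- k) = Suc n" "k + 1 = - int n" using False by (auto simp: n_def)
  have "upow u (k + 1) = adj u ^ n" unfolding n upow_def by auto
  also have "\<dots> = u * adj u * adj u ^ n" using u by (simp add: unitary_def)
  also have "\<dots> = u * upow u k" using False by (simp add: upow_def n mult.assoc)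
  finally show ?thesis .
qed

lemma upow_pred:
  assumes "unitary u"
  shows "upow u (k - 1) = adj u * upow u k"
proof -
  have "adj u * upow u k = (adj u * u) * upow u (k - 1)"
    using upow_Suc[OF assms, of "k - 1"] by (simp add: mult.assoc)
  then show ?thesis using assms by (simp add: unitary_def)
qed

lemma upow_add:
  assumes "unitary u"
  shows "upow u j * upow u k = upow u (j + k)"
proof (induction j rule: int_induct[where k = 0])
  case base
  show ?case by (simp add: upow_def)
next
  case (step1 i)
  then show ?case using upow_Suc[OF assms, of i] upow_Suc[OF assms, of "i + k"]
    by (simp add: mult.assoc add_ac)
next
  case (step2 i)
  then show ?case using upow_pred[OF assms, of i] upow_pred[OF assms, of "i + k"]
    by (simp add: mult.assoc algebra_simps)
qed

lemma upow_simps: "upow u 0 = 1" "upow u 1 = u" "upow u (-1) = adj u"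
  by (simp_all add: upow_def)

lemma upow_in: "star_subalgebra A \<Longrightarrow> u \<in> A \<Longrightarrow> upow u k \<in> A"
  by (simp add: upow_def star_subalgebraD)

lemma tau_upow: "haar_unitary \<tau> u \<Longrightarrow> k \<noteq> 0 \<Longrightarrow> \<tau> (upow u k) = 0"
  by (simp add: upow_def haar_unitary_def)

lemma tau_free_pair:
  "tau_free \<tau> [a, b] \<longleftrightarrow> free_wrt \<tau> {..<2} (\<lambda>i::nat. if i = 0 then generated_star_subalgebra {a}
    else generated_star_subalgebra {b})"
proof -
  have "{..<length [a, b]} = {..<2::nat}" by auto
  moreover have "free_wrt \<tau> {..<2} (\<lambda>i. generated_star_subalgebra {[a, b] ! i}) \<longleftrightarrow>
    free_wrt \<tau> {..<2} (\<lambda>i::nat. if i = 0 then generated_star_subalgebra {a} else generated_star_subalgebra {b})"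
    by (rule free_wrt_cong) (auto simp: less_2_cases_iff)
  ultimately show ?thesis unfolding tau_free_def by (simp only:)
qed

section \<open>A Haar unitary free from a positive operator, and the algebra
  \<open>B\<close>\<close>

locale r_diagonal_pair = wstar_space +
  fixes u h p1 p2 :: "'a bop"
  assumes uM: "u \<in> M" and hM: "h \<in> M" and haar: "haar_unitary \<tau> u" and h_pos: "positive_op h"
    and uh_free: "tau_free \<tau> [u, h]" and p1: "p1 = Proj (ker_op h)" and p2: "p2 = 1 - p1"
    and p1_nz: "p1 \<noteq> 0" and p2_nz: "p2 \<noteq> 0"
begin

definition h_bound where "h_bound = norm h + 1"
definition h_scaled where "h_scaled = inverse h_bound *\<^sub>R h"

lemma h_bound: "h_bound > 0" "norm h \<le> h_bound"
  by (simp_all add: h_bound_def add_nonneg_pos)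

lemma h_scaled: "positive_op h_scaled" "positive_op (1 - h_scaled)" "h_scaled \<in> M" "ker_op h_scaled = ker_op h"
  using h_bound h_pos hM
  by (auto simp: h_scaled_def ker_op_scaleR intro!: positive_op_scaleR positive_op_one_minus_scaled)

lemma p1M: "p1 \<in> M"
  using kernel_projection_in_M[OF h_scaled(3,1,2)] by (simp add: h_scaled p1)

lemma p2M: "p2 \<in> M"
  by (simp add: p2 p1M)

lemma p_simps [simp]:
  "p1 * p1 = p1" "p2 * p2 = p2" "p1 * p2 = 0" "p2 * p1 = 0" "adj p1 = p1" "adj p2 = p2"
  "h * p1 = 0" "p1 * h = 0" "h * p2 = h" "p2 * h = h" "adj h = h"
proof -
  show *: "p1 * p1 = p1" "adj p1 = p1" "h * p1 = 0" "p1 * h = 0" "adj h = h"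
    using Proj_ker(1,2)[of h] Proj_ker_mult[OF h_pos] h_pos
    by (simp_all add: p1 self_adj_def positive_op_self_adj)
  show "p2 * p2 = p2" "p1 * p2 = 0" "p2 * p1 = 0" "adj p2 = p2" "h * p2 = h" "p2 * h = h"
    by (simp_all add: p2 * left_diff_distrib right_diff_distrib)
qed

lemma p_assoc [simp]:
  "p1 * (p1 * a) = p1 * a" "p2 * (p2 * a) = p2 * a" "p1 * (p2 * a) = 0" "p2 * (p1 * a) = 0"
  by (simp_all flip: mult.assoc)

lemma tau_p_nz: "\<tau> p1 \<noteq> 0" "\<tau> p2 \<noteq> 0"
proof -
  have "p = 0" if "p \<in> M" "adj p * p = p" "\<tau> p = 0" for p
    using wstar that unfolding wstar_prob_space_def faithful_on_def by metis
  from this[of p1] this[of p2] show "\<tau> p1 \<noteq> 0" "\<tau> p2 \<noteq> 0"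
    using p1_nz p2_nz p1M p2M by auto
qed

abbreviation E where "E \<equiv> cond_exp \<tau> p1 p2"
abbreviation D where "D \<equiv> span2 p1 p2"
abbreviation C where "C \<equiv> generated_star_subalgebra {u}"

text \<open>A 2-norm closure of the algebra generated by \<open>h\<close>; unlike that algebra it contains \<open>p2\<close>.
  The condition on \<open>p1\<close> holds for all such limits; imposing it saves a limit argument.\<close>

definition B where
  "B = {b. (\<exists>c. p1 * b = c *\<^sub>C p1 \<and> b * p1 = c *\<^sub>C p1) \<and>
    (\<exists>X. (\<forall>n. X n \<in> generated_star_subalgebra {h}) \<and> conv2 X b)}"

lemma B_I:
  "p1 * b = c *\<^sub>C p1 \<Longrightarrow> b * p1 = c *\<^sub>C p1 \<Longrightarrow> (\<And>n. X n \<in> generated_star_subalgebra {h}) \<Longrightarrow>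
    conv2 X b \<Longrightarrow> b \<in> B"
  unfolding B_def by blast

lemma gen_M: "S \<subseteq> M \<Longrightarrow> generated_star_subalgebra S \<subseteq> M"
  by (rule generated_minimal[OF _ star_M])

lemma B_M: "B \<subseteq> M"
  by (auto simp: B_def conv2_def)

lemma star_B: "star_subalgebra B"
proof -
  note G = star_subalgebraD[OF star_subalgebra_generated[of "{h}"]]
  show ?thesis
    unfolding star_subalgebra_def
  proof (intro conjI ballI allI)
    show "1 \<in> B" by (rule B_I[OF _ _ G(1) conv2_const, of 1]) simp_all
  next
    fix a b assume "a \<in> B" "b \<in> B"
    then obtain c d X Y where a: "p1 * a = c *\<^sub>C p1" "a * p1 = c *\<^sub>C p1"
      "\<And>n. X n \<in> generated_star_subalgebra {h}" "conv2 X a"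
      and b: "p1 * b = d *\<^sub>C p1" "b * p1 = d *\<^sub>C p1"
      "\<And>n. Y n \<in> generated_star_subalgebra {h}" "conv2 Y b"
      unfolding B_def by blast
    show "a + b \<in> B"
      by (rule B_I[OF _ _ G(3)[OF a(3) b(3)] conv2_add[OF a(4) b(4)], of "c + d"])
        (simp_all add: distrib_left distrib_right a b scaleC_bop_add)
    show "a * b \<in> B"
    proof (rule B_I[OF _ _ G(4)[OF a(3) b(3)] conv2_mult[OF a(4) b(4)], of "c * d"])
      have "p1 * (a * b) = (p1 * a) * b" by (simp only: mult.assoc)
      then show "p1 * (a * b) = (c * d) *\<^sub>C p1" by (simp add: a b)
      show "(a * b) * p1 = (c * d) *\<^sub>C p1" by (simp add: a b mult.assoc mult.commute)
    qed
  next
    fix a z assume "a \<in> B"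
    then obtain c X where a: "p1 * a = c *\<^sub>C p1" "a * p1 = c *\<^sub>C p1"
      "\<And>n. X n \<in> generated_star_subalgebra {h}" "conv2 X a"
      unfolding B_def by blast
    show "z *\<^sub>C a \<in> B"
      by (rule B_I[where c = "z * c" and X = "\<lambda>n. z *\<^sub>C X n"]) (simp_all add: a G(5) conv2_scaleC)
  next
    fix a assume "a \<in> B"
    then obtain c X where a: "p1 * a = c *\<^sub>C p1" "a * p1 = c *\<^sub>C p1"
      "\<And>n. X n \<in> generated_star_subalgebra {h}" "conv2 X a"
      unfolding B_def by blast
    show "adj a \<in> B"
      by (rule B_I[OF _ _ G(6)[OF a(3)] conv2_adj[OF a(4)], of "cnj c"])
        (use arg_cong[OF a(1), of adj] arg_cong[OF a(2), of adj] in simp_all)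
  qed
qed

lemmas B_simps [simp] = star_subalgebraD[OF star_B]

lemma h_in_B [simp]: "h \<in> B"
proof -
  have "h \<in> generated_star_subalgebra {h}" using generated_superset by blast
  from B_I[OF _ _ this conv2_const[OF hM], of 0] show ?thesis by simp
qed

lemma p_in_B [simp]: "p1 \<in> B" "p2 \<in> B"
proof -
  note G = star_subalgebraD[OF star_subalgebra_generated[of "{h}"]]
  have "h \<in> generated_star_subalgebra {h}" using generated_superset by blast
  then have X: "(1 - h_scaled) ^ n \<in> generated_star_subalgebra {h}" for n
    unfolding h_scaled_def by (intro G)
  have "conv2 (\<lambda>n. (1 - h_scaled) ^ n) p1"
    using power_conv2_Proj_ker[OF h_scaled(3,1,2)] by (simp add: p1 h_scaled(4))
  from B_I[OF _ _ X this, of 1] show "p1 \<in> B" by simp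
  then show "p2 \<in> B" by (simp add: p2)
qed

lemma C_M: "C \<subseteq> M"
  by (rule gen_M) (simp add: uM)

lemma star_C: "star_subalgebra C"
  by (rule star_subalgebra_generated)

lemma free_C_B: "free_wrt \<tau> {..<2} (\<lambda>i::nat. if i = 0 then C else B)"
  using uh_free unfolding tau_free_pair
  by (rule free_wrt_conv2_closure[OF C_M star_subalgebra_generated gen_M, rotated]) (auto simp: hM B_def)

lemma tau_words_C_B: "x \<in> words (centred C) (centred B) B B \<Longrightarrow> x \<in> M \<and> \<tau> x = 0"
  by (rule tau_words[OF C_M star_B B_M free_C_B])

lemma u_unitary: "unitary u" and u_in: "u \<in> C" "adj u \<in> C" and u_centred: "u \<in> centred C" "adj u \<in> centred C"
proof -
  show "unitary u" using haar by (simp add: haar_unitary_def)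
  show u: "u \<in> C" using generated_superset by blast
  then show v: "adj u \<in> C" by (rule star_subalgebraD(6)[OF star_C])
  have "\<forall>n>0. \<tau> (u ^ n) = 0 \<and> \<tau> (adj u ^ n) = 0" using haar by (simp add: haar_unitary_def)
  from this[rule_format, of 1] have "\<tau> u = 0 \<and> \<tau> (adj u) = 0" by simp
  then show "u \<in> centred C" "adj u \<in> centred C" using u v by (simp_all add: centred_def)
qed

section \<open>The coefficient algebra and freeness over it\<close>

lemma span2_D: "d \<in> D \<longleftrightarrow> (\<exists>a b. d = a *\<^sub>C p1 + b *\<^sub>C p2)"
  by (auto simp: span2_def)

lemma star_D: "star_subalgebra D"
  unfolding star_subalgebra_def
proof (intro conjI ballI allI)
  show "1 \<in> D" unfolding span2_D by (intro exI[of _ 1]) (simp add: p2)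
next
  fix d e assume "d \<in> D" "e \<in> D"
  then obtain a b a' b' where d: "d = a *\<^sub>C p1 + b *\<^sub>C p2" "e = a' *\<^sub>C p1 + b' *\<^sub>C p2"
    by (auto simp: span2_D)
  have "d + e = (a + a') *\<^sub>C p1 + (b + b') *\<^sub>C p2" by (simp add: d scaleC_bop_add)
  then show "d + e \<in> D" unfolding span2_D by blast
  have "d * e = (a * a') *\<^sub>C p1 + (b * b') *\<^sub>C p2" by (simp add: d distrib_left distrib_right mult.commute)
  then show "d * e \<in> D" unfolding span2_D by blast
next
  fix d c assume "d \<in> D"
  then obtain a b where d: "d = a *\<^sub>C p1 + b *\<^sub>C p2" by (auto simp: span2_D)
  have "c *\<^sub>C d = (c * a) *\<^sub>C p1 + (c * b) *\<^sub>C p2" by (simp add: d scaleC_bop_add)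
  then show "c *\<^sub>C d \<in> D" unfolding span2_D by blast
next
  fix d assume "d \<in> D"
  then obtain a b where d: "d = a *\<^sub>C p1 + b *\<^sub>C p2" by (auto simp: span2_D)
  have "adj d = cnj a *\<^sub>C p1 + cnj b *\<^sub>C p2" by (simp add: d)
  then show "adj d \<in> D" unfolding span2_D by blast
qed

lemma p_in_D: "p1 \<in> D" "p2 \<in> D"
proof -
  have "p1 = 1 *\<^sub>C p1 + 0 *\<^sub>C p2" "p2 = 0 *\<^sub>C p1 + 1 *\<^sub>C p2" by simp_all
  then show "p1 \<in> D" "p2 \<in> D" unfolding span2_D by blast+
qed

lemma D_minimal: "star_subalgebra A \<Longrightarrow> p2 \<in> A \<Longrightarrow> D \<subseteq> A"
proof
  fix d assume A: "star_subalgebra A" "p2 \<in> A" "d \<in> D"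
  note As = star_subalgebraD[OF A(1)]
  have "p1 = 1 - p2" by (simp add: p2)
  then have "p1 \<in> A" using As A(2) by simp
  moreover obtain a b where "d = a *\<^sub>C p1 + b *\<^sub>C p2" using A(3) by (auto simp: span2_D)
  ultimately show "d \<in> A" using As A(2) by simp
qed

lemma D_B: "D \<subseteq> B" and D_M: "D \<subseteq> M"
  by (rule D_minimal; simp add: star_B star_M p2M)+

lemma E_eqI: "\<tau> (p1 * a * p1) = \<tau> (p1 * b * p1) \<Longrightarrow> \<tau> (p2 * a * p2) = \<tau> (p2 * b * p2) \<Longrightarrow> E a = E b"
  by (simp add: cond_exp_def)

lemma E_eqD:
  assumes "E a = E b"
  shows "\<tau> (p1 * a * p1) = \<tau> (p1 * b * p1)" "\<tau> (p2 * a * p2) = \<tau> (p2 * b * p2)"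
proof -
  have *: "s = t" if "s *\<^sub>C p = t *\<^sub>C p" "p \<in> M" "\<tau> p \<noteq> 0" for s t p
    using arg_cong[OF that(1), of \<tau>] that(2,3) by (simp add: tau_scaleC)
  have "p1 * E a = p1 * E b" "p2 * E a = p2 * E b" using assms by simp_all
  then have "(\<tau> (p1 * a * p1) / \<tau> p1) *\<^sub>C p1 = (\<tau> (p1 * b * p1) / \<tau> p1) *\<^sub>C p1"
    "(\<tau> (p2 * a * p2) / \<tau> p2) *\<^sub>C p2 = (\<tau> (p2 * b * p2) / \<tau> p2) *\<^sub>C p2"
    by (simp_all add: cond_exp_def distrib_left)
  then have "\<tau> (p1 * a * p1) / \<tau> p1 = \<tau> (p1 * b * p1) / \<tau> p1"
    "\<tau> (p2 * a * p2) / \<tau> p2 = \<tau> (p2 * b * p2) / \<tau> p2"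
    using * p1M p2M tau_p_nz by blast+
  then show "\<tau> (p1 * a * p1) = \<tau> (p1 * b * p1)" "\<tau> (p2 * a * p2) = \<tau> (p2 * b * p2)"
    using tau_p_nz by simp_all
qed

lemma E_zero_iff: "E a = 0 \<longleftrightarrow> \<tau> (p1 * a * p1) = 0 \<and> \<tau> (p2 * a * p2) = 0"
proof
  have 0: "E 0 = 0" by (simp add: cond_exp_def)
  show "\<tau> (p1 * a * p1) = 0 \<and> \<tau> (p2 * a * p2) = 0" if "E a = 0"
    using E_eqD[of a 0] that by (simp add: 0)
  show "E a = 0" if "\<tau> (p1 * a * p1) = 0 \<and> \<tau> (p2 * a * p2) = 0"
    using that by (simp add: cond_exp_def)
qed

text \<open>Compression by \<open>p1\<close> or \<open>p2\<close> only changes outer coefficients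
  inside \<open>B\<close>, so the compressed element is again a sum of words of trace zero.\<close>

lemma E_words:
  assumes "x \<in> words (centred C) (centred B) B B"
  shows "x \<in> M" "\<tau> (p1 * x * p1) = 0" "\<tau> (p2 * x * p2) = 0"
proof -
  have "p * x * p \<in> words (centred C) (centred B) B B" if "p \<in> B" for p
    using that assms by (intro words_mult_left[where P = B] words_mult_right[where Q = B]) auto
  then show "x \<in> M" "\<tau> (p1 * x * p1) = 0" "\<tau> (p2 * x * p2) = 0"
    using tau_words_C_B assms by auto
qed

text \<open>On \<open>B\<close> the projection \<open>p1\<close> acts by a scalar, and the
  \<open>p1\<close> component of \<open>E\<close> is that scalar. Once it vanishes, only the corner
  of \<open>p2\<close> is left, where \<open>E\<close> detects the trace.\<close>

lemma kernel_B:
  assumes "b \<in> B" "E b = 0"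
  shows "p1 * b = 0" "b * p1 = 0" "p2 * b = b" "b * p2 = b" "\<tau> b = 0"
proof -
  obtain c where c: "p1 * b = c *\<^sub>C p1" "b * p1 = c *\<^sub>C p1" using assms(1) by (auto simp: B_def)
  then have "c * \<tau> p1 = 0" using assms(2) p1M by (simp add: E_zero_iff tau_scaleC)
  then have "c = 0" using tau_p_nz by simp
  then show p: "p1 * b = 0" "b * p1 = 0" using c by simp_all
  then show q: "p2 * b = b" "b * p2 = b" by (simp_all add: p2 left_diff_distrib right_diff_distrib)
  show "\<tau> b = 0" using assms(2) q by (simp add: E_zero_iff)
qed

text \<open>In the decomposition of \<open>y\<close> the words have no component in
  \<open>D\<close>, so \<open>E y\<close> is the coefficient \<open>d\<close>, which therefore is
  zero.\<close>

lemma kernel_generated: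
  assumes y: "y \<in> generated_star_subalgebra {u, p2}" and 0: "E y = 0"
  shows "y \<in> words (centred C) (centred B) D D"
proof -
  obtain d x where d: "d \<in> D" and x: "x \<in> words (centred C) (centred D) D D" and yx: "y = d + x"
    using generated_decomposition[OF star_C C_M star_D D_M _ y] u_in p_in_D by blast
  have "centred D \<subseteq> centred B" using D_B by (auto simp: centred_def)
  then have x': "x \<in> words (centred C) (centred B) D D" "x \<in> words (centred C) (centred B) B B"
    using words_mono[OF x] D_B by blast+
  obtain a b where ab: "d = a *\<^sub>C p1 + b *\<^sub>C p2" using d by (auto simp: span2_D)
  have "p1 * y * p1 = a *\<^sub>C p1 + p1 * x * p1" "p2 * y * p2 = b *\<^sub>C p2 + p2 * x * p2"
    by (simp_all add: yx ab distrib_left distrib_right)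
  then have "a * \<tau> p1 = 0" "b * \<tau> p2 = 0"
    using 0 E_words[OF x'(2)] p1M p2M by (simp_all add: E_zero_iff tau_simps)
  then have "d = 0" using tau_p_nz by (simp add: ab)
  then show ?thesis using x' by (simp add: yx)
qed

lemma polar_parts_amalgamated_free: "amalgamated_free M D E [u * p2, h]"
proof -
  \<comment> \<open>The algebra generated by \<open>u\<close> and \<open>p2\<close> contains
    \<open>v = u * p2\<close> and all of \<open>D\<close>, and \<open>kernel_generated\<close>
    applies to it.\<close>
  define A where "A i = (if i = 0 then generated_star_subalgebra {u, p2} else B)" for i :: nat
  have up: "u \<in> generated_star_subalgebra {u, p2}" "p2 \<in> generated_star_subalgebra {u, p2}"
    using generated_superset by blast+
  have "free_wrt E {..<length [u * p2, h]} A"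
    unfolding free_wrt_def
  proof (intro allI impI, elim conjE)
    fix w :: "(nat \<times> 'a bop) list"
    assume w: "w \<noteq> []" "distinct_adj (map fst w)"
      and W: "\<forall>(i, a)\<in>set w. i \<in> {..<length [u * p2, h]} \<and> a \<in> A i \<and> E a = 0"
    have "prod_list (map snd w) \<in> {b \<in> B. E b = 0} \<union> words (centred C) (centred B) B B"
    proof (rule alternating_product_words[OF w, where D = D
          and KA = "{y \<in> generated_star_subalgebra {u, p2}. E y = 0}"])
      show "i = 0 \<and> a \<in> {y \<in> generated_star_subalgebra {u, p2}. E y = 0} \<or> i = 1 \<and> a \<in> {b \<in> B. E b = 0}"
        if "(i, a) \<in> set w" for i a
        using W that by (auto simp: A_def split: if_splits)
      show "{y \<in> generated_star_subalgebra {u, p2}. E y = 0} \<subseteq> words (centred C) (centred B) D D"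
        using kernel_generated by blast
      show "d * b * d' \<in> centred B" if "d \<in> D" "b \<in> {b \<in> B. E b = 0}" "d' \<in> D" for d b d'
      proof -
        note b = kernel_B[of b]
        obtain s t s' t' where d: "d = s *\<^sub>C p1 + t *\<^sub>C p2" "d' = s' *\<^sub>C p1 + t' *\<^sub>C p2"
          using \<open>d \<in> D\<close> \<open>d' \<in> D\<close> by (auto simp: span2_D)
        have "d * b * d' = (t * t') *\<^sub>C b"
          using that b by (simp add: d distrib_left distrib_right mult.commute)
        then show ?thesis using that b B_M by (auto simp: centred_def tau_scaleC)
      qed
    qed (use D_B in auto)
    then show "E (prod_list (map snd w)) = 0"
      using E_words by (auto simp: E_zero_iff)
  qed
  moreover have "\<forall>i<length [u * p2, h]. star_subalgebra (A i) \<and> D \<subseteq> A i \<and> A i \<subseteq> M \<and> [u * p2, h] ! i \<in> A i"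
    using star_subalgebra_generated[of "{u, p2}"] star_B D_B B_M up D_minimal[OF star_subalgebra_generated up(2)]
      gen_M[of "{u, p2}"] uM p2M star_subalgebraD(4)[OF star_subalgebra_generated up]
    by (auto simp: A_def less_Suc_eq)
  ultimately show ?thesis unfolding amalgamated_free_def by blast
qed

text \<open>This also supplies the existence of a Haar unitary in \<open>M\<close> that is free from
  \<open>p2\<close>.\<close>

lemma u_free_p2: "tau_free \<tau> [u, p2]"
proof -
  have "generated_star_subalgebra {p2} \<subseteq> B" by (rule generated_minimal) (simp_all add: star_B)
  then show ?thesis
    unfolding tau_free_pair by (intro free_wrt_mono[OF free_C_B]) auto
qed

lemma Proj_final_space: "Proj (final_space (u * p2)) = u * p2 * adj u"
proof (rule Proj_eqI)
  have uu: "adj u * (u * a) = a" "u * (adj u * a) = a" for a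
    using u_unitary by (simp_all add: unitary_def flip: mult.assoc)
  show "self_adj (u * p2 * adj u)" by (simp add: self_adj_def mult.assoc)
  show "u * p2 * adj u * (u * p2 * adj u) = u * p2 * adj u" by (simp add: mult.assoc uu)
  show "range (ap (u * p2 * adj u)) = final_space (u * p2)"
  proof -
    have "ap (u * p2) \<xi> = ap (u * p2 * adj u) (ap u \<xi>)" for \<xi>
    proof -
      have "u * p2 = u * p2 * adj u * u"
        using u_unitary by (simp add: unitary_def mult.assoc)
      then show ?thesis by (metis ap_bop(6))
    qed
    then show ?thesis unfolding final_space_def by auto
  qed
qed

text \<open>Conjugation by \<open>u\<close> turns a centred element of \<open>B\<close> into the word \<open>u b u\<^sup>*\<close>.\<close>

lemma final_projection_free: "tau_free \<tau> [u * p2 * adj u, h]"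
proof -
  define A where "A = {u * b * adj u |b. b \<in> B}"
  have uu: "adj u * u = 1" "u * adj u = 1" "adj u * (u * a) = a" for a
    using u_unitary by (simp_all add: unitary_def flip: mult.assoc)
  have "star_subalgebra A"
    unfolding star_subalgebra_def
  proof (intro conjI ballI allI)
    have "1 = u * 1 * adj u" by (simp add: uu)
    then show "1 \<in> A" unfolding A_def using B_simps(1) by blast
    fix a b assume "a \<in> A" "b \<in> A"
    then obtain s t where st: "a = u * s * adj u" "s \<in> B" "b = u * t * adj u" "t \<in> B"
      by (auto simp: A_def)
    have "a + b = u * (s + t) * adj u" "a * b = u * (s * t) * adj u"
      by (simp_all add: st distrib_left distrib_right mult.assoc uu)
    then show "a + b \<in> A" "a * b \<in> A" unfolding A_def using st B_simps(3,4) by blast+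
  next
    fix a c assume "a \<in> A"
    then obtain s where st: "a = u * s * adj u" "s \<in> B" by (auto simp: A_def)
    have "c *\<^sub>C a = u * (c *\<^sub>C s) * adj u" by (simp add: st)
    then show "c *\<^sub>C a \<in> A" unfolding A_def using st B_simps(5) by blast
  next
    fix a assume "a \<in> A"
    then obtain s where st: "a = u * s * adj u" "s \<in> B" by (auto simp: A_def)
    have "adj a = u * adj s * adj u" by (simp add: st mult.assoc)
    then show "adj a \<in> A" unfolding A_def using st B_simps(6) by blast
  qed
  moreover have "u * p2 * adj u \<in> A" unfolding A_def using p_in_B by blast
  ultimately have gA: "generated_star_subalgebra {u * p2 * adj u} \<subseteq> A"
    by (intro generated_minimal) auto
  have gB: "generated_star_subalgebra {h} \<subseteq> B"
    by (rule generated_minimal) (simp_all add: star_B)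
  \<comment> \<open>Here the coefficients are scalars: every centred element of \<open>A\<close> is
    a single word \<open>u * b * adj u\<close> with \<open>b\<close> centred.\<close>
  define S where "S = range (\<lambda>c. c *\<^sub>C (1 :: 'a bop))"
  have one: "1 \<in> S" unfolding S_def by (rule range_eqI[of _ _ 1]) simp
  have "free_wrt \<tau> {..<2} (\<lambda>i::nat. if i = 0 then A else B)"
    unfolding free_wrt_def
  proof (intro allI impI, elim conjE)
    fix w :: "(nat \<times> 'a bop) list"
    assume w: "w \<noteq> []" "distinct_adj (map fst w)"
      and W: "\<forall>(i, a)\<in>set w. i \<in> {..<2} \<and> a \<in> (if i = 0 then A else B) \<and> \<tau> a = 0"
    have "prod_list (map snd w) \<in> centred B \<union> words (centred C) (centred B) B B"
    proof (rule alternating_product_words[OF w, where D = S and KA = "centred A"])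
      show "i = 0 \<and> a \<in> centred A \<or> i = 1 \<and> a \<in> centred B" if "(i, a) \<in> set w" for i a
        using W that by (auto simp: centred_def split: if_splits)
      show "centred A \<subseteq> words (centred C) (centred B) S S"
      proof
        fix a assume a: "a \<in> centred A"
        then obtain b where b: "a = u * b * adj u" "b \<in> B" by (auto simp: centred_def A_def)
        then have "b \<in> M" using B_M by blast
        then have "\<tau> a = \<tau> (adj u * (u * b))"
          using uM unfolding b(1) by (subst tau_commute) auto
        then have "b \<in> centred B" using a b by (simp add: centred_def uu)
        then have "a \<in> altw (centred C) (centred B)"
          unfolding b(1) using u_centred by (intro altw.step altw.single)
        then show "a \<in> words (centred C) (centred B) S S"
          using words_single[OF one _ one] by fastforce
      qed
      show "d * b * d' \<in> centred B" if "d \<in> S" "b \<in> centred B" "d' \<in> S" for d b d'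
      proof -
        obtain s s' where "d = s *\<^sub>C 1" "d' = s' *\<^sub>C 1" using \<open>d \<in> S\<close> \<open>d' \<in> S\<close> by (auto simp: S_def)
        then show ?thesis using that B_M by (auto simp: centred_def tau_scaleC)
      qed
    qed (auto simp: S_def centred_def)
    then show "\<tau> (prod_list (map snd w)) = 0"
      using tau_words_C_B[of "prod_list (map snd w)"] by (auto simp: centred_def)
  qed
  then show ?thesis
    unfolding tau_free_pair by (rule free_wrt_mono) (use gA gB in auto)
qed

text \<open>Each component of \<open>E\<close> is, up to normalization, the trace of a word in
  powers of the unitary and elements of \<open>D\<close>. The relation pairs equal powers of
  \<open>u\<close> and \<open>u'\<close>, and every element of \<open>D\<close> with itself, so all
  joint moments agree.\<close>

lemma D_distribution_unique:
  assumes u': "u' \<in> M" "haar_unitary \<tau> u'" "tau_free \<tau> [u', p2]"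
  shows "D_distribution D E (u * p2) = D_distribution D E (u' * p2)"
  unfolding D_distribution_def
proof (rule restrict_ext)
  fix w :: "(bool \<times> 'a bop) list" assume w: "w \<in> {w. w \<noteq> [] \<and> snd ` set w \<subseteq> D}"
  define R where "R i = (if i = 0 then {(c *\<^sub>C upow u j, c *\<^sub>C upow u' j) |c j. True}
    else if i = 1 then {(d, d) |d. d \<in> D} else {})" for i :: nat
  define L :: "(nat \<times> 'a bop \<times> 'a bop) list" where "L = concat (map (\<lambda>(s, d). if s then [(1, p2, p2), (0, adj u, adj u'), (1, d, d)]
    else [(0, u, u'), (1, p2, p2), (1, d, d)]) w)"
  have un: "unitary u'" using u' by (simp add: haar_unitary_def)
  have L: "prod_list (map (fst \<circ> snd) L) = prod_list (map (\<lambda>(star, d). (if star then adj (u * p2) else u * p2) * d) w)"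
    "prod_list (map (snd \<circ> snd) L) = prod_list (map (\<lambda>(star, d). (if star then adj (u' * p2) else u' * p2) * d) w)"
    unfolding L_def by (induction w) (auto simp: mult.assoc split: if_splits)
  note Ds = star_subalgebraD[OF star_D]
  have R: "z \<in> R i" if "(i, z) \<in> set L" for i z
  proof -
    have "(upow u j, upow u' j) \<in> R 0" for j
      unfolding R_def by (auto intro!: exI[of _ 1] exI[of _ j])
    from this[of 1] this[of "-1"] have "(u, u') \<in> R 0" "(adj u, adj u') \<in> R 0" by (simp_all add: upow_simps)
    moreover have "(d, d) \<in> R 1" if "d \<in> D" for d using that by (auto simp: R_def)
    ultimately show ?thesis using that w p_in_D unfolding L_def by (fastforce split: if_splits)
  qed
  have eq: "\<tau> (p * prod_list (map (fst \<circ> snd) L) * p) = \<tau> (p * prod_list (map (snd \<circ> snd) L) * p)"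
    if p: "p \<in> D" for p
  proof -
    have pp: "(p, p) \<in> R 1" using p by (simp add: R_def)
    \<comment> \<open>The compressing projections become letters, which makes the compressed trace
      an ordinary joint moment.\<close>
    have "\<tau> (prod_list (map (fst \<circ> snd) ([(1, p, p)] @ L @ [(1, p, p)]))) =
      \<tau> (prod_list (map (snd \<circ> snd) ([(1, p, p)] @ L @ [(1, p, p)])))"
    proof (rule free_moments_eq[OF u_free_p2[unfolded tau_free_pair] u'(3)[unfolded tau_free_pair], of R])
      show "z \<in> R i" if "(i, z) \<in> set ([(1, p, p)] @ L @ [(1, p, p)])" for i z
        using that pp R[of i z] by auto
      fix i a a' assume a: "(a, a') \<in> R i"
      then consider c j where "i = 0" "a = c *\<^sub>C upow u j" "a' = c *\<^sub>C upow u' j" | "i = 1" "a = a'" "a \<in> D"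
        by (auto simp: R_def split: if_splits)
      note ac = this
      have gu: "upow u j \<in> C" "upow u' j \<in> generated_star_subalgebra {u'}" for j
        using generated_superset by (blast intro: upow_in star_subalgebra_generated)+
      note gc = star_subalgebraD(5)[OF star_subalgebra_generated gu(1)]
        star_subalgebraD(5)[OF star_subalgebra_generated gu(2)]
      have uM': "upow u j \<in> M" "upow u' j \<in> M" for j
        using uM u' by (simp_all add: upow_in[OF star_M])
      have tu: "\<tau> (upow u j) = \<tau> (upow u' j)" for j
        using tau_upow[OF haar, of j] tau_upow[OF u'(2), of j] by (cases "j = 0") (simp_all add: upow_simps)
      have gD: "D \<subseteq> generated_star_subalgebra {p2}"
        using generated_superset by (intro D_minimal star_subalgebra_generated) blast
      from ac show "i \<in> {..<2} \<and> a \<in> (if i = 0 then C else generated_star_subalgebra {p2}) \<and>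
         a' \<in> (if i = 0 then generated_star_subalgebra {u'} else generated_star_subalgebra {p2}) \<and>
         a \<in> M \<and> a' \<in> M \<and> \<tau> a = \<tau> a'"
        by cases (use gc uM' tu gD D_M in \<open>auto simp: tau_scaleC\<close>)
      from ac show "(a - \<tau> a *\<^sub>C 1, a' - \<tau> a' *\<^sub>C 1) \<in> R i"
      proof cases
        case (1 c j)
        show ?thesis
        proof (cases "j = 0")
          case True
          have "(0, 0) \<in> R 0" unfolding R_def by (auto intro!: exI[of _ 0])
          then show ?thesis using 1 True by (simp add: upow_simps tau_scaleC)
        next
          case False
          then show ?thesis using 1 a uM' tau_upow[OF haar] tau_upow[OF u'(2)] by (simp add: tau_scaleC)
        qed
      next
        case 2
        then show ?thesis using Ds by (auto simp: R_def)
      qed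
      fix b b' assume b: "(b, b') \<in> R i"
      from ac show "(a * b, a' * b') \<in> R i"
      proof cases
        case (1 c j)
        then obtain c' j' where "b = c' *\<^sub>C upow u j'" "b' = c' *\<^sub>C upow u' j'"
          using b by (auto simp: R_def)
        then have "(a * b, a' * b') = ((c' * c) *\<^sub>C upow u (j + j'), (c' * c) *\<^sub>C upow u' (j + j'))"
          using 1 by (simp add: upow_add u_unitary un)
        then show ?thesis using 1 unfolding R_def by auto
      next
        case 2
        then show ?thesis using b Ds by (auto simp: R_def)
      qed
    qed
    then show ?thesis by (simp add: mult.assoc o_def)
  qed
  show "E (prod_list (map (\<lambda>(star, d). (if star then adj (u * p2) else u * p2) * d) w)) =
    E (prod_list (map (\<lambda>(star, d). (if star then adj (u' * p2) else u' * p2) * d) w))"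
    using eq[OF p_in_D(1)] eq[OF p_in_D(2)] unfolding L by (rule E_eqI)
qed

lemma compressed_mult_p:
  assumes "p2 * a * p2 = a"
  shows "a * p1 = 0" "a * p2 = a" "p1 * a = 0" "p2 * a = a"
proof -
  have "p2 * a * p2 * p1 = 0" "p2 * a * p2 * p2 = p2 * a * p2"
    "p1 * (p2 * a * p2) = 0" "p2 * (p2 * a * p2) = p2 * a * p2"
    by (simp_all add: mult.assoc)
  then show "a * p1 = 0" "a * p2 = a" "p1 * a = 0" "p2 * a = a" by (simp_all only: assms)
qed

text \<open>An operator in the corner of \<open>p2\<close> sees only the \<open>p2\<close>
  coefficient of each letter from \<open>D\<close>. The scalar depends on the word alone, so it is
  the same for two operators under comparison.\<close>

lemma word_collapse:
  assumes "snd ` set w \<subseteq> D"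
  obtains c where "\<And>a. adj a = a \<Longrightarrow> p2 * a * p2 = a \<Longrightarrow>
    prod_list (map (\<lambda>(star, d). (if star then adj a else a) * d) w) * p2 = c *\<^sub>C (a ^ length w * p2)"
proof -
  have "\<exists>c. \<forall>a. adj a = a \<and> p2 * a * p2 = a \<longrightarrow>
    prod_list (map (\<lambda>(star, d). (if star then adj a else a) * d) w) * p2 = c *\<^sub>C (a ^ length w * p2)"
    using assms
  proof (induction w)
    case Nil
    then show ?case by (intro exI[of _ 1]) simp
  next
    case (Cons y w)
    then obtain c where c: "\<And>a. adj a = a \<Longrightarrow> p2 * a * p2 = a \<Longrightarrow>
      prod_list (map (\<lambda>(star, d). (if star then adj a else a) * d) w) * p2 = c *\<^sub>C (a ^ length w * p2)"
      by auto
    obtain s d where y: "y = (s, d)" by (cases y)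
    then obtain \<alpha> \<beta> where d: "d = \<alpha> *\<^sub>C p1 + \<beta> *\<^sub>C p2" using Cons.prems by (auto simp: span2_D)
    have "prod_list (map (\<lambda>(star, d). (if star then adj a else a) * d) (y # w)) * p2 =
      (\<beta> * c) *\<^sub>C (a ^ length (y # w) * p2)" if a: "adj a = a" "p2 * a * p2 = a" for a
    proof -
      have "a * d = \<beta> *\<^sub>C a" using compressed_mult_p[OF a(2)] by (simp add: d distrib_left)
      moreover have "prod_list (map (\<lambda>(star, d). (if star then adj a else a) * d) (y # w)) * p2 =
        (a * d) * (prod_list (map (\<lambda>(star, d). (if star then adj a else a) * d) w) * p2)"
        by (simp add: y a mult.assoc)
      ultimately show ?thesis by (simp only: c[OF a]) (simp add: mult.assoc mult.commute[of \<beta>])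
    qed
    then show ?case by blast
  qed
  then show thesis using that by blast
qed

text \<open>Words with trivial coefficients extract the even moments from the distribution of the
  square, and positivity then fixes all moments. A general word reduces to a scalar times one
  moment, with zero \<open>p1\<close> component.\<close>

lemma positive_part_unique:
  assumes a: "a \<in> M" "positive_op a" "p2 * a * p2 = a"
    and dist: "D_distribution D E (a * a) = D_distribution D E (h * h)"
  shows "D_distribution D E a = D_distribution D E h"
proof -
  have one: "1 \<in> D" by (rule star_subalgebraD[OF star_D])
  have sa: "adj a = a" using a by (simp add: positive_op_self_adj)
  note ca = compressed_mult_p[OF a(3)]
  \<comment> \<open>Distributions only record nonempty words; the moment with \<open>m = 0\<close>
    is trivial.\<close>
  have even: "\<tau> ((a * a) ^ m) = \<tau> ((h * h) ^ m)" for m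
  proof (cases m)
    case (Suc n)
    define w where "w = replicate m (False, 1 :: 'a bop)"
    have P: "prod_list (map (\<lambda>(star, d). (if star then adj b else b) * d) w) = b ^ m" for b
      unfolding w_def by (induction m) simp_all
    have "w \<noteq> []" "snd ` set w \<subseteq> D" using Suc one by (auto simp: w_def)
    then have "E ((a * a) ^ m) = E ((h * h) ^ m)"
      using fun_cong[OF dist, of w] by (simp add: D_distribution_def P)
    from E_eqD(2)[OF this] have "\<tau> (p2 * (a * a) ^ m * p2) = \<tau> (p2 * (h * h) ^ m * p2)" .
    moreover have "p2 * (b * b) ^ m * p2 = (b * b) ^ m" if "b * p2 = b" "p2 * b = b" for b
    proof -
      have "(b * b) ^ m = b * b * (b * b) ^ n" "(b * b) ^ m = (b * b) ^ n * (b * b)"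
        by (simp_all add: Suc power_commutes)
      then have "p2 * (b * b) ^ m = (b * b) ^ m" "(b * b) ^ m * p2 = (b * b) ^ m"
        using that by (metis mult.assoc)+
      then show ?thesis by simp
    qed
    ultimately show ?thesis using ca by simp
  qed simp
  have mom: "\<tau> (a ^ n) = \<tau> (h ^ n)" for n
    using moments_determined_by_even[OF a(1,2) hM h_pos even] .
  show ?thesis
    unfolding D_distribution_def
  proof (rule restrict_ext)
    fix w :: "(bool \<times> 'a bop) list" assume w: "w \<in> {w. w \<noteq> [] \<and> snd ` set w \<subseteq> D}"
    let ?P = "\<lambda>b. prod_list (map (\<lambda>(star, d). (if star then adj b else b) * d) w)"
    obtain c where c: "\<And>b. adj b = b \<Longrightarrow> p2 * b * p2 = b \<Longrightarrow> ?P b * p2 = c *\<^sub>C (b ^ length w * p2)"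
      using word_collapse[of w] w by blast
    obtain n where n: "length w = Suc n" using w by (cases w) auto
    have t: "\<tau> (p1 * ?P b * p1) = 0 \<and> \<tau> (p2 * ?P b * p2) = c * \<tau> (b ^ length w)"
      if b: "adj b = b" "p2 * b * p2 = b" "b \<in> M" for b
    proof
      note cb = compressed_mult_p[OF b(2)]
      obtain s d w' where w': "w = (s, d) # w'" using w by (cases w) auto
      have "?P b = b * (d * prod_list (map (\<lambda>(star, d). (if star then adj b else b) * d) w'))"
        by (simp add: w' b mult.assoc)
      then have "p1 * ?P b = 0" using cb(3) by (simp flip: mult.assoc)
      then show "\<tau> (p1 * ?P b * p1) = 0" by simp
      have "b ^ length w * p2 = b ^ length w"
        unfolding n power_Suc2 using cb by (simp add: mult.assoc)
      moreover have "p2 * b ^ length w = b ^ length w"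
        unfolding n power_Suc using cb by (simp flip: mult.assoc)
      ultimately have "p2 * ?P b * p2 = c *\<^sub>C b ^ length w"
        using c[OF b(1,2)] by (simp add: mult.assoc)
      then show "\<tau> (p2 * ?P b * p2) = c * \<tau> (b ^ length w)" using b by (simp add: tau_scaleC)
    qed
    show "E (?P a) = E (?P h)"
      using t[OF sa a(3,1)] t[of h] hM mom by (intro E_eqI) simp_all
  qed
qed

end

theorem corollary3p5:
  fixes M :: "'a::chilbert_space bop set" and \<tau> :: "'a bop \<Rightarrow> complex"
    and x p1 p2 v h :: "'a bop" and D :: "'a bop set" and E :: "'a bop \<Rightarrow> 'a bop"
  assumes "wstar_prob_space M \<tau>"
    and "x \<in> M" and "x \<noteq> 0" and "R_diagonal M \<tau> x" and "ker_op x \<noteq> {0}"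
    and "p1 = Proj (ker_op x)" and "p2 = 1 - p1"
    and "D = span2 p1 p2" and "E = cond_exp \<tau> p1 p2"
    and "polar_decomposition x v h"
  shows "amalgamated_free M D E [v, h] \<and>
    ((\<exists>u\<in>M. haar_unitary \<tau> u \<and> tau_free \<tau> [u, p2]) \<and>
     (\<forall>u\<in>M. haar_unitary \<tau> u \<and> tau_free \<tau> [u, p2] \<longrightarrow>
        D_distribution D E v = D_distribution D E (u * p2))) \<and>
    (h * h = adj x * x \<and> p2 * h * p2 = h \<and>
     (\<forall>k\<in>M. positive_op k \<and> D_distribution D E (k * k) = D_distribution D E (adj x * x) \<and>
        p2 * k * p2 = k \<longrightarrow> D_distribution D E k = D_distribution D E h)) \<and>
    tau_free \<tau> [Proj (final_space v), h]"
proof -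
  obtain u h0 where u: "u \<in> M" "h0 \<in> M" "haar_unitary \<tau> u" "positive_op h0" "tau_free \<tau> [u, h0]"
    and x: "x = u * h0"
    using assms(4) by (auto simp: R_diagonal_def)
  have un: "unitary u" using u by (simp add: haar_unitary_def)
  note pol = polar_identification[OF un u(4) x assms(10)]
  have h0: "h0 = h" using pol(1) by simp
  have v: "v = u * p2" using pol(2) assms(6,7) by simp
  have rng: "range (ap p1) = ker_op x" unfolding assms(6) by (rule Proj_ker)
  have "p1 \<noteq> 0" using rng assms(5) by (auto simp: image_iff)
  moreover have "p2 \<noteq> 0"
  proof
    \<comment> \<open>Vanishing of \<open>p2\<close> would make the kernel the whole space,
      contradicting \<open>x \<noteq> 0\<close>; this secures the second denominator of
      \<open>E\<close>.\<close>
    assume "p2 = 0"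
    then have "p1 = 1" using assms(7) by simp
    then have "ker_op x = UNIV" using rng by auto
    then have "ap x \<xi> = 0" for \<xi> unfolding ker_op_def by blast
    then show False using assms(3) bop_eqI[of x 0] by simp
  qed
  ultimately interpret r_diagonal_pair M \<tau> u h p1 p2
    using assms(1,6,7) u pol(3) by unfold_locales (simp_all add: h0)
  have hh: "h * h = adj x * x"
  proof -
    have "adj x * x = h * (adj u * u) * h" by (simp add: x h0 mult.assoc)
    then show ?thesis using un by (simp add: unitary_def)
  qed
  show ?thesis
    unfolding assms(8,9) v Proj_final_space hh[symmetric]
    using polar_parts_amalgamated_free u(1,3) u_free_p2 D_distribution_unique positive_part_unique
      final_projection_free by auto
qed

end
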